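(* Let $(M,g,J)$ be a complete, non-compact, almost Hermitian manifold of dimension at least $4$, with essential subset $K$, and let $r$ be the distance function to $K$. Assume that for some $a>1$ one has $\|R-R^0\|_g=\mathcal O(e^{-ar})$ and $\|\nabla J\|_g=\mathcal O(e^{-ar})$. Let $\eta^0=\lim_{r\to\infty}\eta^0_r$, $\gamma=\lim_{r\to\infty}\gamma_r$ and $\varphi=\lim_{r\to\infty}\varphi_r$ be the continuous limit tensors on $\partial K$ (defined in the context). Then the restriction $J_0=\varphi|_{H_0}$ of $\varphi$ to the hyperplane distribution $H_0=\ker\eta^0$ induces an almost complex structure on $H_0$ (i.e. $J_0$ maps $H_0$ to itself and $J_0^2=-\mathrm{Id}$), and $\gamma^0=\gamma|_{H_0\times H_0}$ is $J_0$-invariant.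
   Context: $\nabla$ is the Levi-Civita connection of $g$; $R(X,Y)Z=\nabla_{[X,Y]}Z-\nabla_X(\nabla_YZ)+\nabla_Y(\nabla_XZ)$, $R(X,Y,Z,T)=g(R(X,Y)Z,T)$, so $\sec(u,v)=R(u,v,u,v)$ for orthonormal $u,v$. Almost Hermitian means $J$ is an almost complex structure with $g(JX,JY)=g(X,Y)$. The tensor $R^0$ is $$R^0(X,Y)Z=\tfrac14\big(g(Y,Z)X-g(X,Z)Y+g(JY,Z)JX-g(JX,Z)JY+2g(X,JY)JZ\big).$$ An essential subset $K\subset M$ is a codimension $0$, compact, totally convex submanifold with smooth boundary $\partial K$, oriented by a unit outward normal field $\nu$, with $\sec<0$ on $M\setminus K$. The normal exponential map $\mathcal E:\mathbb R_+\times\partial K\to\overline{M\setminus K}$, $\mathcal E(r,p)=\exp_p(r\nu_p)$, is then a diffeomorphism; $\partial K_r$ is the level set at distance $r$ from $K$, $\mathcal E_r=\mathcal E(r,\cdot):\partial K\to\partial K_r$, $g_r=\mathcal E_r^*g$, $g_0=g|_{\partial K}$, and $\partial_r=\nabla r$. For a vector field $v$ on $\partial K$ with parallel transport $V$ along the radial geodesics $r\mapsto\mathcal E(r,p)$, set $\beta_r(v)=g(J\partial_r,V)|_{\partial K_r}$ (a $1$-form on $\partial K$). Under the assumption on $\nabla J$, $\beta_r$ converges uniformly to a continuous $1$-form $\beta$ with $\|\beta\|_{g_0}=1$. Let $e_0$ be the unique $g_0$-unit vector field on $\partial K$ that is $g_0$-orthogonal to $\ker\beta$ and satisfies $\beta(e_0)>0$,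 and let $E_0$ be its parallel transport along radial geodesics. Set $\eta^0_r=\mathcal E_r^*(e^{-r}g(\cdot,E_0))$ and $\gamma_r=e^{-r}(g_r-e^{2r}\eta^0_r\otimes\eta^0_r)$. Let $\pi$ be the orthogonal projection onto $\{\partial_r\}^\perp$, $\Phi=\pi J\pi$, and $\varphi_r=\mathcal E_r^*\Phi$ (a field of endomorphisms of $T\partial K$). Under the stated hypotheses the uniform limits $\eta^0,\gamma,\varphi$ of $\eta^0_r,\gamma_r,\varphi_r$ as $r\to\infty$ exist and are continuous, and $\eta^0$ is nowhere vanishing. *)

theory Defs
  imports "HOL-Analysis.Analysis" "HOL-Library.Landau_Symbols"
begin

section \<open>Smooth manifolds\<close>

text \<open>The sets on which the next two notions are used are always open.\<close>

primrec Ck_on :: "nat \<Rightarrow> 'a::real_normed_vector set \<Rightarrow> ('a \<Rightarrow> 'b::real_normed_vector) \<Rightarrow> bool" where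
  "Ck_on 0 S f \<longleftrightarrow> continuous_on S f"
| "Ck_on (Suc k) S f \<longleftrightarrow>
     (\<forall>x\<in>S. f differentiable (at x)) \<and> (\<forall>v. Ck_on k S (\<lambda>x. frechet_derivative f (at x) v))"

definition smooth_on :: "'a::real_normed_vector set \<Rightarrow> ('a \<Rightarrow> 'b::real_normed_vector) \<Rightarrow> bool" where
  "smooth_on S f \<longleftrightarrow> (\<forall>k. Ck_on k S f)"

text \<open>A chart is a pair of its domain and its coordinate map. The points of a manifold are all
  the elements of a type; a manifold is given by an atlas on that type.\<close>

type_synonym ('m, 'e) chart = "'m set \<times> ('m \<Rightarrow> 'e)"

definition chart_inv :: "('m, 'e) chart \<Rightarrow> 'e \<Rightarrow> 'm" where
  "chart_inv c = inv_into (fst c) (snd c)"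

definition is_chart :: "('m::topological_space, 'e::euclidean_space) chart \<Rightarrow> bool" where
  "is_chart c \<longleftrightarrow> open (fst c) \<and> open (snd c ` fst c) \<and> inj_on (snd c) (fst c) \<and>
     continuous_on (fst c) (snd c) \<and> continuous_on (snd c ` fst c) (chart_inv c)"

definition smooth_atlas :: "('m::topological_space, 'e::euclidean_space) chart set \<Rightarrow> bool" where
  "smooth_atlas A \<longleftrightarrow> (\<forall>c\<in>A. is_chart c) \<and> (\<Union>c\<in>A. fst c) = UNIV \<and>
     (\<forall>c\<in>A. \<forall>d\<in>A. smooth_on (snd c ` (fst c \<inter> fst d)) (snd d \<circ> chart_inv c))"

definition maximal_atlas ::
    "('m::topological_space, 'e::euclidean_space) chart set \<Rightarrow> ('m, 'e) chart set" where
  "maximal_atlas A = {c. smooth_atlas (insert c A)}"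

text \<open>A chart around each point is chosen once and for all, and the tangent space at \<open>p\<close> is
  identified with the model space \<open>'e\<close> through the chosen chart \<open>chart_at A p\<close>. So a vector field
  is a function \<open>'m \<Rightarrow> 'e\<close>, a field of bilinear forms a function \<open>'m \<Rightarrow> 'e \<Rightarrow> 'e \<Rightarrow> real\<close>, etc.; no
  regularity in \<open>p\<close> of these functions is meaningful before passing to a chart with \<open>coord\<close>
  and \<open>vec\<close>.\<close>

definition chart_at :: "('m, 'e) chart set \<Rightarrow> 'm \<Rightarrow> ('m, 'e) chart" where
  "chart_at A p = (SOME c. c \<in> A \<and> p \<in> fst c)"

text \<open>\<open>coord A c p v\<close>: components in the chart \<open>c\<close> of the tangent vector \<open>v\<close> at \<open>p\<close>;
  \<open>vec A c p u\<close>: the tangent vector at \<open>p\<close> with components \<open>u\<close> in the chart \<open>c\<close>.\<close>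

definition coord :: "('m, 'e::euclidean_space) chart set \<Rightarrow> ('m, 'e) chart \<Rightarrow> 'm \<Rightarrow> 'e \<Rightarrow> 'e" where
  "coord A c p v =
     frechet_derivative (snd c \<circ> chart_inv (chart_at A p)) (at (snd (chart_at A p) p)) v"

definition vec :: "('m, 'e::euclidean_space) chart set \<Rightarrow> ('m, 'e) chart \<Rightarrow> 'm \<Rightarrow> 'e \<Rightarrow> 'e" where
  "vec A c p u = frechet_derivative (snd (chart_at A p) \<circ> chart_inv c) (at (snd c p)) u"

definition real_atlas :: "(real, real) chart set" where
  "real_atlas = {(UNIV, id)}"

definition prod_atlas ::
    "('m, 'e) chart set \<Rightarrow> ('n, 'f) chart set \<Rightarrow> ('m \<times> 'n, 'e \<times> 'f) chart set" where
  "prod_atlas A B = {(fst c \<times> fst d, map_prod (snd c) (snd d)) |c d. c \<in> A \<and> d \<in> B}"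

text \<open>Smoothness on an open set \<open>W\<close>, and on an arbitrary set \<open>S\<close> (existence of local smooth
  extensions).\<close>

definition smooth_map ::
    "('m::topological_space, 'e::euclidean_space) chart set \<Rightarrow>
     ('n::topological_space, 'f::euclidean_space) chart set \<Rightarrow> 'm set \<Rightarrow> ('m \<Rightarrow> 'n) \<Rightarrow> bool" where
  "smooth_map A B W f \<longleftrightarrow> continuous_on W f \<and>
     (\<forall>c\<in>A. \<forall>d\<in>B. smooth_on (snd c ` (fst c \<inter> W \<inter> f -` fst d)) (snd d \<circ> f \<circ> chart_inv c))"

definition smooth_map_on ::
    "('m::topological_space, 'e::euclidean_space) chart set \<Rightarrow>
     ('n::topological_space, 'f::euclidean_space) chart set \<Rightarrow> 'm set \<Rightarrow> ('m \<Rightarrow> 'n) \<Rightarrow> bool" where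
  "smooth_map_on A B S f \<longleftrightarrow>
     (\<forall>p\<in>S. \<exists>W h. open W \<and> p \<in> W \<and> smooth_map A B W h \<and> (\<forall>q\<in>S \<inter> W. h q = f q))"

definition diffeo_between ::
    "('m::topological_space, 'e::euclidean_space) chart set \<Rightarrow>
     ('n::topological_space, 'f::euclidean_space) chart set \<Rightarrow>
     'm set \<Rightarrow> 'n set \<Rightarrow> ('m \<Rightarrow> 'n) \<Rightarrow> bool" where
  "diffeo_between A B S T f \<longleftrightarrow> bij_betw f S T \<and> smooth_map_on A B S f \<and>
     smooth_map_on B A T (inv_into S f)"

definition velocity ::
    "('m, 'e::euclidean_space) chart set \<Rightarrow> (real \<Rightarrow> 'm) \<Rightarrow> real \<Rightarrow> 'e" where
  "velocity A \<sigma> t = vector_derivative (snd (chart_at A (\<sigma> t)) \<circ> \<sigma>) (at t)"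

text \<open>Tangent space of a submanifold \<open>S\<close> and differential of a map defined on \<open>S\<close>, by means of
  smooth curves lying in \<open>S\<close>.\<close>

definition curve_through ::
    "('m::topological_space, 'e::euclidean_space) chart set \<Rightarrow> 'm set \<Rightarrow>
     (real \<Rightarrow> 'm) \<Rightarrow> 'm \<Rightarrow> 'e \<Rightarrow> bool" where
  "curve_through A S \<sigma> p v \<longleftrightarrow>
     (\<exists>\<epsilon>>0. smooth_map real_atlas A {-\<epsilon><..<\<epsilon>} \<sigma> \<and> \<sigma> ` {-\<epsilon><..<\<epsilon>} \<subseteq> S) \<and>
     \<sigma> 0 = p \<and> velocity A \<sigma> 0 = v"

definition tangent_space ::
    "('m::topological_space, 'e::euclidean_space) chart set \<Rightarrow> 'm set \<Rightarrow> 'm \<Rightarrow> 'e set" where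
  "tangent_space A S p = {v. \<exists>\<sigma>. curve_through A S \<sigma> p v}"

definition differential ::
    "('m::topological_space, 'e::euclidean_space) chart set \<Rightarrow> 'm set \<Rightarrow>
     ('m \<Rightarrow> 'm) \<Rightarrow> 'm \<Rightarrow> 'e \<Rightarrow> 'e" where
  "differential A S f p v =
     (THE w. \<exists>\<sigma>. curve_through A S \<sigma> p v \<and> w = velocity A (f \<circ> \<sigma>) 0)"


section \<open>Riemannian and almost Hermitian geometry\<close>

definition metric_rep ::
    "('m, 'e::euclidean_space) chart set \<Rightarrow> ('m \<Rightarrow> 'e \<Rightarrow> 'e \<Rightarrow> real) \<Rightarrow>
     ('m, 'e) chart \<Rightarrow> 'e \<Rightarrow> 'e \<Rightarrow> 'e \<Rightarrow> real" where
  "metric_rep A g c x u v =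
     (let q = chart_inv c x in g q (vec A c q u) (vec A c q v))"

definition riemannian_metric ::
    "('m::topological_space, 'e::euclidean_space) chart set \<Rightarrow> ('m \<Rightarrow> 'e \<Rightarrow> 'e \<Rightarrow> real) \<Rightarrow> bool" where
  "riemannian_metric A g \<longleftrightarrow>
     (\<forall>p. bilinear (g p) \<and> (\<forall>u v. g p u v = g p v u) \<and> (\<forall>v. v \<noteq> 0 \<longrightarrow> g p v v > 0)) \<and>
     (\<forall>c\<in>A. \<forall>u v. smooth_on (snd c ` fst c) (\<lambda>x. metric_rep A g c x u v))"

definition gnorm :: "('m \<Rightarrow> 'e \<Rightarrow> 'e \<Rightarrow> real) \<Rightarrow> 'm \<Rightarrow> 'e \<Rightarrow> real" where
  "gnorm g p v = sqrt (g p v v)"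

definition almost_hermitian ::
    "('m::topological_space, 'e::euclidean_space) chart set \<Rightarrow> ('m \<Rightarrow> 'e \<Rightarrow> 'e \<Rightarrow> real) \<Rightarrow>
     ('m \<Rightarrow> 'e \<Rightarrow> 'e) \<Rightarrow> bool" where
  "almost_hermitian A g J \<longleftrightarrow> riemannian_metric A g \<and>
     (\<forall>p. linear (J p) \<and> (\<forall>v. J p (J p v) = - v) \<and> (\<forall>u v. g p (J p u) (J p v) = g p u v)) \<and>
     (\<forall>c\<in>A. \<forall>u. smooth_on (snd c ` fst c)
        (\<lambda>x. let q = chart_inv c x in coord A c q (J q (vec A c q u))))"

text \<open>The Levi-Civita connection. At \<open>p\<close> everything is computed in the chart \<open>chart_at A p\<close>, in
  which components of tangent vectors at \<open>p\<close> are the vectors themselves; \<open>christoffel A g p u v\<close>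
  is the vector with components \<open>\<Gamma>\<^sup>k\<^sub>i\<^sub>j u\<^sup>i v\<^sup>j\<close>, given by the Koszul formula for coordinate fields.\<close>

definition christoffel ::
    "('m, 'e::euclidean_space) chart set \<Rightarrow> ('m \<Rightarrow> 'e \<Rightarrow> 'e \<Rightarrow> real) \<Rightarrow> 'm \<Rightarrow> 'e \<Rightarrow> 'e \<Rightarrow> 'e" where
  "christoffel A g p u v =
     (let c = chart_at A p;
          dG = (\<lambda>a b d. frechet_derivative (\<lambda>x. metric_rep A g c x b d) (at (snd c p)) a)
      in THE w. \<forall>z. g p w z = (dG u v z + dG v u z - dG z u v) / 2)"

definition field_rep ::
    "('m, 'e::euclidean_space) chart set \<Rightarrow> ('m, 'e) chart \<Rightarrow> ('m \<Rightarrow> 'e) \<Rightarrow> 'e \<Rightarrow> 'e" where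
  "field_rep A c Y x = coord A c (chart_inv c x) (Y (chart_inv c x))"

definition field_deriv ::
    "('m, 'e::euclidean_space) chart set \<Rightarrow> ('m \<Rightarrow> 'e) \<Rightarrow> 'm \<Rightarrow> 'e \<Rightarrow> 'e" where
  "field_deriv A Y p u =
     frechet_derivative (field_rep A (chart_at A p) Y) (at (snd (chart_at A p) p)) u"

definition nabla ::
    "('m, 'e::euclidean_space) chart set \<Rightarrow> ('m \<Rightarrow> 'e \<Rightarrow> 'e \<Rightarrow> real) \<Rightarrow>
     ('m \<Rightarrow> 'e) \<Rightarrow> ('m \<Rightarrow> 'e) \<Rightarrow> 'm \<Rightarrow> 'e" where
  "nabla A g X Y p = field_deriv A Y p (X p) + christoffel A g p (X p) (Y p)"

definition lie_bracket ::
    "('m, 'e::euclidean_space) chart set \<Rightarrow> ('m \<Rightarrow> 'e) \<Rightarrow> ('m \<Rightarrow> 'e) \<Rightarrow> 'm \<Rightarrow> 'e" where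
  "lie_bracket A X Y p = field_deriv A Y p (X p) - field_deriv A X p (Y p)"

definition curvature ::
    "('m, 'e::euclidean_space) chart set \<Rightarrow> ('m \<Rightarrow> 'e \<Rightarrow> 'e \<Rightarrow> real) \<Rightarrow>
     ('m \<Rightarrow> 'e) \<Rightarrow> ('m \<Rightarrow> 'e) \<Rightarrow> ('m \<Rightarrow> 'e) \<Rightarrow> 'm \<Rightarrow> 'e" where
  "curvature A g X Y Z p =
     nabla A g (lie_bracket A X Y) Z p - nabla A g X (nabla A g Y Z) p + nabla A g Y (nabla A g X Z) p"

text \<open>Values of tensors at a point are computed on an extension of the tangent vectors to smooth
  vector fields near \<open>p\<close>; we take the one with constant components in \<open>chart_at A p\<close>.\<close>

definition extend ::
    "('m, 'e::euclidean_space) chart set \<Rightarrow> 'm \<Rightarrow> 'e \<Rightarrow> 'm \<Rightarrow> 'e" where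
  "extend A p u q = vec A (chart_at A p) q u"

definition curv ::
    "('m, 'e::euclidean_space) chart set \<Rightarrow> ('m \<Rightarrow> 'e \<Rightarrow> 'e \<Rightarrow> real) \<Rightarrow>
     'm \<Rightarrow> 'e \<Rightarrow> 'e \<Rightarrow> 'e \<Rightarrow> 'e" where
  "curv A g p u v w = curvature A g (extend A p u) (extend A p v) (extend A p w) p"

definition nabla_J ::
    "('m, 'e::euclidean_space) chart set \<Rightarrow> ('m \<Rightarrow> 'e \<Rightarrow> 'e \<Rightarrow> real) \<Rightarrow> ('m \<Rightarrow> 'e \<Rightarrow> 'e) \<Rightarrow>
     'm \<Rightarrow> 'e \<Rightarrow> 'e \<Rightarrow> 'e" where
  "nabla_J A g J p u v =
     nabla A g (extend A p u) (\<lambda>q. J q (extend A p v q)) p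
     - J p (nabla A g (extend A p u) (extend A p v) p)"

definition R0 ::
    "('m \<Rightarrow> 'e::euclidean_space \<Rightarrow> 'e \<Rightarrow> real) \<Rightarrow> ('m \<Rightarrow> 'e \<Rightarrow> 'e) \<Rightarrow> 'm \<Rightarrow> 'e \<Rightarrow> 'e \<Rightarrow> 'e \<Rightarrow> 'e" where
  "R0 g J p x y z = (1/4) *\<^sub>R
     (g p y z *\<^sub>R x - g p x z *\<^sub>R y + g p (J p y) z *\<^sub>R J p x - g p (J p x) z *\<^sub>R J p y
      + (2 * g p x (J p y)) *\<^sub>R J p z)"

text \<open>Pointwise operator norms of tensors.\<close>

definition tensor_norm2 ::
    "('m \<Rightarrow> 'e \<Rightarrow> 'e \<Rightarrow> real) \<Rightarrow> 'm \<Rightarrow> ('e \<Rightarrow> 'e \<Rightarrow> 'e) \<Rightarrow> real" where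
  "tensor_norm2 g p T = Sup {gnorm g p (T u v) |u v. gnorm g p u \<le> 1 \<and> gnorm g p v \<le> 1}"

definition tensor_norm3 ::
    "('m \<Rightarrow> 'e \<Rightarrow> 'e \<Rightarrow> real) \<Rightarrow> 'm \<Rightarrow> ('e \<Rightarrow> 'e \<Rightarrow> 'e \<Rightarrow> 'e) \<Rightarrow> real" where
  "tensor_norm3 g p T =
     Sup {gnorm g p (T u v w) |u v w. gnorm g p u \<le> 1 \<and> gnorm g p v \<le> 1 \<and> gnorm g p w \<le> 1}"

text \<open>\<open>has_covd A g \<sigma> V t W\<close>: the covariant derivative at time \<open>t\<close> of the vector field \<open>V\<close> along the
  curve \<open>\<sigma>\<close> exists and equals \<open>W\<close>.\<close>

definition has_covd ::
    "('m, 'e::euclidean_space) chart set \<Rightarrow> ('m \<Rightarrow> 'e \<Rightarrow> 'e \<Rightarrow> real) \<Rightarrow>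
     (real \<Rightarrow> 'm) \<Rightarrow> (real \<Rightarrow> 'e) \<Rightarrow> real \<Rightarrow> 'e \<Rightarrow> bool" where
  "has_covd A g \<sigma> V t W \<longleftrightarrow>
     ((\<lambda>s. coord A (chart_at A (\<sigma> t)) (\<sigma> s) (V s)) has_vector_derivative
        (W - christoffel A g (\<sigma> t) (velocity A \<sigma> t) (V t))) (at t)"

definition geodesic ::
    "('m::topological_space, 'e::euclidean_space) chart set \<Rightarrow> ('m \<Rightarrow> 'e \<Rightarrow> 'e \<Rightarrow> real) \<Rightarrow>
     (real \<Rightarrow> 'm) \<Rightarrow> bool" where
  "geodesic A g \<sigma> \<longleftrightarrow> smooth_map real_atlas A UNIV \<sigma> \<and> (\<forall>t. has_covd A g \<sigma> (velocity A \<sigma>) t 0)"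

text \<open>Geodesic completeness, equivalent to metric completeness by Hopf--Rinow.\<close>

definition complete_metric ::
    "('m::topological_space, 'e::euclidean_space) chart set \<Rightarrow> ('m \<Rightarrow> 'e \<Rightarrow> 'e \<Rightarrow> real) \<Rightarrow> bool" where
  "complete_metric A g \<longleftrightarrow> (\<forall>p v. \<exists>\<sigma>. geodesic A g \<sigma> \<and> \<sigma> 0 = p \<and> velocity A \<sigma> 0 = v)"

definition riem_exp ::
    "('m::topological_space, 'e::euclidean_space) chart set \<Rightarrow> ('m \<Rightarrow> 'e \<Rightarrow> 'e \<Rightarrow> real) \<Rightarrow>
     'm \<Rightarrow> 'e \<Rightarrow> 'm" where
  "riem_exp A g p v =
     (THE q. \<exists>\<sigma>. geodesic A g \<sigma> \<and> \<sigma> 0 = p \<and> velocity A \<sigma> 0 = v \<and> q = \<sigma> 1)"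

definition parallel_transport ::
    "('m, 'e::euclidean_space) chart set \<Rightarrow> ('m \<Rightarrow> 'e \<Rightarrow> 'e \<Rightarrow> real) \<Rightarrow>
     (real \<Rightarrow> 'm) \<Rightarrow> real \<Rightarrow> 'e \<Rightarrow> 'e" where
  "parallel_transport A g \<sigma> t v =
     (THE w. \<exists>V. (\<forall>s. has_covd A g \<sigma> V s 0) \<and> V 0 = v \<and> V t = w)"

definition piecewise_smooth ::
    "('m::topological_space, 'e::euclidean_space) chart set \<Rightarrow> (real \<Rightarrow> 'm) \<Rightarrow> bool" where
  "piecewise_smooth A \<sigma> \<longleftrightarrow>
     (\<exists>ts. ts \<noteq> [] \<and> sorted ts \<and> hd ts = 0 \<and> last ts = 1 \<and>
        (\<forall>i. Suc i < length ts \<longrightarrow> smooth_map_on real_atlas A {ts ! i..ts ! Suc i} \<sigma>))"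

definition curve_length ::
    "('m, 'e::euclidean_space) chart set \<Rightarrow> ('m \<Rightarrow> 'e \<Rightarrow> 'e \<Rightarrow> real) \<Rightarrow> (real \<Rightarrow> 'm) \<Rightarrow> real" where
  "curve_length A g \<sigma> = integral {0..1} (\<lambda>t. gnorm g (\<sigma> t) (velocity A \<sigma> t))"

definition distance_to ::
    "('m::topological_space, 'e::euclidean_space) chart set \<Rightarrow> ('m \<Rightarrow> 'e \<Rightarrow> 'e \<Rightarrow> real) \<Rightarrow>
     'm set \<Rightarrow> 'm \<Rightarrow> real" where
  "distance_to A g K p =
     Inf {curve_length A g \<sigma> |\<sigma>. piecewise_smooth A \<sigma> \<and> \<sigma> 0 \<in> K \<and> \<sigma> 1 = p}"

definition gradient ::
    "('m, 'e::euclidean_space) chart set \<Rightarrow> ('m \<Rightarrow> 'e \<Rightarrow> 'e \<Rightarrow> real) \<Rightarrow> ('m \<Rightarrow> real) \<Rightarrow> 'm \<Rightarrow> 'e" where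
  "gradient A g f p =
     (THE w. \<forall>v. g p w v =
        frechet_derivative (f \<circ> chart_inv (chart_at A p)) (at (snd (chart_at A p) p)) v)"


section \<open>Essential subsets and the normal exponential map\<close>

definition codim0_submanifold ::
    "('m::topological_space, 'e::euclidean_space) chart set \<Rightarrow> 'm set \<Rightarrow> bool" where
  "codim0_submanifold A K \<longleftrightarrow> K \<noteq> {} \<and> closed K \<and>
     (\<forall>p\<in>frontier K. \<exists>c\<in>maximal_atlas A. \<exists>b. b \<noteq> 0 \<and> p \<in> fst c \<and> snd c p \<bullet> b = 0 \<and>
        fst c \<inter> K = {q \<in> fst c. snd c q \<bullet> b \<le> 0})"

definition totally_convex ::
    "('m::topological_space, 'e::euclidean_space) chart set \<Rightarrow> ('m \<Rightarrow> 'e \<Rightarrow> 'e \<Rightarrow> real) \<Rightarrow>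
     'm set \<Rightarrow> bool" where
  "totally_convex A g K \<longleftrightarrow>
     (\<forall>\<sigma> s t. geodesic A g \<sigma> \<and> s \<le> t \<and> \<sigma> s \<in> K \<and> \<sigma> t \<in> K \<longrightarrow> \<sigma> ` {s..t} \<subseteq> K)"

definition outward_unit_normal ::
    "('m::topological_space, 'e::euclidean_space) chart set \<Rightarrow> ('m \<Rightarrow> 'e \<Rightarrow> 'e \<Rightarrow> real) \<Rightarrow>
     'm set \<Rightarrow> ('m \<Rightarrow> 'e) \<Rightarrow> bool" where
  "outward_unit_normal A g K \<nu> \<longleftrightarrow>
     (\<forall>p\<in>frontier K. g p (\<nu> p) (\<nu> p) = 1 \<and>
        (\<forall>v\<in>tangent_space A (frontier K) p. g p (\<nu> p) v = 0) \<and>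
        (\<forall>\<sigma>. curve_through A UNIV \<sigma> p (\<nu> p) \<longrightarrow> (\<forall>\<^sub>F t in at_right 0. \<sigma> t \<notin> K)))"

definition negative_sec_on ::
    "('m, 'e::euclidean_space) chart set \<Rightarrow> ('m \<Rightarrow> 'e \<Rightarrow> 'e \<Rightarrow> real) \<Rightarrow> 'm set \<Rightarrow> bool" where
  "negative_sec_on A g S \<longleftrightarrow>
     (\<forall>p\<in>S. \<forall>u v. g p u u = 1 \<and> g p v v = 1 \<and> g p u v = 0 \<longrightarrow> g p (curv A g p u v u) v < 0)"

definition essential_subset ::
    "('m::topological_space, 'e::euclidean_space) chart set \<Rightarrow> ('m \<Rightarrow> 'e \<Rightarrow> 'e \<Rightarrow> real) \<Rightarrow>
     'm set \<Rightarrow> ('m \<Rightarrow> 'e) \<Rightarrow> bool" where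
  "essential_subset A g K \<nu> \<longleftrightarrow> compact K \<and> codim0_submanifold A K \<and> totally_convex A g K \<and>
     outward_unit_normal A g K \<nu> \<and> negative_sec_on A g (- K)"

definition normal_exp ::
    "('m::topological_space, 'e::euclidean_space) chart set \<Rightarrow> ('m \<Rightarrow> 'e \<Rightarrow> 'e \<Rightarrow> real) \<Rightarrow>
     ('m \<Rightarrow> 'e) \<Rightarrow> real \<Rightarrow> 'm \<Rightarrow> 'm" where
  "normal_exp A g \<nu> r p = riem_exp A g p (r *\<^sub>R \<nu> p)"

text \<open>\<open>bdry_tangent A K p\<close> is the tangent space of \<open>\<partial>K\<close> at \<open>p\<close>, and \<open>d_exp A g K \<nu> r p\<close> the
  differential there of \<open>\<E>\<^sub>r\<close>. Tensors on \<open>\<partial>K\<close> only matter on vectors of \<open>bdry_tangent A K p\<close>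
  for \<open>p \<in> \<partial>K\<close>.\<close>

definition bdry_tangent ::
    "('m::topological_space, 'e::euclidean_space) chart set \<Rightarrow> 'm set \<Rightarrow> 'm \<Rightarrow> 'e set" where
  "bdry_tangent A K p = tangent_space A (frontier K) p"

definition d_exp ::
    "('m::topological_space, 'e::euclidean_space) chart set \<Rightarrow> ('m \<Rightarrow> 'e \<Rightarrow> 'e \<Rightarrow> real) \<Rightarrow>
     'm set \<Rightarrow> ('m \<Rightarrow> 'e) \<Rightarrow> real \<Rightarrow> 'm \<Rightarrow> 'e \<Rightarrow> 'e" where
  "d_exp A g K \<nu> r p v = differential A (frontier K) (normal_exp A g \<nu> r) p v"

definition d_r ::
    "('m::topological_space, 'e::euclidean_space) chart set \<Rightarrow> ('m \<Rightarrow> 'e \<Rightarrow> 'e \<Rightarrow> real) \<Rightarrow>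
     'm set \<Rightarrow> 'm \<Rightarrow> 'e" where
  "d_r A g K q = gradient A g (distance_to A g K) q"

definition radial_transport ::
    "('m::topological_space, 'e::euclidean_space) chart set \<Rightarrow> ('m \<Rightarrow> 'e \<Rightarrow> 'e \<Rightarrow> real) \<Rightarrow>
     ('m \<Rightarrow> 'e) \<Rightarrow> real \<Rightarrow> 'm \<Rightarrow> 'e \<Rightarrow> 'e" where
  "radial_transport A g \<nu> r p v = parallel_transport A g (\<lambda>s. normal_exp A g \<nu> s p) r v"

definition beta_r ::
    "('m::topological_space, 'e::euclidean_space) chart set \<Rightarrow> ('m \<Rightarrow> 'e \<Rightarrow> 'e \<Rightarrow> real) \<Rightarrow>
     ('m \<Rightarrow> 'e \<Rightarrow> 'e) \<Rightarrow> 'm set \<Rightarrow> ('m \<Rightarrow> 'e) \<Rightarrow> real \<Rightarrow> 'm \<Rightarrow> 'e \<Rightarrow> real" where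
  "beta_r A g J K \<nu> r p v =
     (let q = normal_exp A g \<nu> r p in g q (J q (d_r A g K q)) (radial_transport A g \<nu> r p v))"

definition beta ::
    "('m::topological_space, 'e::euclidean_space) chart set \<Rightarrow> ('m \<Rightarrow> 'e \<Rightarrow> 'e \<Rightarrow> real) \<Rightarrow>
     ('m \<Rightarrow> 'e \<Rightarrow> 'e) \<Rightarrow> 'm set \<Rightarrow> ('m \<Rightarrow> 'e) \<Rightarrow> 'm \<Rightarrow> 'e \<Rightarrow> real" where
  "beta A g J K \<nu> p v = Lim at_top (\<lambda>r. beta_r A g J K \<nu> r p v)"

definition e0 ::
    "('m::topological_space, 'e::euclidean_space) chart set \<Rightarrow> ('m \<Rightarrow> 'e \<Rightarrow> 'e \<Rightarrow> real) \<Rightarrow>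
     ('m \<Rightarrow> 'e \<Rightarrow> 'e) \<Rightarrow> 'm set \<Rightarrow> ('m \<Rightarrow> 'e) \<Rightarrow> 'm \<Rightarrow> 'e" where
  "e0 A g J K \<nu> p =
     (THE e. e \<in> bdry_tangent A K p \<and> g p e e = 1 \<and>
        (\<forall>v\<in>bdry_tangent A K p. beta A g J K \<nu> p v = 0 \<longrightarrow> g p e v = 0) \<and> beta A g J K \<nu> p e > 0)"

text \<open>\<open>E0 A g J K \<nu> r p\<close> is the value of the field \<open>E\<^sub>0\<close> at the point \<open>\<E>(r,p)\<close>.\<close>

definition E0 ::
    "('m::topological_space, 'e::euclidean_space) chart set \<Rightarrow> ('m \<Rightarrow> 'e \<Rightarrow> 'e \<Rightarrow> real) \<Rightarrow>
     ('m \<Rightarrow> 'e \<Rightarrow> 'e) \<Rightarrow> 'm set \<Rightarrow> ('m \<Rightarrow> 'e) \<Rightarrow> real \<Rightarrow> 'm \<Rightarrow> 'e" where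
  "E0 A g J K \<nu> r p = radial_transport A g \<nu> r p (e0 A g J K \<nu> p)"

definition g_r ::
    "('m::topological_space, 'e::euclidean_space) chart set \<Rightarrow> ('m \<Rightarrow> 'e \<Rightarrow> 'e \<Rightarrow> real) \<Rightarrow>
     'm set \<Rightarrow> ('m \<Rightarrow> 'e) \<Rightarrow> real \<Rightarrow> 'm \<Rightarrow> 'e \<Rightarrow> 'e \<Rightarrow> real" where
  "g_r A g K \<nu> r p u v =
     g (normal_exp A g \<nu> r p) (d_exp A g K \<nu> r p u) (d_exp A g K \<nu> r p v)"

definition eta_r ::
    "('m::topological_space, 'e::euclidean_space) chart set \<Rightarrow> ('m \<Rightarrow> 'e \<Rightarrow> 'e \<Rightarrow> real) \<Rightarrow>
     ('m \<Rightarrow> 'e \<Rightarrow> 'e) \<Rightarrow> 'm set \<Rightarrow> ('m \<Rightarrow> 'e) \<Rightarrow> real \<Rightarrow> 'm \<Rightarrow> 'e \<Rightarrow> real" where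
  "eta_r A g J K \<nu> r p v =
     exp (- r) * g (normal_exp A g \<nu> r p) (d_exp A g K \<nu> r p v) (E0 A g J K \<nu> r p)"

definition gamma_r ::
    "('m::topological_space, 'e::euclidean_space) chart set \<Rightarrow> ('m \<Rightarrow> 'e \<Rightarrow> 'e \<Rightarrow> real) \<Rightarrow>
     ('m \<Rightarrow> 'e \<Rightarrow> 'e) \<Rightarrow> 'm set \<Rightarrow> ('m \<Rightarrow> 'e) \<Rightarrow> real \<Rightarrow> 'm \<Rightarrow> 'e \<Rightarrow> 'e \<Rightarrow> real" where
  "gamma_r A g J K \<nu> r p u v =
     exp (- r) * (g_r A g K \<nu> r p u v
       - exp (2 * r) * (eta_r A g J K \<nu> r p u * eta_r A g J K \<nu> r p v))"

text \<open>The projection onto \<open>{\<partial>\<^sub>r}\<^sup>\<bottom>\<close>; recall that \<open>\<partial>\<^sub>r\<close> is a unit vector outside \<open>K\<close>.\<close>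

definition proj_r ::
    "('m::topological_space, 'e::euclidean_space) chart set \<Rightarrow> ('m \<Rightarrow> 'e \<Rightarrow> 'e \<Rightarrow> real) \<Rightarrow>
     'm set \<Rightarrow> 'm \<Rightarrow> 'e \<Rightarrow> 'e" where
  "proj_r A g K q w = w - g q w (d_r A g K q) *\<^sub>R d_r A g K q"

definition Phi ::
    "('m::topological_space, 'e::euclidean_space) chart set \<Rightarrow> ('m \<Rightarrow> 'e \<Rightarrow> 'e \<Rightarrow> real) \<Rightarrow>
     ('m \<Rightarrow> 'e \<Rightarrow> 'e) \<Rightarrow> 'm set \<Rightarrow> 'm \<Rightarrow> 'e \<Rightarrow> 'e" where
  "Phi A g J K q w = proj_r A g K q (J q (proj_r A g K q w))"

text \<open>Pullback of a field of endomorphisms: \<open>\<phi>\<^sub>r = (d\<E>\<^sub>r)\<^sup>-\<^sup>1 \<circ> \<Phi> \<circ> d\<E>\<^sub>r\<close>.\<close>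

definition phi_r ::
    "('m::topological_space, 'e::euclidean_space) chart set \<Rightarrow> ('m \<Rightarrow> 'e \<Rightarrow> 'e \<Rightarrow> real) \<Rightarrow>
     ('m \<Rightarrow> 'e \<Rightarrow> 'e) \<Rightarrow> 'm set \<Rightarrow> ('m \<Rightarrow> 'e) \<Rightarrow> real \<Rightarrow> 'm \<Rightarrow> 'e \<Rightarrow> 'e" where
  "phi_r A g J K \<nu> r p v =
     inv_into (bdry_tangent A K p) (d_exp A g K \<nu> r p)
       (Phi A g J K (normal_exp A g \<nu> r p) (d_exp A g K \<nu> r p v))"

text \<open>Uniform convergence on \<open>\<partial>K\<close>, as \<open>r \<rightarrow> \<infinity>\<close>, of \<open>1\<close>-forms, bilinear forms and fields of
  endomorphisms, with respect to \<open>g\<^sub>0 = g|\<^bsub>\<partial>K\<^esub>\<close>.\<close>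

definition unif_lim_form ::
    "('m::topological_space, 'e::euclidean_space) chart set \<Rightarrow> ('m \<Rightarrow> 'e \<Rightarrow> 'e \<Rightarrow> real) \<Rightarrow> 'm set \<Rightarrow>
     (real \<Rightarrow> 'm \<Rightarrow> 'e \<Rightarrow> real) \<Rightarrow> ('m \<Rightarrow> 'e \<Rightarrow> real) \<Rightarrow> bool" where
  "unif_lim_form A g K F L \<longleftrightarrow>
     (\<forall>\<epsilon>>0. \<forall>\<^sub>F r in at_top. \<forall>p\<in>frontier K. \<forall>v\<in>bdry_tangent A K p.
        \<bar>F r p v - L p v\<bar> \<le> \<epsilon> * gnorm g p v)"

definition unif_lim_bilin ::
    "('m::topological_space, 'e::euclidean_space) chart set \<Rightarrow> ('m \<Rightarrow> 'e \<Rightarrow> 'e \<Rightarrow> real) \<Rightarrow> 'm set \<Rightarrow>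
     (real \<Rightarrow> 'm \<Rightarrow> 'e \<Rightarrow> 'e \<Rightarrow> real) \<Rightarrow> ('m \<Rightarrow> 'e \<Rightarrow> 'e \<Rightarrow> real) \<Rightarrow> bool" where
  "unif_lim_bilin A g K F L \<longleftrightarrow>
     (\<forall>\<epsilon>>0. \<forall>\<^sub>F r in at_top. \<forall>p\<in>frontier K. \<forall>u\<in>bdry_tangent A K p. \<forall>v\<in>bdry_tangent A K p.
        \<bar>F r p u v - L p u v\<bar> \<le> \<epsilon> * (gnorm g p u * gnorm g p v))"

definition unif_lim_endo ::
    "('m::topological_space, 'e::euclidean_space) chart set \<Rightarrow> ('m \<Rightarrow> 'e \<Rightarrow> 'e \<Rightarrow> real) \<Rightarrow> 'm set \<Rightarrow>
     (real \<Rightarrow> 'm \<Rightarrow> 'e \<Rightarrow> 'e) \<Rightarrow> ('m \<Rightarrow> 'e \<Rightarrow> 'e) \<Rightarrow> bool" where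
  "unif_lim_endo A g K F L \<longleftrightarrow>
     (\<forall>\<epsilon>>0. \<forall>\<^sub>F r in at_top. \<forall>p\<in>frontier K. \<forall>v\<in>bdry_tangent A K p.
        gnorm g p (F r p v - L p v) \<le> \<epsilon> * gnorm g p v)"

definition form_kernel ::
    "('m::topological_space, 'e::euclidean_space) chart set \<Rightarrow> 'm set \<Rightarrow>
     ('m \<Rightarrow> 'e \<Rightarrow> real) \<Rightarrow> 'm \<Rightarrow> 'e set" where
  "form_kernel A K \<eta> p = {v \<in> bdry_tangent A K p. \<eta> p v = 0}"

definition complex_structure_on :: "'e::real_vector set \<Rightarrow> ('e \<Rightarrow> 'e) \<Rightarrow> bool" where
  "complex_structure_on H j \<longleftrightarrow> subspace H \<and> j ` H \<subseteq> H \<and>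
     (\<forall>u\<in>H. \<forall>v\<in>H. j (u + v) = j u + j v) \<and> (\<forall>a. \<forall>v\<in>H. j (a *\<^sub>R v) = a *\<^sub>R j v) \<and>
     (\<forall>v\<in>H. j (j v) = - v)"

end

theory Submission
  imports Defs
begin

text \<open>Put \<open>\<xi> = J\<partial>\<^sub>r\<close>. Since \<open>\<nabla>\<^sub>r\<partial>\<^sub>r = 0\<close>, the radial derivative of \<open>\<xi>\<close> is
  \<open>(\<nabla>\<^sub>rJ)\<partial>\<^sub>r = O(e\<^sup>-\<^sup>a\<^sup>r)\<close>, and integrating it in a parallel frame gives \<open>|\<xi> - E\<^sub>0| = O(e\<^sup>-\<^sup>a\<^sup>r)\<close>.
  On vectors orthogonal to \<open>\<partial>\<^sub>r\<close> one has \<open>g(\<Phi>w, \<xi>) = 0\<close>, \<open>\<Phi>\<^sup>2w = -w + g(w, \<xi>)\<xi>\<close> and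
  \<open>g(\<Phi>w, \<Phi>w') = g(w, w') - g(w, \<xi>)g(w', \<xi>)\<close>. The convergence of \<open>\<gamma>\<^sub>r\<close> and \<open>\<eta>\<^sup>0\<^sub>r\<close> bounds \<open>d\<E>\<^sub>r\<close> by a
  multiple of \<open>e\<^sup>r\<close>, so after pulling back \<open>\<xi>\<close> may be replaced by \<open>E\<^sub>0\<close> up to \<open>O(e\<^sup>(\<^sup>1\<^sup>-\<^sup>a\<^sup>)\<^sup>r)\<close>, and the
  three identities pass to the limit: \<open>\<eta>\<^sup>0 \<circ> \<phi> = 0\<close>, \<open>\<phi>\<^sup>2 = -Id\<close> on \<open>ker \<eta>\<^sup>0\<close>, and
  \<open>\<gamma>(\<phi>u, \<phi>v) = \<gamma>(u, v)\<close>. For the second one, evaluating at a vector with \<open>\<eta>\<^sup>0 \<noteq> 0\<close> shows that the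
  pullback of \<open>e\<^sup>r\<xi>\<close> converges.

  That \<open>\<partial>\<^sub>r\<close> is the velocity of the normal geodesics and that \<open>d\<E>\<^sub>r\<close> maps onto its orthogonal
  complement are the Gauss lemma and its consequence that the radial coordinate is the distance to \<open>K\<close>.\<close>

section \<open>Calculus\<close>

text \<open>Almost every object of the statement is a definite description or an infimum: the
  exponential map, parallel transport, the Christoffel vector, the differential of a map and e_0 are
  given by THE, and \<partial>_r is the gradient of an infimum of curve lengths. Each costs a proof
  of existence or uniqueness. Geodesics exist by completeness, but their uniqueness is that of a
  nonlinear equation; parallel fields must be constructed on the whole line; the tangent space of
  the boundary, defined by curves, must be shown to be a hyperplane; and the length of every
  piecewise smooth curve must be compared with the radial coordinate. Smoothness up to the boundary
  only means local smooth extensions, hence the one-sided derivatives at r = 0. In the last section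
  the vectors inserted into the converging tensors move with r, as \<open>\<phi>r r v\<close> does,
  so pointwise limits are too weak and the uniformity of the convergence is used.\<close>

lemma Ck_on_subset: "Ck_on k T f \<Longrightarrow> S \<subseteq> T \<Longrightarrow> Ck_on k S f"
  by (induction k arbitrary: f) (auto intro: continuous_on_subset)

lemma smooth_on_subset: "smooth_on T f \<Longrightarrow> S \<subseteq> T \<Longrightarrow> smooth_on S f"
  by (auto simp: smooth_on_def intro: Ck_on_subset)

lemma has_derivative_cong_open:
  assumes "open S" "x \<in> S" "\<And>y. y \<in> S \<Longrightarrow> f y = g y"
  shows "(f has_derivative f') (at x) \<longleftrightarrow> (g has_derivative f') (at x)"
  using has_derivative_transform_within_open[of f f' x UNIV S g]
    has_derivative_transform_within_open[of g f' x UNIV S f] assms by auto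

lemma frechet_derivative_cong_open:
  assumes "open S" "x \<in> S" "\<And>y. y \<in> S \<Longrightarrow> f y = g y"
  shows "frechet_derivative f (at x) = frechet_derivative g (at x)"
  using has_derivative_cong_open[OF assms] by (simp add: frechet_derivative_def)

lemma differentiable_cong_open:
  assumes "open S" "x \<in> S" "\<And>y. y \<in> S \<Longrightarrow> f y = g y"
  shows "f differentiable at x \<longleftrightarrow> g differentiable at x"
  using has_derivative_cong_open[OF assms] by (simp add: differentiable_def)

lemma Ck_on_cong:
  assumes "open S" "\<And>x. x \<in> S \<Longrightarrow> f x = g x"
  shows "Ck_on k S f \<longleftrightarrow> Ck_on k S g"
  using assms
proof (induction k arbitrary: f g)
  case 0
  then show ?case by (auto cong: continuous_on_cong)
next
  case (Suc k)
  have "Ck_on k S (\<lambda>x. frechet_derivative f (at x) v) = Ck_on k S (\<lambda>x. frechet_derivative g (at x) v)" for v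
    by (rule Suc.IH[OF Suc.prems(1)], subst frechet_derivative_cong_open[of S _ f g]) (use Suc.prems in auto)
  moreover have "f differentiable at x \<longleftrightarrow> g differentiable at x" if "x \<in> S" for x
    using Suc.prems that by (intro differentiable_cong_open) auto
  ultimately show ?case by simp
qed

lemma smooth_on_cong:
  "open S \<Longrightarrow> (\<And>x. x \<in> S \<Longrightarrow> f x = g x) \<Longrightarrow> smooth_on S f \<longleftrightarrow> smooth_on S g"
  unfolding smooth_on_def using Ck_on_cong[of S f g] by blast

lemma smooth_on_has_derivative:
  "smooth_on S f \<Longrightarrow> x \<in> S \<Longrightarrow> (f has_derivative frechet_derivative f (at x)) (at x)"
  unfolding smooth_on_def by (metis Ck_on.simps(2) frechet_derivative_works)

lemma smooth_on_deriv:
  "smooth_on S f \<Longrightarrow> smooth_on S (\<lambda>x. frechet_derivative f (at x) v)"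
  unfolding smooth_on_def by (metis Ck_on.simps(2))

lemma smooth_on_continuous_on: "smooth_on S f \<Longrightarrow> continuous_on S f"
  unfolding smooth_on_def by (metis Ck_on.simps(1))

text \<open>Continuity and differentiability are tested at points, and the induction on the order
  runs over all functions \<open>f\<close>, so that it applies to the directional
  derivatives.\<close>

lemma smooth_on_local:
  assumes "\<And>x. x \<in> S \<Longrightarrow> \<exists>U. open U \<and> x \<in> U \<and> smooth_on U f"
  shows "smooth_on S f"
proof -
  have "Ck_on k S f" if "\<And>x. x \<in> S \<Longrightarrow> \<exists>U. open U \<and> x \<in> U \<and> Ck_on k U f" for k
    using that
  proof (induction k arbitrary: f)
    case 0
    then show ?case
      by (metis Ck_on.simps(1) continuous_on_eq_continuous_at continuous_at_imp_continuous_on)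
  next
    case (Suc k)
    have "Ck_on k S (\<lambda>x. frechet_derivative f (at x) v)" for v
      by (rule Suc.IH) (metis Suc.prems Ck_on.simps(2))
    moreover have "f differentiable at x" if "x \<in> S" for x
      using Suc.prems[OF that] by auto
    ultimately show ?case by simp
  qed
  then show ?thesis
    using assms by (metis smooth_on_def)
qed

text \<open>With an affine inner map the directional derivative is again of the same shape,
  \<open>v\<close> replaced by \<open>M v\<close>, so the induction on the order closes without a
  general chain and product rule. Straight lines and affine reparametrizations of curves are the
  maps inserted later.\<close>

lemma smooth_on_precompose_affine:
  fixes f :: "'a::euclidean_space \<Rightarrow> 'b::real_normed_vector"
    and M :: "'c::euclidean_space \<Rightarrow> 'a"
  assumes "smooth_on S f" "linear M" "open S"
  shows "smooth_on ((\<lambda>x. a + M x) -` S) (\<lambda>x. f (a + M x))"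
proof -
  have bM: "bounded_linear M"
    using assms linear_linear by blast
  have op: "open ((\<lambda>x. a + M x) -` S)"
    using assms bM by (intro open_vimage continuous_intros linear_continuous_on)
  have "Ck_on k ((\<lambda>x. a + M x) -` S) (\<lambda>x. f (a + M x))" if "Ck_on k S f" for k
    using that
  proof (induction k arbitrary: f)
    case 0
    have "continuous_on ((\<lambda>x. a + M x) -` S) (\<lambda>x. a + M x)"
      by (intro continuous_intros linear_continuous_on bM)
    then show ?case
      using 0 by (auto intro: continuous_on_compose2[of S f])
  next
    case (Suc k)
    have d: "((\<lambda>x. f (a + M x)) has_derivative (\<lambda>v. frechet_derivative f (at (a + M x)) (M v))) (at x)"
      if "a + M x \<in> S" for x
    proof -
      have "(f has_derivative frechet_derivative f (at (a + M x))) (at (a + M x))"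
        using Suc.prems that frechet_derivative_works by auto
      then have "(f \<circ> (\<lambda>x. a + M x) has_derivative frechet_derivative f (at (a + M x)) \<circ> M) (at x)"
        by (intro diff_chain_at) (auto intro!: derivative_eq_intros bounded_linear_imp_has_derivative bM)
      then show ?thesis by (simp add: o_def)
    qed
    have "Ck_on k ((\<lambda>x. a + M x) -` S) (\<lambda>x. frechet_derivative (\<lambda>x. f (a + M x)) (at x) v)" for v
    proof -
      have "Ck_on k S (\<lambda>y. frechet_derivative f (at y) (M v))"
        using Suc.prems by simp
      from Suc.IH[OF this] show ?thesis
        using Ck_on_cong[OF op, of "\<lambda>x. frechet_derivative (\<lambda>x. f (a + M x)) (at x) v"
            "\<lambda>x. frechet_derivative f (at (a + M x)) (M v)" k] frechet_derivative_at[OF d]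
        by (metis vimageE)
    qed
    then show ?case
      using d by (auto simp: differentiable_def)
  qed
  with assms show ?thesis by (simp add: smooth_on_def)
qed

text \<open>A linear outer map commutes with differentiation, so the same induction closes.\<close>

lemma smooth_on_bounded_linear_compose:
  assumes "smooth_on S f" "bounded_linear L" "open S"
  shows "smooth_on S (\<lambda>x. L (f x))"
proof -
  have "Ck_on k S (\<lambda>x. L (f x))" if "Ck_on k S f" for k
    using that
  proof (induction k arbitrary: f)
    case 0
    then show ?case
      using assms(2) by (auto intro: bounded_linear.continuous_on)
  next
    case (Suc k)
    have d: "((\<lambda>x. L (f x)) has_derivative (\<lambda>v. L (frechet_derivative f (at x) v))) (at x)"
      if "x \<in> S" for x
    proof -
      have "(f has_derivative frechet_derivative f (at x)) (at x)"
        using Suc.prems that frechet_derivative_works by auto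
      then show ?thesis
        by (rule bounded_linear.has_derivative[OF assms(2)])
    qed
    have "Ck_on k S (\<lambda>x. frechet_derivative (\<lambda>x. L (f x)) (at x) v)" for v
    proof -
      have "Ck_on k S (\<lambda>y. frechet_derivative f (at y) v)"
        using Suc.prems by simp
      from Suc.IH[OF this] show ?thesis
        using Ck_on_cong[OF assms(3), of "\<lambda>x. frechet_derivative (\<lambda>x. L (f x)) (at x) v"
            "\<lambda>x. L (frechet_derivative f (at x) v)" k] frechet_derivative_at[OF d]
        by metis
    qed
    then show ?case
      using d by (auto simp: differentiable_def)
  qed
  with assms show ?thesis by (simp add: smooth_on_def)
qed

section \<open>Symmetry of second derivatives\<close>

lemma double_mean_value:
  fixes \<phi> :: "'a::euclidean_space \<Rightarrow> real"
  assumes sm: "smooth_on S \<phi>" and t: "t > 0"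
    and S: "\<And>\<alpha> \<beta>. 0 \<le> \<alpha> \<Longrightarrow> \<alpha> \<le> t \<Longrightarrow> 0 \<le> \<beta> \<Longrightarrow> \<beta> \<le> t \<Longrightarrow> x + \<alpha> *\<^sub>R u + \<beta> *\<^sub>R v \<in> S"
  shows "\<exists>\<alpha> \<beta>. 0 \<le> \<alpha> \<and> \<alpha> \<le> t \<and> 0 \<le> \<beta> \<and> \<beta> \<le> t \<and>
    \<phi> (x + t *\<^sub>R u + t *\<^sub>R v) - \<phi> (x + t *\<^sub>R u) - \<phi> (x + t *\<^sub>R v) + \<phi> x =
    t * t * frechet_derivative (\<lambda>y. frechet_derivative \<phi> (at y) u) (at (x + \<alpha> *\<^sub>R u + \<beta> *\<^sub>R v)) v"
proof -
  have line: "((\<lambda>s. f (a + s *\<^sub>R w)) has_real_derivative frechet_derivative f (at (a + s *\<^sub>R w)) w) (at s)"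
    if "smooth_on S f" "a + s *\<^sub>R w \<in> S" for f :: "'a \<Rightarrow> real" and a w s
  proof -
    have "((\<lambda>s. f (a + s *\<^sub>R w)) has_derivative (\<lambda>h. frechet_derivative f (at (a + s *\<^sub>R w)) (h *\<^sub>R w))) (at s)"
      by (rule has_derivative_compose[where f = "\<lambda>s. a + s *\<^sub>R w" and g = f, OF _ smooth_on_has_derivative[OF that]])
        (auto intro!: derivative_eq_intros)
    moreover have "linear (frechet_derivative f (at (a + s *\<^sub>R w)))"
      using smooth_on_has_derivative[OF that] has_derivative_linear by blast
    moreover from this have "(\<lambda>h. frechet_derivative f (at (a + s *\<^sub>R w)) (h *\<^sub>R w)) =
        (*) (frechet_derivative f (at (a + s *\<^sub>R w)) w)"
      by (auto simp: fun_eq_iff linear_cmul)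
    ultimately show ?thesis
      by (simp add: has_field_derivative_def)
  qed
  \<comment> \<open>The second difference equals \<open>h t - h 0\<close>. One mean value step in
    the direction \<open>u\<close> turns it into a difference of first derivatives, a second one in
    the direction \<open>v\<close> into a mixed derivative.\<close>
  define h where "h \<alpha> = \<phi> ((x + t *\<^sub>R v) + \<alpha> *\<^sub>R u) - \<phi> (x + \<alpha> *\<^sub>R u)" for \<alpha>
  define A where "A y = frechet_derivative \<phi> (at y) u" for y
  have smA: "smooth_on S A"
    unfolding A_def by (rule smooth_on_deriv[OF sm])
  have h': "(h has_real_derivative A ((x + t *\<^sub>R v) + \<alpha> *\<^sub>R u) - A (x + \<alpha> *\<^sub>R u)) (at \<alpha>)"
    if "0 \<le> \<alpha>" "\<alpha> \<le> t" for \<alpha>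
    unfolding h_def A_def
    using S[of \<alpha> t] S[of \<alpha> 0] that t
    by (intro DERIV_diff line sm) (auto simp: algebra_simps)
  obtain \<alpha> where \<alpha>: "0 < \<alpha>" "\<alpha> < t" "h t - h 0 = (t - 0) * (A ((x + t *\<^sub>R v) + \<alpha> *\<^sub>R u) - A (x + \<alpha> *\<^sub>R u))"
    using MVT2[OF t h'] by blast
  have A': "((\<lambda>\<beta>. A ((x + \<alpha> *\<^sub>R u) + \<beta> *\<^sub>R v)) has_real_derivative
      frechet_derivative A (at ((x + \<alpha> *\<^sub>R u) + \<beta> *\<^sub>R v)) v) (at \<beta>)" if "0 \<le> \<beta>" "\<beta> \<le> t" for \<beta>
    using S[of \<alpha> \<beta>] that \<alpha> by (intro line smA) auto
  obtain \<beta> where \<beta>: "0 < \<beta>" "\<beta> < t"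
    "A ((x + \<alpha> *\<^sub>R u) + t *\<^sub>R v) - A ((x + \<alpha> *\<^sub>R u) + 0 *\<^sub>R v) = (t - 0) * frechet_derivative A (at ((x + \<alpha> *\<^sub>R u) + \<beta> *\<^sub>R v)) v"
    using MVT2[OF t A'] by blast
  have "\<phi> (x + t *\<^sub>R u + t *\<^sub>R v) - \<phi> (x + t *\<^sub>R u) - \<phi> (x + t *\<^sub>R v) + \<phi> x = h t - h 0"
    by (simp add: h_def algebra_simps)
  also have "\<dots> = t * t * frechet_derivative A (at ((x + \<alpha> *\<^sub>R u) + \<beta> *\<^sub>R v)) v"
    using \<alpha>(3) \<beta>(3) by (simp add: algebra_simps)
  finally show ?thesis
    using \<alpha> \<beta> unfolding A_def by (intro exI[of _ \<alpha>] exI[of _ \<beta>]) auto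
qed

text \<open>The second difference of \<open>\<phi>\<close> over a parallelogram does not see the
  order of \<open>u\<close> and \<open>v\<close>, and it is \<open>t * t\<close> times either mixed
  derivative at some point of that parallelogram. Continuity of both derivatives does the
  rest.\<close>

lemma frechet_derivative_symmetric_real:
  fixes \<phi> :: "'a::euclidean_space \<Rightarrow> real"
  assumes sm: "smooth_on S \<phi>" and op: "open S" and x: "x \<in> S"
  shows "frechet_derivative (\<lambda>y. frechet_derivative \<phi> (at y) u) (at x) v
       = frechet_derivative (\<lambda>y. frechet_derivative \<phi> (at y) v) (at x) u"
proof -
  define A where "A y = frechet_derivative (\<lambda>y. frechet_derivative \<phi> (at y) u) (at y) v" for y
  define B where "B y = frechet_derivative (\<lambda>y. frechet_derivative \<phi> (at y) v) (at y) u" for y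
  have "continuous_on S A" "continuous_on S B"
    unfolding A_def B_def by (intro smooth_on_continuous_on smooth_on_deriv sm)+
  then have cont: "isCont A x" "isCont B x"
    using op x continuous_on_eq_continuous_at by blast+
  have "\<bar>A x - B x\<bar> \<le> e" if "e > 0" for e
  proof -
    have e2: "e / 2 > 0" using that by simp
    obtain d1 where d1: "d1 > 0" "\<And>y. dist y x < d1 \<Longrightarrow> dist (A y) (A x) < e/2"
      using cont(1)[unfolded continuous_at_eps_delta, rule_format, OF e2] by blast
    obtain d2 where d2: "d2 > 0" "\<And>y. dist y x < d2 \<Longrightarrow> dist (B y) (B x) < e/2"
      using cont(2)[unfolded continuous_at_eps_delta, rule_format, OF e2] by blast
    obtain d3 where d3: "d3 > 0" "\<And>y. dist y x < d3 \<Longrightarrow> y \<in> S"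
      using op x unfolding open_dist by blast
    define d where "d = min d1 (min d2 d3)"
    \<comment> \<open>Small enough for the whole parallelogram to lie in the ball of radius
      \<open>d\<close>; the summand 1 keeps the denominator positive.\<close>
    define t where "t = d / (1 + norm u + norm v)"
    have n: "1 + norm u + norm v > 0"
      by (smt (verit) norm_ge_zero)
    have d: "d > 0" using d1 d2 d3 by (simp add: d_def)
    have t: "t > 0" unfolding t_def using n d by simp
    have small: "dist (x + \<alpha> *\<^sub>R u + \<beta> *\<^sub>R v) x < d" if "0 \<le> \<alpha>" "\<alpha> \<le> t" "0 \<le> \<beta>" "\<beta> \<le> t" for \<alpha> \<beta>
    proof -
      have "dist (x + \<alpha> *\<^sub>R u + \<beta> *\<^sub>R v) x \<le> \<alpha> * norm u + \<beta> * norm v"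
        using norm_triangle_ineq[of "\<alpha> *\<^sub>R u" "\<beta> *\<^sub>R v"] that by (simp add: dist_norm add.assoc)
      also have "\<dots> \<le> t * norm u + t * norm v"
        using that by (intro add_mono mult_right_mono) auto
      also have "\<dots> < t * (1 + norm u + norm v)"
        using t by (simp add: algebra_simps)
      also have "\<dots> = d" using n by (simp add: t_def)
      finally show ?thesis .
    qed
    obtain \<alpha> \<beta> where ab: "0 \<le> \<alpha>" "\<alpha> \<le> t" "0 \<le> \<beta>" "\<beta> \<le> t"
      "\<phi> (x + t *\<^sub>R u + t *\<^sub>R v) - \<phi> (x + t *\<^sub>R u) - \<phi> (x + t *\<^sub>R v) + \<phi> x = t * t * A (x + \<alpha> *\<^sub>R u + \<beta> *\<^sub>R v)"
      using double_mean_value[OF sm t, of x u v] small d3 unfolding A_def d_def by (smt (verit))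
    obtain \<alpha>' \<beta>' where ab': "0 \<le> \<alpha>'" "\<alpha>' \<le> t" "0 \<le> \<beta>'" "\<beta>' \<le> t"
      "\<phi> (x + t *\<^sub>R v + t *\<^sub>R u) - \<phi> (x + t *\<^sub>R v) - \<phi> (x + t *\<^sub>R u) + \<phi> x = t * t * B (x + \<alpha>' *\<^sub>R v + \<beta>' *\<^sub>R u)"
      using double_mean_value[OF sm t, of x v u] small d3 unfolding B_def d_def
      by (smt (verit) add.commute add.left_commute)
    have "t * t * A (x + \<alpha> *\<^sub>R u + \<beta> *\<^sub>R v) = t * t * B (x + \<alpha>' *\<^sub>R v + \<beta>' *\<^sub>R u)"
      using ab(5) ab'(5) by (simp add: algebra_simps)
    then have "A (x + \<alpha> *\<^sub>R u + \<beta> *\<^sub>R v) = B (x + \<alpha>' *\<^sub>R v + \<beta>' *\<^sub>R u)"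
      using t by simp
    moreover have "dist (A (x + \<alpha> *\<^sub>R u + \<beta> *\<^sub>R v)) (A x) < e/2"
      using small[OF ab(1-4)] by (intro d1) (simp add: d_def)
    moreover have "dist (B (x + \<alpha>' *\<^sub>R v + \<beta>' *\<^sub>R u)) (B x) < e/2"
      using small[OF ab'(3,4,1,2)] by (intro d2) (simp add: d_def algebra_simps)
    ultimately show ?thesis unfolding dist_real_def by linarith
  qed
  then have "\<bar>A x - B x\<bar> \<le> 0" by (rule field_le_epsilon) auto
  then show ?thesis by (simp add: A_def B_def)
qed

lemma frechet_derivative_symmetric:
  fixes f :: "'a::euclidean_space \<Rightarrow> 'b::euclidean_space"
  assumes sm: "smooth_on S f" and op: "open S" and x: "x \<in> S"
  shows "frechet_derivative (\<lambda>y. frechet_derivative f (at y) u) (at x) v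
       = frechet_derivative (\<lambda>y. frechet_derivative f (at y) v) (at x) u"
proof (rule euclidean_eqI)
  fix i :: 'b
  have bl: "bounded_linear (\<lambda>z::'b. z \<bullet> i)" by (rule bounded_linear_inner_left)
  have comp: "frechet_derivative (\<lambda>y. h y \<bullet> i) (at y) w = frechet_derivative h (at y) w \<bullet> i"
    if "smooth_on S h" "y \<in> S" for h :: "'a \<Rightarrow> 'b" and y w
    using bounded_linear.has_derivative[OF bl smooth_on_has_derivative[OF that]]
    by (metis frechet_derivative_at)
  have key: "frechet_derivative (\<lambda>y. frechet_derivative f (at y) u) (at x) v \<bullet> i =
      frechet_derivative (\<lambda>y. frechet_derivative (\<lambda>y. f y \<bullet> i) (at y) u) (at x) v" for u v
  proof -
    have "frechet_derivative (\<lambda>y. frechet_derivative f (at y) u) (at x) v \<bullet> i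
        = frechet_derivative (\<lambda>y. frechet_derivative f (at y) u \<bullet> i) (at x) v"
      by (rule comp[OF smooth_on_deriv[OF sm] x, symmetric])
    also have "\<dots> = frechet_derivative (\<lambda>y. frechet_derivative (\<lambda>y. f y \<bullet> i) (at y) u) (at x) v"
      by (subst frechet_derivative_cong_open[OF op x]) (use comp[OF sm] in auto)
    finally show ?thesis .
  qed
  show "frechet_derivative (\<lambda>y. frechet_derivative f (at y) u) (at x) v \<bullet> i =
      frechet_derivative (\<lambda>y. frechet_derivative f (at y) v) (at x) u \<bullet> i"
    unfolding key
    by (rule frechet_derivative_symmetric_real[OF smooth_on_bounded_linear_compose[OF sm bl op] op x])
qed

section \<open>Differentiation of linear maps along curves\<close>

lemma linear_euclidean_expand:
  fixes F :: "'a::euclidean_space \<Rightarrow> 'b::real_vector"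
  assumes "linear F"
  shows "F v = (\<Sum>b\<in>Basis. (v \<bullet> b) *\<^sub>R F b)"
proof -
  have "F v = F (\<Sum>b\<in>Basis. (v \<bullet> b) *\<^sub>R b)"
    by (simp add: euclidean_representation)
  also have "\<dots> = (\<Sum>b\<in>Basis. (v \<bullet> b) *\<^sub>R F b)"
    by (simp add: linear_sum[OF assms] linear_cmul[OF assms])
  finally show ?thesis .
qed

text \<open>A Leibniz rule for operators applied to vectors in which the operators are
  differentiated only pointwise in \<open>w\<close>; expanding in a basis avoids an operator-valued
  derivative. It drives the change of charts for covariant derivatives, their compatibility with the
  metric and the Leibniz rule for \<open>J\<close>.\<close>

lemma linear_family_has_vector_derivative:
  fixes F :: "real \<Rightarrow> 'a::euclidean_space \<Rightarrow> 'b::real_normed_vector"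
  assumes lin: "\<forall>\<^sub>F s in nhds t. linear (F s)"
    and F: "\<And>w. ((\<lambda>s. F s w) has_vector_derivative F' w) (at t)"
    and v: "(v has_vector_derivative v') (at t)"
  shows "((\<lambda>s. F s (v s)) has_vector_derivative (F t v' + F' (v t))) (at t)"
proof -
  have lin_t: "linear (F t)"
    using lin by (rule eventually_nhds_x_imp_x)
  obtain U where U: "open U" "t \<in> U" "\<And>s. s \<in> U \<Longrightarrow> linear (F s)"
    using lin unfolding eventually_nhds by blast
  have sumd: "((\<lambda>s. \<Sum>b\<in>Basis. (w s \<bullet> b) *\<^sub>R F s b) has_vector_derivative
      (\<Sum>b\<in>Basis. (w t \<bullet> b) *\<^sub>R F' b + (w' \<bullet> b) *\<^sub>R F t b)) (at t)"
    if w: "(w has_vector_derivative w') (at t)" for w w'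
  proof (intro has_vector_derivative_sum has_vector_derivative_scaleR F)
    fix b :: 'a
    show "((\<lambda>s. w s \<bullet> b) has_field_derivative w' \<bullet> b) (at t)"
      using bounded_linear.has_vector_derivative[OF bounded_linear_inner_left w, of b]
      by (simp add: has_real_derivative_iff_has_vector_derivative)
  qed
  \<comment> \<open>\<open>F'\<close> is an arbitrary function so far; its linearity comes from
    uniqueness of derivatives.\<close>
  have F'_eq: "F' w = (\<Sum>b\<in>Basis. (w \<bullet> b) *\<^sub>R F' b)" for w
  proof -
    have "((\<lambda>s. \<Sum>b\<in>Basis. (w \<bullet> b) *\<^sub>R F s b) has_vector_derivative (\<Sum>b\<in>Basis. (w \<bullet> b) *\<^sub>R F' b)) (at t)"
      using sumd[OF has_vector_derivative_const[of w]] by simp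
    then have "((\<lambda>s. F s w) has_vector_derivative (\<Sum>b\<in>Basis. (w \<bullet> b) *\<^sub>R F' b)) (at t)"
      by (rule has_vector_derivative_transform_within_open[OF _ U(1,2)])
        (metis linear_euclidean_expand U(3))
    then show ?thesis
      using F vector_derivative_unique_at by blast
  qed
  have "(\<Sum>b\<in>Basis. (v t \<bullet> b) *\<^sub>R F' b + (v' \<bullet> b) *\<^sub>R F t b) = F t v' + F' (v t)"
    by (simp only: sum.distrib F'_eq[of "v t", symmetric] linear_euclidean_expand[OF lin_t, of v', symmetric] add.commute)
  with sumd[OF v] have "((\<lambda>s. \<Sum>b\<in>Basis. (v s \<bullet> b) *\<^sub>R F s b) has_vector_derivative (F t v' + F' (v t))) (at t)"
    by simp
  then show ?thesis
    by (rule has_vector_derivative_transform_within_open[OF _ U(1,2)])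
      (metis linear_euclidean_expand U(3))
qed

lemma has_vector_derivative_compose_derivative:
  assumes "(f has_derivative f') (at (x t))" "(x has_vector_derivative x') (at t)"
  shows "((\<lambda>s. f (x s)) has_vector_derivative f' x') (at t)"
  using vector_derivative_diff_chain_within[of x x' t UNIV f f'] assms
  by (simp add: o_def has_derivative_at_withinI)

section \<open>Lipschitz bounds, uniqueness and existence for differential equations\<close>

lemma smooth_on_lipschitz:
  fixes f :: "'a::euclidean_space \<Rightarrow> 'b::real_normed_vector"
  assumes sm: "smooth_on S f" and B: "compact B" "convex B" "B \<subseteq> S"
  shows "\<exists>L\<ge>0. \<forall>x\<in>B. \<forall>y\<in>B. norm (f x - f y) \<le> L * norm (x - y)"
proof -
  let ?h = "\<lambda>x. \<Sum>b\<in>Basis. norm (frechet_derivative f (at x) b)"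
  have "continuous_on B ?h"
    using smooth_on_continuous_on[OF smooth_on_deriv[OF sm]] B(3)
    by (intro continuous_intros) (auto intro: continuous_on_subset)
  then have "bounded (?h ` B)"
    using B(1) compact_continuous_image compact_imp_bounded by blast
  then obtain L where L: "\<And>x. x \<in> B \<Longrightarrow> norm (?h x) \<le> L"
    unfolding bounded_iff by blast
  \<comment> \<open>The maximum with 0 keeps the constant nonnegative when \<open>B\<close> is empty
    and \<open>L\<close> is arbitrary.\<close>
  have "norm (f x - f y) \<le> max L 0 * norm (x - y)" if "x \<in> B" "y \<in> B" for x y
  proof (rule differentiable_bound[OF B(2) _ _ that])
    fix z assume z: "z \<in> B"
    then have d: "(f has_derivative frechet_derivative f (at z)) (at z)"
      using sm B(3) smooth_on_has_derivative by blast
    then show "(f has_derivative frechet_derivative f (at z)) (at z within B)"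
      by (rule has_derivative_at_withinI)
    have lin: "linear (frechet_derivative f (at z))"
      using d has_derivative_linear by blast
    show "onorm (frechet_derivative f (at z)) \<le> max L 0"
    proof (rule onorm_bound)
      fix v :: 'a
      have "norm (frechet_derivative f (at z) v) \<le> (\<Sum>b\<in>Basis. norm ((v \<bullet> b) *\<^sub>R frechet_derivative f (at z) b))"
        by (subst linear_euclidean_expand[OF lin]) (rule norm_sum)
      also have "\<dots> \<le> (\<Sum>b\<in>Basis. norm v * norm (frechet_derivative f (at z) b))"
        by (intro sum_mono) (auto intro!: mult_right_mono Basis_le_norm)
      also have "\<dots> = norm v * ?h z" by (simp add: sum_distrib_left)
      also have "\<dots> \<le> norm v * max L 0"
        using L[OF z] by (intro mult_left_mono) auto
      finally show "norm (frechet_derivative f (at z) v) \<le> max L 0 * norm v"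
        by (simp add: mult.commute)
    qed simp
  qed
  then show ?thesis by (intro exI[of _ "max L 0"]) auto
qed

text \<open>Gronwall's argument: the squared norm \<open>h\<close> satisfies |h'| <= 2 C h. Hence
  \<open>h\<close> weighted with exp(-2Cs) decreases to the right of \<open>t0\<close>, weighted
  with exp(2Cs) it increases to the left, and in both cases it vanishes at
  \<open>t0\<close>.\<close>

lemma linear_growth_imp_zero:
  fixes f :: "real \<Rightarrow> 'a::real_inner"
  assumes f: "\<And>s. a < s \<Longrightarrow> s < b \<Longrightarrow> (f has_vector_derivative f' s) (at s)"
    and bd: "\<And>s. a < s \<Longrightarrow> s < b \<Longrightarrow> norm (f' s) \<le> C * norm (f s)"
    and t0: "a < t0" "t0 < b" "f t0 = 0" and t: "a < t" "t < b"
  shows "f t = 0"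
proof -
  define h where "h s = f s \<bullet> f s" for s
  have h: "(h has_real_derivative 2 * (f s \<bullet> f' s)) (at s)" if "a < s" "s < b" for s
    unfolding h_def has_real_derivative_iff_has_vector_derivative
    using bounded_bilinear.has_vector_derivative[OF bounded_bilinear_inner f[OF that] f[OF that]]
    by (simp add: inner_commute)
  have hb: "\<bar>2 * (f s \<bullet> f' s)\<bar> \<le> 2 * C * h s" if "a < s" "s < b" for s
  proof -
    have "\<bar>f s \<bullet> f' s\<bar> \<le> norm (f s) * norm (f' s)" by (rule Cauchy_Schwarz_ineq2)
    also have "\<dots> \<le> norm (f s) * (C * norm (f s))"
      using bd[OF that] by (intro mult_left_mono) auto
    finally show ?thesis
      by (simp add: h_def dot_square_norm power2_eq_square ac_simps abs_mult)
  qed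
  define k where "k c s = exp (c * s) * h s" for c s
  have k: "(k c has_real_derivative exp (c * s) * (c * h s + 2 * (f s \<bullet> f' s))) (at s)"
    if "a < s" "s < b" for s c
    unfolding k_def by (auto intro!: derivative_eq_intros h that simp: algebra_simps)
  have ht: "h t \<le> 0"
  proof (cases "t0 \<le> t")
    case True
    have kt: "k (-2*C) t \<le> k (-2*C) t0"
    proof (rule DERIV_nonpos_imp_nonincreasing[OF True])
      fix s assume "t0 \<le> s" "s \<le> t"
      then have s: "a < s" "s < b" using t0 t by auto
      have "exp (-2*C * s) * (-2*C * h s + 2 * (f s \<bullet> f' s)) \<le> 0"
        using hb[OF s] by (intro mult_nonneg_nonpos) auto
      with k[OF s] show "\<exists>y. (k (-2*C) has_real_derivative y) (at s) \<and> y \<le> 0" by blast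
    qed
    show ?thesis using kt t0(3) by (simp add: k_def h_def mult_le_0_iff)
  next
    case False
    have kt: "k (2*C) t \<le> k (2*C) t0"
    proof (rule DERIV_nonneg_imp_nondecreasing[where f = "k (2*C)" and a = t and b = t0])
      fix s assume "t \<le> s" "s \<le> t0"
      then have s: "a < s" "s < b" using t0 t by auto
      have "exp (2*C * s) * (2*C * h s + 2 * (f s \<bullet> f' s)) \<ge> 0"
        using hb[OF s] by (intro mult_nonneg_nonneg) auto
      with k[OF s] show "\<exists>y. (k (2*C) has_real_derivative y) (at s) \<and> 0 \<le> y" by blast
    qed (use False in simp)
    show ?thesis using kt t0(3) by (simp add: k_def h_def mult_le_0_iff)
  qed
  from ht show ?thesis unfolding h_def using inner_ge_zero[of "f t"] by (simp add: order_antisym)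
qed

text \<open>Picard's theorem as a contraction on bounded continuous functions. Linearity of
  \<open>Q s\<close> makes its bound \<open>L\<close> a Lipschitz constant as well, and the interval
  is short enough for the contraction factor 1/2.\<close>

lemma linear_ode_local_existence:
  fixes Q :: "real \<Rightarrow> 'e::euclidean_space \<Rightarrow> 'e"
  assumes lin: "\<And>s. s \<in> {a..b} \<Longrightarrow> linear (Q s)"
    and cont: "\<And>y. continuous_on UNIV y \<Longrightarrow> continuous_on {a..b} (\<lambda>s. Q s (y s))"
    and bd: "\<And>s v. s \<in> {a..b} \<Longrightarrow> norm (Q s v) \<le> L * norm v"
    and L: "L \<ge> 0" "L * (b - a) \<le> 1/2" and s0: "s0 \<in> {a..b}"
  shows "\<exists>y. y s0 = w \<and> (\<forall>t\<in>{a<..<b}. (y has_vector_derivative Q t (y t)) (at t))"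
proof -
  \<comment> \<open>Clamping the time to \<open>{a..b}\<close> makes the Picard image a bounded
    continuous function on the whole line, which is what the type of bounded continuous functions
    contains.\<close>
  define c where "c t = max a (min b t)" for t
  have ab: "a \<le> b" using s0 by auto
  have c: "c t \<in> {a..b}" for t using ab by (auto simp: c_def)
  \<comment> \<open>The primitive starts at \<open>a\<close> and is renormalized at
    \<open>s0\<close> inside \<open>T\<close>, because \<open>s0\<close> may lie on either side of
    \<open>t\<close>.\<close>
  define I where "I y u = integral {a..u} (\<lambda>s. Q s (y s))" for y u
  define T where "T y t = w + (I y (c t) - I y s0)" for y t
  have I': "(I y has_vector_derivative Q u (y u)) (at u within {a..b})"
    if "continuous_on UNIV y" "u \<in> {a..b}" for y u
    unfolding I_def by (rule integral_has_vector_derivative[OF cont[OF that(1)] that(2)])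
  have I_cont: "continuous_on {a..b} (I y)" if "continuous_on UNIV y" for y
    using I'[OF that] has_vector_derivative_continuous continuous_on_eq_continuous_within by blast
  have T: "T y \<in> bcontfun" if "continuous_on UNIV y" for y
  proof -
    have "continuous_on UNIV c" unfolding c_def by (intro continuous_intros)
    then have "continuous_on UNIV (\<lambda>t. I y (c t))"
      by (rule continuous_on_compose2[OF I_cont[OF that]]) (use c in auto)
    then have "continuous_on UNIV (T y)" unfolding T_def by (intro continuous_intros)
    moreover have "bounded (range (T y))"
    proof (rule bounded_subset)
      show "bounded ((\<lambda>u. w + (I y u - I y s0)) ` {a..b})"
        by (intro compact_imp_bounded compact_continuous_image continuous_intros I_cont that) simp
      show "range (T y) \<subseteq> (\<lambda>u. w + (I y u - I y s0)) ` {a..b}"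
        using c by (auto simp: T_def)
    qed
    ultimately show ?thesis by (simp add: bcontfun_def)
  qed
  have "\<exists>!y. (\<lambda>y. Bcontfun (T (apply_bcontfun y))) y = y"
  proof (rule banach_fix_type[of "1/2"])
    show "\<forall>x y. dist (Bcontfun (T (apply_bcontfun x))) (Bcontfun (T (apply_bcontfun y))) \<le> 1/2 * dist x y"
    proof (intro allI dist_bound)
      fix x y :: "real \<Rightarrow>\<^sub>C 'e" and t
      define J where "J u = I (apply_bcontfun x) u - I (apply_bcontfun y) u" for u
      have J: "(J has_vector_derivative Q u (x u) - Q u (y u)) (at u within {a..b})" if "u \<in> {a..b}" for u
        unfolding J_def by (intro has_vector_derivative_diff I' that) auto
      have "norm (J (c t) - J s0) \<le> (L * dist x y) * norm (c t - s0)"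
      \<comment> \<open>The mean value inequality replaces an estimate of an integral and covers
        both orders of \<open>c t\<close> and \<open>s0\<close>.\<close>
      proof (rule differentiable_bound[where f' = "\<lambda>u h. h *\<^sub>R (Q u (x u) - Q u (y u))" and S = "{a..b}"])
        fix u assume u: "u \<in> {a..b}"
        show "(J has_derivative (\<lambda>h. h *\<^sub>R (Q u (x u) - Q u (y u)))) (at u within {a..b})"
          using J[OF u] by (simp add: has_vector_derivative_def)
        have "norm (Q u (x u) - Q u (y u)) = norm (Q u (x u - y u))"
          by (simp add: linear_diff[OF lin[OF u]])
        also have "\<dots> \<le> L * norm (x u - y u)" by (rule bd[OF u])
        also have "\<dots> \<le> L * dist x y"
          using dist_bounded[of x u y] L by (intro mult_left_mono) (auto simp: dist_norm)
        finally have "norm (Q u (x u) - Q u (y u)) \<le> L * dist x y" .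
        then show "onorm (\<lambda>h. h *\<^sub>R (Q u (x u) - Q u (y u))) \<le> L * dist x y"
          using L by (intro onorm_bound) (auto simp: mult.commute intro: mult_left_mono)
      qed (use c s0 in auto)
      also have "\<dots> \<le> (L * dist x y) * (b - a)"
        using c[of t] s0 L by (intro mult_left_mono) auto
      also have "\<dots> = (L * (b - a)) * dist x y" by simp
      also have "\<dots> \<le> 1/2 * dist x y"
        using L by (intro mult_right_mono) auto
      finally show "dist (apply_bcontfun (Bcontfun (T x)) t) (apply_bcontfun (Bcontfun (T y)) t) \<le> 1/2 * dist x y"
        by (simp add: T Bcontfun_inverse dist_norm T_def J_def algebra_simps)
    qed
  qed auto
  then obtain y where y: "Bcontfun (T (apply_bcontfun y)) = y" by blast
  have fix_y: "apply_bcontfun y = T y"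
    using T[of "apply_bcontfun y"] y by (metis Bcontfun_inverse continuous_on_apply_bcontfun)
  have "apply_bcontfun y s0 = w"
    using s0 by (subst fix_y) (simp add: T_def c_def)
  moreover have "(apply_bcontfun y has_vector_derivative Q t (y t)) (at t)" if t: "t \<in> {a<..<b}" for t
  proof -
    have "(I y has_vector_derivative Q t (y t)) (at t within {a..b})"
      using t by (intro I') auto
    then have "(I y has_vector_derivative Q t (y t)) (at t)"
      using t at_within_interior[of t "{a..b}"] by (simp add: interior_atLeastAtMost_real)
    then have "((\<lambda>u. w + (I y u - I y s0)) has_vector_derivative Q t (y t)) (at t)"
      by (auto intro!: derivative_eq_intros)
    then show ?thesis
    proof (rule has_vector_derivative_transform_within_open[where S = "{a<..<b}"])
      fix s assume "s \<in> {a<..<b}"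
      then show "w + (I y s - I y s0) = y s"
        by (subst (3) fix_y) (simp add: T_def c_def)
    qed (use t in auto)
  qed
  ultimately show ?thesis by blast
qed

section \<open>Bilinear forms and positive definite systems\<close>

lemma bilinear_euclidean_expand:
  fixes B :: "'a::euclidean_space \<Rightarrow> 'b::euclidean_space \<Rightarrow> 'c::real_vector"
  assumes "bilinear B"
  shows "B u v = (\<Sum>i\<in>Basis. \<Sum>j\<in>Basis. ((u \<bullet> i) * (v \<bullet> j)) *\<^sub>R B i j)"
proof -
  have "B u v = B (\<Sum>i\<in>Basis. (u \<bullet> i) *\<^sub>R i) (\<Sum>j\<in>Basis. (v \<bullet> j) *\<^sub>R j)"
    by (simp add: euclidean_representation)
  also have "\<dots> = (\<Sum>(i,j)\<in>Basis \<times> Basis. B ((u \<bullet> i) *\<^sub>R i) ((v \<bullet> j) *\<^sub>R j))"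
    by (rule bilinear_sum[OF assms])
  finally show ?thesis
    by (simp add: sum.cartesian_product bilinear_lmul[OF assms] bilinear_rmul[OF assms] ac_simps)
qed

text \<open>The minimum over the compact product of \<open>B\<close> with the unit sphere is
  positive, and homogeneity extends the bound to all \<open>v\<close>. Joint continuity follows from
  continuity in \<open>x\<close> by expanding in a basis.\<close>

lemma positive_definite_uniform_bound:
  fixes G :: "'a::euclidean_space \<Rightarrow> 'e::euclidean_space \<Rightarrow> 'e \<Rightarrow> real"
  assumes "compact B" and bil: "\<And>x. x \<in> B \<Longrightarrow> bilinear (G x)"
    and pos: "\<And>x v. x \<in> B \<Longrightarrow> v \<noteq> 0 \<Longrightarrow> G x v v > 0"
    and cont: "\<And>u v. continuous_on B (\<lambda>x. G x u v)"
  shows "\<exists>m>0. \<forall>x\<in>B. \<forall>v. m * (norm v)\<^sup>2 \<le> G x v v"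
proof (cases "B = {}")
  case False
  let ?S = "B \<times> sphere (0::'e) 1"
  have ne: "?S \<noteq> {}" using False by auto
  have cpt: "compact ?S" using assms by (intro compact_Times) auto
  have "continuous_on ?S (\<lambda>z. \<Sum>i\<in>Basis. \<Sum>j\<in>Basis. ((snd z \<bullet> i) * (snd z \<bullet> j)) *\<^sub>R G (fst z) i j)"
    by (intro continuous_intros continuous_on_compose2[OF cont]) auto
  then have ct: "continuous_on ?S (\<lambda>z. G (fst z) (snd z) (snd z))"
    by (rule continuous_on_eq) (rule bilinear_euclidean_expand[OF bil, symmetric], auto)
  obtain z where z: "z \<in> ?S" "\<And>y. y \<in> ?S \<Longrightarrow> G (fst z) (snd z) (snd z) \<le> G (fst y) (snd y) (snd y)"
    using continuous_attains_inf[OF cpt ne ct] by blast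
  define m where "m = G (fst z) (snd z) (snd z)"
  have "m > 0" unfolding m_def using z(1) by (intro pos) auto
  moreover have "m * (norm v)\<^sup>2 \<le> G x v v" if x: "x \<in> B" for x v
  proof (cases "v = 0")
    case True
    then show ?thesis using bilinear_lzero[OF bil[OF x]] by simp
  next
    case False
    have "m \<le> G x (v /\<^sub>R norm v) (v /\<^sub>R norm v)"
      using z(2)[of "(x, v /\<^sub>R norm v)"] x False by (simp add: m_def)
    also have "\<dots> = G x v v / (norm v)\<^sup>2"
      by (simp add: bilinear_lmul[OF bil[OF x]] bilinear_rmul[OF bil[OF x]] power2_eq_square field_simps)
    finally show ?thesis using False by (simp add: field_simps)
  qed
  ultimately show ?thesis by blast
qed (auto intro: exI[of _ 1])

lemma smooth_on_add:
  assumes "smooth_on S f" "smooth_on S h" "open S"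
  shows "smooth_on S (\<lambda>x. f x + h x)"
proof -
  have "Ck_on k S (\<lambda>x. f x + h x)" if "Ck_on k S f" "Ck_on k S h" for k
    using that
  proof (induction k arbitrary: f h)
    case (Suc k)
    have d: "((\<lambda>x. f x + h x) has_derivative (\<lambda>v. frechet_derivative f (at x) v + frechet_derivative h (at x) v)) (at x)"
      if "x \<in> S" for x
      using Suc.prems that frechet_derivative_works by (intro has_derivative_add) auto
    have "Ck_on k S (\<lambda>x. frechet_derivative (\<lambda>x. f x + h x) (at x) v)" for v
    proof -
      have "Ck_on k S (\<lambda>y. frechet_derivative f (at y) v + frechet_derivative h (at y) v)"
        using Suc.prems by (intro Suc.IH) auto
      then show ?thesis
        by (rule iffD2[OF Ck_on_cong[OF assms(3)], rotated])
          (rule fun_cong[OF frechet_derivative_at[OF d], symmetric])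
    qed
    then show ?case using d by (auto simp: differentiable_def)
  qed (auto intro: continuous_intros)
  with assms show ?thesis by (simp add: smooth_on_def)
qed

text \<open>It justifies the definite description of the Christoffel vector and later produces the
  vector dual to \<beta>. Definiteness makes the matrix \<open>T\<close> injective, and dimension
  makes it surjective.\<close>

lemma positive_definite_riesz:
  fixes B :: "'e::euclidean_space \<Rightarrow> 'e \<Rightarrow> real"
  assumes B: "bilinear B" "\<And>v. v \<noteq> 0 \<Longrightarrow> B v v > 0" and l: "linear l"
  shows "\<exists>!w. \<forall>z. B w z = l z"
proof -
  define T where "T w = (\<Sum>i\<in>Basis. B w i *\<^sub>R i)" for w
  have linT: "linear T"
    unfolding T_def using B(1)
    by (auto intro!: linearI simp: bilinear_ladd bilinear_lmul scaleR_left_distrib sum.distrib scaleR_sum_right)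
  have T_inner: "T w \<bullet> i = B w i" if "i \<in> Basis" for w i
    using that by (simp add: T_def inner_sum_left inner_Basis if_distrib cong: if_cong)
  have lB: "linear (B w)" for w using B(1) by (simp add: bilinear_def)
  have T_eq: "B w z = T w \<bullet> z" for w z
  proof -
    have "B w z = (\<Sum>i\<in>Basis. (z \<bullet> i) *\<^sub>R B w i)" by (rule linear_euclidean_expand[OF lB])
    also have "\<dots> = T w \<bullet> z"
      by (subst euclidean_inner) (simp add: T_inner mult.commute)
    finally show ?thesis .
  qed
  have "inj T"
  proof (subst linear_injective_0[OF linT], intro allI impI)
    fix w assume "T w = 0"
    then have "B w w = 0" by (simp add: T_eq)
    then show "w = 0" using B(2)[of w] by (cases "w = 0") auto
  qed
  then have "surj T" using linear_injective_imp_surjective[OF linT] by blast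
  then obtain w where w: "T w = (\<Sum>i\<in>Basis. l i *\<^sub>R i)" by (metis surjD)
  have "B w z = l z" for z
  proof -
    have "B w z = (\<Sum>i\<in>Basis. (z \<bullet> i) *\<^sub>R l i)"
      unfolding T_eq w by (simp add: inner_sum_left inner_commute[of z] mult.commute)
    then show ?thesis by (simp only: linear_euclidean_expand[OF l, of z])
  qed
  moreover have "w' = w" if "\<forall>z. B w' z = l z" for w'
  proof -
    have "T w' \<bullet> z = T w \<bullet> z" for z
      using that \<open>\<And>z. B w z = l z\<close> by (simp add: T_eq)
    then have "T w' = T w" by (metis vector_eq_rdot)
    then show ?thesis using \<open>inj T\<close> by (simp add: injD)
  qed
  ultimately show ?thesis by blast
qed

lemma bilinear_bound_Basis:
  fixes h :: "'a::euclidean_space \<Rightarrow> 'b::euclidean_space \<Rightarrow> 'c::real_normed_vector"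
  assumes h: "bilinear h"
  shows "norm (h u v) \<le> (\<Sum>i\<in>Basis. \<Sum>j\<in>Basis. norm (h i j)) * (norm u * norm v)"
proof -
  have "norm (h u v) \<le> (\<Sum>i\<in>Basis. \<Sum>j\<in>Basis. norm (((u \<bullet> i) * (v \<bullet> j)) *\<^sub>R h i j))"
    by (subst bilinear_euclidean_expand[OF h]) (intro order_trans[OF norm_sum] sum_mono order_refl)
  also have "\<dots> \<le> (\<Sum>i\<in>Basis. \<Sum>j\<in>Basis. (norm u * norm v) * norm (h i j))"
    by (intro sum_mono) (auto simp: abs_mult intro!: mult_mono Basis_le_norm)
  also have "\<dots> = (\<Sum>i\<in>Basis. \<Sum>j\<in>Basis. norm (h i j)) * (norm u * norm v)"
    by (simp add: sum_distrib_left mult.commute)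
  finally show ?thesis .
qed

lemma linear_bound_Basis:
  fixes h :: "'a::euclidean_space \<Rightarrow> 'c::real_normed_vector"
  assumes h: "linear h"
  shows "norm (h u) \<le> (\<Sum>i\<in>Basis. norm (h i)) * norm u"
proof -
  have "norm (h u) \<le> (\<Sum>i\<in>Basis. norm ((u \<bullet> i) *\<^sub>R h i))"
    by (subst linear_euclidean_expand[OF h]) (rule norm_sum)
  also have "\<dots> \<le> (\<Sum>i\<in>Basis. norm u * norm (h i))"
    by (intro sum_mono) (auto intro!: mult_right_mono Basis_le_norm)
  finally show ?thesis by (simp add: sum_distrib_left mult.commute)
qed

lemma bilinear_diff: "bilinear f \<Longrightarrow> bilinear h \<Longrightarrow> bilinear (\<lambda>u v. f u v - h u v)"
  by (auto simp: bilinear_def intro: linear_compose_sub)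

text \<open>Coercivity gives Lipschitz dependence of the solution \<open>w x\<close> on
  \<open>x\<close> without inverting a matrix. Applied to the Koszul identity it makes the
  Christoffel symbols Lipschitz, which is the regularity that the differential equations below ask
  for.\<close>

lemma positive_definite_solution_lipschitz:
  fixes G :: "'a::euclidean_space \<Rightarrow> 'e::euclidean_space \<Rightarrow> 'e \<Rightarrow> real" and w :: "'a \<Rightarrow> 'e"
  assumes B: "compact B" "convex B" "B \<subseteq> S"
    and bil: "\<And>x. x \<in> B \<Longrightarrow> bilinear (G x)"
    and pos: "\<And>x v. x \<in> B \<Longrightarrow> v \<noteq> 0 \<Longrightarrow> G x v v > 0"
    and G: "\<And>u v. smooth_on S (\<lambda>x. G x u v)"
    and lin: "\<And>x. x \<in> B \<Longrightarrow> linear (k x)" and k: "\<And>z. smooth_on S (\<lambda>x. k x z)"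
    and w: "\<And>x z. x \<in> B \<Longrightarrow> G x (w x) z = k x z"
  shows "\<exists>L\<ge>0. \<forall>x\<in>B. \<forall>y\<in>B. norm (w x) \<le> L \<and> norm (w x - w y) \<le> L * norm (x - y)"
proof -
  have contG: "continuous_on B (\<lambda>x. G x u v)" for u v
    using smooth_on_continuous_on[OF G] B(3) continuous_on_subset by blast
  obtain m where m: "m > 0" "\<And>x v. x \<in> B \<Longrightarrow> m * (norm v)\<^sup>2 \<le> G x v v"
    using positive_definite_uniform_bound[OF B(1) bil pos contG] by blast
  have "\<forall>ij. \<exists>L\<ge>0. \<forall>x\<in>B. \<forall>y\<in>B. norm (G x (fst ij) (snd ij) - G y (fst ij) (snd ij)) \<le> L * norm (x - y)"
    using smooth_on_lipschitz[OF G B] by blast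
  then obtain LG where LG: "\<And>ij. LG ij \<ge> 0"
    "\<And>ij x y. x \<in> B \<Longrightarrow> y \<in> B \<Longrightarrow> norm (G x (fst ij) (snd ij) - G y (fst ij) (snd ij)) \<le> LG ij * norm (x - y)"
    by metis
  have "\<forall>i. \<exists>L\<ge>0. \<forall>x\<in>B. \<forall>y\<in>B. norm (k x i - k y i) \<le> L * norm (x - y)"
    using smooth_on_lipschitz[OF k B] by blast
  then obtain LK where LK: "\<And>i. LK i \<ge> 0"
    "\<And>i x y. x \<in> B \<Longrightarrow> y \<in> B \<Longrightarrow> norm (k x i - k y i) \<le> LK i * norm (x - y)"
    by metis
  have "continuous_on B (\<lambda>x. \<Sum>i\<in>Basis. norm (k x i))"
    using smooth_on_continuous_on[OF k] B(3) by (intro continuous_intros) (auto intro: continuous_on_subset)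
  then have "bounded ((\<lambda>x. \<Sum>i\<in>Basis. norm (k x i)) ` B)"
    using B(1) compact_continuous_image compact_imp_bounded by blast
  then obtain M0 where M0: "\<And>x. x \<in> B \<Longrightarrow> norm (\<Sum>i\<in>Basis. norm (k x i)) \<le> M0"
    unfolding bounded_iff by blast
  define M where "M = max M0 0"
  define SG where "SG = (\<Sum>i\<in>(Basis::'e set). \<Sum>j\<in>(Basis::'e set). LG (i,j))"
  define SK where "SK = (\<Sum>i\<in>(Basis::'e set). LK i)"
  have nn: "M \<ge> 0" "SG \<ge> 0" "SK \<ge> 0"
    unfolding M_def SG_def SK_def using LG LK by (auto intro!: sum_nonneg)
  have bd: "norm (w x) \<le> M / m" if x: "x \<in> B" for x
  proof (cases "w x = 0")
    case False
    have "m * (norm (w x))\<^sup>2 \<le> k x (w x)" using m(2)[OF x, of "w x"] w[OF x] by simp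
    also have "\<dots> \<le> norm (k x (w x))" by simp
    also have "\<dots> \<le> (\<Sum>i\<in>Basis. norm (k x i)) * norm (w x)" by (rule linear_bound_Basis[OF lin[OF x]])
    also have "\<dots> \<le> M * norm (w x)" using M0[OF x] by (intro mult_right_mono) (auto simp: M_def)
    finally have "m * norm (w x) \<le> M" using False by (simp add: power2_eq_square)
    then show ?thesis using m(1) by (simp add: field_simps)
  qed (use m nn in simp)
  have lip: "norm (w x - w y) \<le> (SK + SG * (M / m)) / m * norm (x - y)" if x: "x \<in> B" and y: "y \<in> B" for x y
  proof (cases "w x = w y")
    case False
    let ?d = "w x - w y"
    have "m * (norm ?d)\<^sup>2 \<le> G x ?d ?d" by (rule m(2)[OF x])
    \<comment> \<open>The equations at \<open>x\<close> and at \<open>y\<close> are tested against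
      the difference \<open>?d\<close> itself and subtracted; what remains is linear in the
      increments of \<open>k\<close> and \<open>G\<close>.\<close>
    also have "\<dots> = (k x ?d - k y ?d) - (G x (w y) ?d - G y (w y) ?d)"
      using w[OF x, of ?d] w[OF y, of ?d] bilinear_lsub[OF bil[OF x], of "w x" "w y" ?d] by simp
    also have "\<dots> \<le> norm (k x ?d - k y ?d) + norm (G x (w y) ?d - G y (w y) ?d)" by simp
    also have "\<dots> \<le> (SK * norm (x - y)) * norm ?d + (SG * norm (x - y)) * (norm (w y) * norm ?d)"
    proof (rule add_mono)
      have "norm (k x ?d - k y ?d) \<le> (\<Sum>i\<in>Basis. norm (k x i - k y i)) * norm ?d"
        by (rule linear_bound_Basis[OF linear_compose_sub[OF lin[OF x] lin[OF y]]])
      also have "\<dots> \<le> (\<Sum>i\<in>Basis. LK i * norm (x - y)) * norm ?d"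
        using LK(2)[OF x y] by (intro mult_right_mono sum_mono) auto
      finally show "norm (k x ?d - k y ?d) \<le> (SK * norm (x - y)) * norm ?d"
        by (simp add: SK_def sum_distrib_right)
      have "norm (G x (w y) ?d - G y (w y) ?d) \<le>
          (\<Sum>i\<in>Basis. \<Sum>j\<in>Basis. norm (G x i j - G y i j)) * (norm (w y) * norm ?d)"
        by (rule bilinear_bound_Basis[OF bilinear_diff[OF bil[OF x] bil[OF y]]])
      also have "\<dots> \<le> (\<Sum>i\<in>Basis. \<Sum>j\<in>Basis. LG (i,j) * norm (x - y)) * (norm (w y) * norm ?d)"
        using LG(2)[OF x y] by (intro mult_right_mono sum_mono) auto
      finally show "norm (G x (w y) ?d - G y (w y) ?d) \<le> (SG * norm (x - y)) * (norm (w y) * norm ?d)"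
        by (simp add: SG_def sum_distrib_right)
    qed
    also have "\<dots> \<le> (SK * norm (x - y)) * norm ?d + (SG * norm (x - y)) * (M / m * norm ?d)"
      using bd[OF y] nn by (intro add_left_mono mult_left_mono mult_right_mono) auto
    also have "\<dots> = ((SK + SG * (M / m)) * norm (x - y)) * norm ?d" by (simp add: algebra_simps)
    finally have "m * norm ?d \<le> (SK + SG * (M / m)) * norm (x - y)"
      using False by (simp add: power2_eq_square)
    then show ?thesis using m(1) by (simp add: field_simps)
  qed (use m nn in simp)
  have "(SK + SG * (M / m)) / m \<ge> 0" "M / m \<ge> 0" using m nn by auto
  moreover have "norm (w x - w y) \<le> max (M / m) ((SK + SG * (M / m)) / m) * norm (x - y)"
    if "x \<in> B" "y \<in> B" for x y
    by (rule order_trans[OF lip[OF that]], rule mult_right_mono) auto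
  ultimately show ?thesis
    by (intro exI[of _ "max (M / m) ((SK + SG * (M / m)) / m)"])
      (auto intro: max.coboundedI1[OF bd] simp del: times_divide_eq_right)
qed

lemma linear_frechet_derivative: "smooth_on W F \<Longrightarrow> z \<in> W \<Longrightarrow> linear (frechet_derivative F (at z))"
  using smooth_on_has_derivative has_derivative_linear by blast

section \<open>Limits at infinity\<close>

lemma exp_decay_tendsto_0:
  fixes a C :: real
  assumes "a > 0"
  shows "((\<lambda>s. C * exp (- a * s)) \<longlongrightarrow> 0) at_top"
proof (rule tendsto_mult_right_zero, rule filterlim_compose[OF exp_at_bot])
  show "filterlim (\<lambda>s. - a * s) at_bot at_top"
    by (rule filterlim_tendsto_neg_mult_at_bot[OF tendsto_const _ filterlim_ident]) (use assms in simp)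
qed

text \<open>The rate survives in the limit: let the later time tend to infinity in the Cauchy
  estimate. A limit along the integers is enough, since the resulting bound extends it to all real
  times.\<close>

lemma exp_cauchy_imp_limit:
  fixes f :: "real \<Rightarrow> real"
  assumes a: "a > 0" and f: "\<And>s t. R \<le> s \<Longrightarrow> s \<le> t \<Longrightarrow> \<bar>f t - f s\<bar> \<le> C * exp (- a * s)"
  shows "\<exists>L. (f \<longlongrightarrow> L) at_top \<and> (\<forall>t\<ge>R. \<bar>f t - L\<bar> \<le> C * exp (- a * t))"
proof -
  have e0: "((\<lambda>s. C * exp (- a * s)) \<longlongrightarrow> 0) at_top"
    by (rule exp_decay_tendsto_0[OF a])
  have "Cauchy (\<lambda>n. f (real n))"
    unfolding Cauchy_altdef
  proof (intro allI impI)
    fix e :: real assume e: "e > 0"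
    then have "\<forall>\<^sub>F s in at_top. C * exp (- a * s) < e" using e0 by (rule order_tendstoD(2)[rotated])
    then have "\<forall>\<^sub>F n in sequentially. C * exp (- a * real n) < e"
      by (rule eventually_compose_filterlim[OF _ filterlim_real_sequentially])
    then obtain M where M: "\<And>n. n \<ge> M \<Longrightarrow> C * exp (- a * real n) < e"
      unfolding eventually_sequentially by blast
    have "dist (f (real m)) (f (real n)) < e" if "m \<ge> max M (nat \<lceil>R\<rceil>)" "n > m" for m n
    proof -
      have "R \<le> real m" using that(1) by linarith
      then have "\<bar>f (real n) - f (real m)\<bar> \<le> C * exp (- a * real m)" using that(2) by (intro f) auto
      also have "\<dots> < e" using that(1) by (intro M) auto
      finally show ?thesis by (simp add: dist_real_def abs_minus_commute)
    qed
    then show "\<exists>M. \<forall>m\<ge>M. \<forall>n>m. dist (f (real m)) (f (real n)) < e" by blast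
  qed
  then obtain L where L: "(\<lambda>n. f (real n)) \<longlonglongrightarrow> L" using Cauchy_convergent convergent_def by blast
  have bd: "\<bar>f t - L\<bar> \<le> C * exp (- a * t)" if t: "t \<ge> R" for t
  proof (rule tendsto_upperbound)
    show "(\<lambda>n. \<bar>f t - f (real n)\<bar>) \<longlonglongrightarrow> \<bar>f t - L\<bar>" by (intro tendsto_intros L)
    have "\<forall>\<^sub>F n in sequentially. real n \<ge> t"
      using filterlim_real_sequentially by (simp add: filterlim_at_top)
    then show "\<forall>\<^sub>F n in sequentially. \<bar>f t - f (real n)\<bar> \<le> C * exp (- a * t)"
      by (rule eventually_mono) (use f[OF t] in \<open>simp add: abs_minus_commute[of "f t"]\<close>)
  qed simp
  have "((\<lambda>t. f t - L) \<longlongrightarrow> 0) at_top"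
    by (rule Lim_null_comparison[OF _ e0])
      (use bd in \<open>auto simp: eventually_at_top_linorder intro!: exI[of _ R]\<close>)
  then have "(f \<longlongrightarrow> L) at_top" by (rule LIM_zero_cancel)
  with bd show ?thesis by blast
qed

text \<open>The form in which uniform convergence of tensors is used: the error is at most
  \<open>\<epsilon>\<close> times a product of norms of vectors that move with \<open>r\<close> but
  converge.\<close>

lemma tendsto_zero_of_uniform:
  fixes f :: "real \<Rightarrow> 'b::real_normed_vector"
  assumes "\<And>\<epsilon>. \<epsilon> > 0 \<Longrightarrow> \<forall>\<^sub>F r in at_top. norm (f r) \<le> \<epsilon> * b r" "(b \<longlongrightarrow> B) at_top"
  shows "(f \<longlongrightarrow> 0) at_top"
  unfolding tendsto_iff
proof (intro allI impI)
  fix e :: real assume e: "e > 0"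
  define \<epsilon> where "\<epsilon> = e / (2 * (\<bar>B\<bar> + 1))"
  have \<epsilon>: "\<epsilon> > 0" using e by (simp add: \<epsilon>_def)
  have "\<forall>\<^sub>F r in at_top. b r < \<bar>B\<bar> + 1" using assms(2) by (rule order_tendstoD(2)) simp
  with assms(1)[OF \<epsilon>] show "\<forall>\<^sub>F r in at_top. dist (f r) 0 < e"
  proof eventually_elim
    case (elim r)
    have "norm (f r) \<le> \<epsilon> * (\<bar>B\<bar> + 1)" using elim \<epsilon> by (intro order_trans[OF elim(1)] mult_left_mono) auto
    also have "\<dots> = e / 2" by (simp add: \<epsilon>_def field_simps)
    finally show ?case using e by simp
  qed
qed

lemma exp_cancel: "exp r * (exp (- r) * z) = z" "exp (- r) * (exp r * z) = z" for r z :: real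
  by (simp_all add: exp_minus)

lemma ev_pos: "(\<And>r. r > 0 \<Longrightarrow> P r) \<Longrightarrow> \<forall>\<^sub>F r :: real in at_top. P r"
  by (rule eventually_mono[OF eventually_gt_at_top[of 0]])

lemma limit_unique_ev:
  fixes f h :: "real \<Rightarrow> 'b::real_normed_vector"
  assumes "(f \<longlongrightarrow> l) at_top" "(h \<longlongrightarrow> k) at_top" "\<And>r. r > 0 \<Longrightarrow> f r = h r"
  shows "l = k"
proof -
  have "(h \<longlongrightarrow> l) at_top" by (rule Lim_transform_eventually[OF assms(1) ev_pos]) (rule assms(3))
  then show ?thesis using assms(2) tendsto_unique[OF trivial_limit_at_top_linorder] by blast
qed

section \<open>Charts\<close>

text \<open>The Jacobian of the transition map. Both \<open>coord\<close> and \<open>vec\<close> are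
  instances in which one of the two charts is the chosen one, so a single composition rule serves
  for both.\<close>

definition chart_change ::
    "('m, 'e::euclidean_space) chart \<Rightarrow> ('m, 'e) chart \<Rightarrow> 'm \<Rightarrow> 'e \<Rightarrow> 'e" where
  "chart_change c d p = frechet_derivative (snd d \<circ> chart_inv c) (at (snd c p))"

lemma coord_eq_chart_change: "coord A c p = chart_change (chart_at A p) c p"
  by (simp add: fun_eq_iff coord_def chart_change_def)

lemma vec_eq_chart_change: "vec A c p = chart_change c (chart_at A p) p"
  by (simp add: fun_eq_iff vec_def chart_change_def)

context
  fixes c :: "('m::t2_space, 'e::euclidean_space) chart"
  assumes c: "is_chart c"
begin

lemma chart_inv_snd [simp]: "p \<in> fst c \<Longrightarrow> chart_inv c (snd c p) = p"
  using c by (simp add: chart_inv_def is_chart_def)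

lemma snd_chart_inv [simp]: "x \<in> snd c ` fst c \<Longrightarrow> snd c (chart_inv c x) = x"
  by (simp add: chart_inv_def f_inv_into_f)

lemma chart_inv_in [simp]: "x \<in> snd c ` fst c \<Longrightarrow> chart_inv c x \<in> fst c"
  by (simp add: chart_inv_def inv_into_into)

lemma mem_chart_image_iff: "x \<in> snd c ` (fst c \<inter> U) \<longleftrightarrow> x \<in> snd c ` fst c \<and> chart_inv c x \<in> U"
proof
  assume "x \<in> snd c ` (fst c \<inter> U)"
  then show "x \<in> snd c ` fst c \<and> chart_inv c x \<in> U" by auto
next
  assume "x \<in> snd c ` fst c \<and> chart_inv c x \<in> U"
  then have "x = snd c (chart_inv c x)" "chart_inv c x \<in> fst c \<inter> U"
    using snd_chart_inv chart_inv_in by (simp_all only: IntI)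
  then show "x \<in> snd c ` (fst c \<inter> U)" by (rule image_eqI)
qed

lemma open_chart_domain: "open (fst c)"
  using c by (simp add: is_chart_def)

lemma open_chart_range: "open (snd c ` fst c)"
  using c by (simp add: is_chart_def)

lemma open_chart_image:
  assumes "open U"
  shows "open (snd c ` (fst c \<inter> U))"
proof -
  have "open (snd c ` fst c \<inter> chart_inv c -` U)"
    using c assms by (intro continuous_open_preimage) (auto simp: is_chart_def)
  moreover have "snd c ` (fst c \<inter> U) = snd c ` fst c \<inter> chart_inv c -` U"
    using mem_chart_image_iff by blast
  ultimately show ?thesis by simp
qed

lemma isCont_chart: "p \<in> fst c \<Longrightarrow> isCont (snd c) p"
  using c continuous_on_eq_continuous_at unfolding is_chart_def by blast

lemma isCont_chart_inv: "x \<in> snd c ` fst c \<Longrightarrow> isCont (chart_inv c) x"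
  using c continuous_on_eq_continuous_at unfolding is_chart_def by blast

end

lemma isCont_eventually_in_open:
  assumes "isCont f t" "open U" "f t \<in> U"
  shows "\<forall>\<^sub>F s in nhds t. f s \<in> U"
  using assms(1)[unfolded isCont_def tendsto_at_iff_tendsto_nhds] assms(2,3) by (rule topological_tendstoD)

lemma isCont_open_vimage:
  assumes "isCont f t" "open U" "f t \<in> U"
  obtains W where "open W" "t \<in> W" "\<And>s. s \<in> W \<Longrightarrow> f s \<in> U"
  using isCont_eventually_in_open[OF assms] unfolding eventually_nhds by blast

lemma smooth_map_chart:
  "smooth_map A B W f \<Longrightarrow> c \<in> A \<Longrightarrow> d \<in> B \<Longrightarrow>
    smooth_on (snd c ` (fst c \<inter> W \<inter> f -` fst d)) (snd d \<circ> f \<circ> chart_inv c)"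
  by (simp add: smooth_map_def)

lemma smooth_map_on_subset: "smooth_map_on B C S f \<Longrightarrow> S' \<subseteq> S \<Longrightarrow> smooth_map_on B C S' f"
  unfolding smooth_map_on_def
  by (intro ballI) (drule bspec, erule (1) subsetD, elim exE conjE, intro exI conjI, assumption+, blast)

locale manifold =
  fixes A :: "('m::t2_space, 'e::euclidean_space) chart set"
  assumes smooth_atlas: "smooth_atlas A"
begin

lemma is_chart [simp]: "c \<in> A \<Longrightarrow> is_chart c"
  using smooth_atlas by (simp add: smooth_atlas_def)

lemma chart_at_in [simp]: "chart_at A p \<in> A" "p \<in> fst (chart_at A p)"
proof -
  have "\<exists>c. c \<in> A \<and> p \<in> fst c"
    using smooth_atlas unfolding smooth_atlas_def by (metis UN_iff UNIV_I)
  from someI_ex[OF this] show "chart_at A p \<in> A" "p \<in> fst (chart_at A p)"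
    by (auto simp: chart_at_def)
qed

lemma smooth_transition:
  "c \<in> A \<Longrightarrow> d \<in> A \<Longrightarrow> smooth_on (snd c ` (fst c \<inter> fst d)) (snd d \<circ> chart_inv c)"
  using smooth_atlas by (simp add: smooth_atlas_def)

lemma transition_has_derivative:
  assumes "c \<in> A" "d \<in> A" "p \<in> fst c" "p \<in> fst d"
  shows "(snd d \<circ> chart_inv c has_derivative chart_change c d p) (at (snd c p))"
  unfolding chart_change_def
  using assms by (intro smooth_on_has_derivative[OF smooth_transition]) auto

lemma linear_chart_change:
  assumes "c \<in> A" "d \<in> A" "p \<in> fst c" "p \<in> fst d"
  shows "linear (chart_change c d p)"
  using transition_has_derivative[OF assms] has_derivative_linear by blast

lemma chart_change_vector_derivative:
  assumes "c \<in> A" "d \<in> A" and p: "\<sigma> t \<in> fst c" "\<sigma> t \<in> fst d" and "isCont \<sigma> t"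
    and v: "(snd c \<circ> \<sigma> has_vector_derivative v) (at t)"
  shows "(snd d \<circ> \<sigma> has_vector_derivative chart_change c d (\<sigma> t) v) (at t)"
proof -
  obtain W where W: "open W" "t \<in> W" "\<And>s. s \<in> W \<Longrightarrow> \<sigma> s \<in> fst c"
    using isCont_open_vimage[OF \<open>isCont \<sigma> t\<close> open_chart_domain p(1)] assms by auto
  have "((\<lambda>s. (snd d \<circ> chart_inv c) ((snd c \<circ> \<sigma>) s)) has_vector_derivative chart_change c d (\<sigma> t) v) (at t)"
    by (rule has_vector_derivative_compose_derivative[OF _ v])
      (use transition_has_derivative[OF assms(1,2) p] in \<open>simp add: o_def\<close>)
  then show ?thesis
    by (rule has_vector_derivative_transform_within_open[OF _ W(1,2)])
      (use assms W in auto)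
qed

lemma chart_change_self:
  assumes "c \<in> A" "p \<in> fst c"
  shows "chart_change c c p v = v"
proof -
  have "((\<lambda>x. x) has_derivative (\<lambda>x. x)) (at (snd c p))" by simp
  then have "(snd c \<circ> chart_inv c has_derivative (\<lambda>x. x)) (at (snd c p))"
    by (rule has_derivative_transform_within_open[OF _ open_chart_range[of c]])
      (use assms in auto)
  then have "chart_change c c p = (\<lambda>x. x)"
    using transition_has_derivative[of c c p] assms has_derivative_unique by blast
  then show ?thesis by simp
qed

text \<open>The chain rule for transition maps. That \<open>vec\<close> and \<open>coord\<close> are
  mutually inverse is the case where the first and the last chart coincide.\<close>

lemma chart_change_comp:
  assumes "c \<in> A" "d \<in> A" "e \<in> A" "p \<in> fst c" "p \<in> fst d" "p \<in> fst e"
  shows "chart_change d e p (chart_change c d p v) = chart_change c e p v"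
proof -
  have ch: "is_chart c" "is_chart d" "is_chart e" using assms by auto
  let ?S = "snd c ` (fst c \<inter> (fst d \<inter> fst e))"
  have "(snd e \<circ> chart_inv d has_derivative chart_change d e p) (at ((snd d \<circ> chart_inv c) (snd c p)))"
    using transition_has_derivative[of d e p] assms by simp
  then have "((snd e \<circ> chart_inv d) \<circ> (snd d \<circ> chart_inv c) has_derivative
      chart_change d e p \<circ> chart_change c d p) (at (snd c p))"
    by (intro diff_chain_at transition_has_derivative assms)
  then have "(snd e \<circ> chart_inv c has_derivative chart_change d e p \<circ> chart_change c d p) (at (snd c p))"
  proof (rule has_derivative_transform_within_open)
    show "open ?S"
      by (intro open_chart_image ch open_Int open_chart_domain)
    show "snd c p \<in> ?S" using assms by auto
    fix x assume "x \<in> ?S"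
    then show "(snd e \<circ> chart_inv d \<circ> (snd d \<circ> chart_inv c)) x = (snd e \<circ> chart_inv c) x"
      using ch by (auto simp: mem_chart_image_iff)
  qed
  then have "chart_change d e p \<circ> chart_change c d p = chart_change c e p"
    using transition_has_derivative[of c e p] assms has_derivative_unique by blast
  then show ?thesis by (metis comp_apply)
qed

lemma linear_coord: "c \<in> A \<Longrightarrow> p \<in> fst c \<Longrightarrow> linear (coord A c p)"
  by (simp add: coord_eq_chart_change linear_chart_change)

lemma linear_vec: "c \<in> A \<Longrightarrow> p \<in> fst c \<Longrightarrow> linear (vec A c p)"
  by (simp add: vec_eq_chart_change linear_chart_change)

lemma vec_coord [simp]: "c \<in> A \<Longrightarrow> p \<in> fst c \<Longrightarrow> vec A c p (coord A c p v) = v"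
  by (simp add: coord_eq_chart_change vec_eq_chart_change chart_change_comp chart_change_self)

lemma coord_vec [simp]: "c \<in> A \<Longrightarrow> p \<in> fst c \<Longrightarrow> coord A c p (vec A c p v) = v"
  by (simp add: coord_eq_chart_change vec_eq_chart_change chart_change_comp chart_change_self)

lemma coord_chart_at [simp]: "coord A (chart_at A p) p v = v"
  by (simp add: coord_eq_chart_change chart_change_self)

lemma vec_chart_at [simp]: "vec A (chart_at A p) p v = v"
  by (simp add: vec_eq_chart_change chart_change_self)

lemma chart_change_coord:
  "c \<in> A \<Longrightarrow> d \<in> A \<Longrightarrow> p \<in> fst c \<Longrightarrow> p \<in> fst d \<Longrightarrow> chart_change c d p (coord A c p v) = coord A d p v"
  by (simp add: coord_eq_chart_change chart_change_comp)

lemma vec_chart_change: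
  "c \<in> A \<Longrightarrow> d \<in> A \<Longrightarrow> p \<in> fst c \<Longrightarrow> p \<in> fst d \<Longrightarrow> vec A d p (chart_change c d p v) = vec A c p v"
  by (simp add: vec_eq_chart_change chart_change_comp)

text \<open>\<open>velocity\<close> is only meaningful for curves satisfying this predicate.\<close>

definition has_velocity :: "(real \<Rightarrow> 'm) \<Rightarrow> real \<Rightarrow> 'e \<Rightarrow> bool" where
  "has_velocity \<sigma> t v \<longleftrightarrow> isCont \<sigma> t \<and> (snd (chart_at A (\<sigma> t)) \<circ> \<sigma> has_vector_derivative v) (at t)"

lemma has_velocity_velocity: "has_velocity \<sigma> t v \<Longrightarrow> velocity A \<sigma> t = v"
  by (simp add: has_velocity_def velocity_def vector_derivative_at)

lemma has_velocity_chart: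
  assumes "has_velocity \<sigma> t v" "c \<in> A" "\<sigma> t \<in> fst c"
  shows "(snd c \<circ> \<sigma> has_vector_derivative coord A c (\<sigma> t) v) (at t)"
  unfolding coord_eq_chart_change
  using assms by (intro chart_change_vector_derivative) (auto simp: has_velocity_def)

lemma has_velocityI:
  assumes "isCont \<sigma> t" "c \<in> A" "\<sigma> t \<in> fst c" "(snd c \<circ> \<sigma> has_vector_derivative w) (at t)"
  shows "has_velocity \<sigma> t (vec A c (\<sigma> t) w)"
  unfolding has_velocity_def vec_eq_chart_change
  using assms by (intro conjI chart_change_vector_derivative) auto

lemma has_velocity_transform:
  assumes "has_velocity \<sigma> t v" "open W" "t \<in> W" "\<And>s. s \<in> W \<Longrightarrow> \<sigma> s = \<tau> s"
  shows "has_velocity \<tau> t v"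
proof -
  have "(snd (chart_at A (\<sigma> t)) \<circ> \<tau> has_vector_derivative v) (at t)"
  proof (rule has_vector_derivative_transform_within_open[OF _ assms(2,3)])
    show "(snd (chart_at A (\<sigma> t)) \<circ> \<sigma> has_vector_derivative v) (at t)"
      using assms(1) by (simp add: has_velocity_def)
  qed (simp add: assms(4))
  moreover have "\<forall>\<^sub>F s in nhds t. \<sigma> s = \<tau> s"
    using assms(2-4) unfolding eventually_nhds by blast
  then have "isCont \<tau> t"
    using assms(1) isCont_cong[of \<sigma> \<tau> t] by (simp add: has_velocity_def)
  ultimately show ?thesis using assms(4)[OF assms(3)] by (simp add: has_velocity_def)
qed

lemma smooth_map_real_iff:
  "smooth_map real_atlas A W \<sigma> \<longleftrightarrow> continuous_on W \<sigma> \<and>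
    (\<forall>c\<in>A. smooth_on (W \<inter> \<sigma> -` fst c) (snd c \<circ> \<sigma>))"
  by (simp add: smooth_map_def real_atlas_def chart_inv_def o_def)

lemma smooth_curve_smooth_on:
  "smooth_map real_atlas A W \<sigma> \<Longrightarrow> c \<in> A \<Longrightarrow> smooth_on (W \<inter> \<sigma> -` fst c) (snd c \<circ> \<sigma>)"
  by (simp add: smooth_map_real_iff)

lemma open_curve_domain:
  "smooth_map real_atlas A W \<sigma> \<Longrightarrow> open W \<Longrightarrow> c \<in> A \<Longrightarrow> open (W \<inter> \<sigma> -` fst c)"
  by (auto simp: smooth_map_real_iff intro!: continuous_open_preimage open_chart_domain)

lemma smooth_curve_has_velocity:
  assumes sm: "smooth_map real_atlas A W \<sigma>" and W: "open W" "t \<in> W"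
  shows "has_velocity \<sigma> t (velocity A \<sigma> t)"
proof -
  have "isCont \<sigma> t"
    using sm W continuous_on_eq_continuous_at smooth_map_real_iff by blast
  moreover have "snd (chart_at A (\<sigma> t)) \<circ> \<sigma> differentiable at t"
    using smooth_on_has_derivative[OF smooth_curve_smooth_on[OF sm chart_at_in(1)[of "\<sigma> t"]], of t] W
    by (auto simp: differentiable_def)
  ultimately show ?thesis
    unfolding has_velocity_def velocity_def by (metis vector_derivative_works)
qed

lemma smooth_map_real_affine:
  assumes sm: "smooth_map real_atlas A W \<sigma>" and W: "open W"
  shows "smooth_map real_atlas A ((\<lambda>t. a + b * t) -` W) (\<lambda>t. \<sigma> (a + b * t))"
  unfolding smooth_map_real_iff
proof (intro conjI ballI)
  show "continuous_on ((\<lambda>t. a + b * t) -` W) (\<lambda>t. \<sigma> (a + b * t))"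
    using sm by (auto simp: smooth_map_real_iff intro!: continuous_on_compose2[of W \<sigma>] continuous_intros)
  fix c assume c: "c \<in> A"
  have "linear (\<lambda>t::real. b * t)" by (simp add: linear_times)
  from smooth_on_precompose_affine[OF smooth_curve_smooth_on[OF sm c] this open_curve_domain[OF sm W c], of a]
  show "smooth_on ((\<lambda>t. a + b * t) -` W \<inter> (\<lambda>t. \<sigma> (a + b * t)) -` fst c) (snd c \<circ> (\<lambda>t. \<sigma> (a + b * t)))"
    by (simp add: o_def vimage_def Int_def)
qed

text \<open>\<open>c\<close> need not belong to \<open>A\<close>, since boundary charts come from
  the maximal atlas. With \<open>f\<close> the identity the lemma yields curves in the boundary,
  with \<open>f\<close> the foot map the projection to the boundary of a straight line in a
  chart.\<close>

lemma smooth_affine_curve: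
  fixes c :: "('m, 'e) chart" and f :: "'m \<Rightarrow> 'm"
  assumes c: "is_chart c" and V: "open V" and f: "continuous_on V f"
    and sm: "\<And>d. d \<in> A \<Longrightarrow> smooth_on (snd c ` (fst c \<inter> V \<inter> f -` fst d)) (snd d \<circ> f \<circ> chart_inv c)"
    and T: "\<And>t. t \<in> T \<Longrightarrow> x + t *\<^sub>R w \<in> snd c ` (fst c \<inter> V)"
  shows "smooth_map real_atlas A T (\<lambda>t. f (chart_inv c (x + t *\<^sub>R w)))"
  unfolding smooth_map_real_iff
proof (intro conjI ballI)
  have T': "x + t *\<^sub>R w \<in> snd c ` fst c" "chart_inv c (x + t *\<^sub>R w) \<in> V" if "t \<in> T" for t
    using T[OF that] mem_chart_image_iff[OF c] by blast+
  have "continuous_on (snd c ` fst c) (chart_inv c)"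
    using c by (simp add: is_chart_def)
  then have "continuous_on T (\<lambda>t. chart_inv c (x + t *\<^sub>R w))"
    by (rule continuous_on_compose2) (use T' in \<open>auto intro!: continuous_intros\<close>)
  then show "continuous_on T (\<lambda>t. f (chart_inv c (x + t *\<^sub>R w)))"
    by (rule continuous_on_compose2[OF f]) (use T' in auto)
  fix d assume d: "d \<in> A"
  have "open (V \<inter> f -` fst d)"
    by (rule continuous_open_preimage[OF f V open_chart_domain[OF is_chart[OF d]]])
  then have op: "open (snd c ` (fst c \<inter> V \<inter> f -` fst d))"
    using open_chart_image[OF c] by (simp add: Int_assoc)
  have lin: "linear (\<lambda>t. t *\<^sub>R w)" by (simp add: linear_iff scaleR_left_distrib)
  from smooth_on_precompose_affine[OF sm[OF d] lin op, of x]
  show "smooth_on (T \<inter> (\<lambda>t. f (chart_inv c (x + t *\<^sub>R w))) -` fst d) (snd d \<circ> (\<lambda>t. f (chart_inv c (x + t *\<^sub>R w))))"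
    unfolding o_def
  proof (rule smooth_on_subset)
    show "T \<inter> (\<lambda>t. f (chart_inv c (x + t *\<^sub>R w))) -` fst d
      \<subseteq> (\<lambda>t. x + t *\<^sub>R w) -` snd c ` (fst c \<inter> V \<inter> f -` fst d)"
      using T' by (auto simp: Int_assoc mem_chart_image_iff[OF c])
  qed
qed

end

section \<open>The Levi-Civita connection in charts\<close>

locale riemannian = manifold A for A :: "('m::t2_space, 'e::euclidean_space) chart set" +
  fixes g :: "'m \<Rightarrow> 'e \<Rightarrow> 'e \<Rightarrow> real"
  assumes metric: "riemannian_metric A g"
begin

lemma g_bilinear: "bilinear (g p)"
  using metric by (simp add: riemannian_metric_def)

lemma g_sym: "g p u v = g p v u"
  using metric by (simp add: riemannian_metric_def)

lemma g_pos: "v \<noteq> 0 \<Longrightarrow> g p v v > 0"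
  using metric by (simp add: riemannian_metric_def)

lemmas g_simps [simp] = bilinear_ladd[OF g_bilinear] bilinear_radd[OF g_bilinear]
  bilinear_lmul[OF g_bilinear] bilinear_rmul[OF g_bilinear] bilinear_lneg[OF g_bilinear]
  bilinear_rneg[OF g_bilinear] bilinear_lzero[OF g_bilinear] bilinear_rzero[OF g_bilinear]
  bilinear_lsub[OF g_bilinear] bilinear_rsub[OF g_bilinear]

lemma g_nonneg [simp]: "g p v v \<ge> 0"
  using g_pos[of v p] by (cases "v = 0") auto

lemma g_eq_0_iff [simp]: "g p v v = 0 \<longleftrightarrow> v = 0"
  using g_pos[of v p] by (cases "v = 0") auto

lemma g_eqI: "(\<And>z. g p u z = g p v z) \<Longrightarrow> u = v"
  by (metis g_eq_0_iff g_simps(9) right_minus_eq)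

lemma gnorm_nonneg [simp]: "gnorm g p v \<ge> 0"
  by (simp add: gnorm_def)

lemma gnorm_sq: "(gnorm g p v)\<^sup>2 = g p v v"
  by (simp add: gnorm_def)

lemma metric_rep_snd:
  "c \<in> A \<Longrightarrow> q \<in> fst c \<Longrightarrow> metric_rep A g c (snd c q) u v = g q (vec A c q u) (vec A c q v)"
  by (simp add: metric_rep_def)

lemma g_eq_metric_rep:
  "c \<in> A \<Longrightarrow> q \<in> fst c \<Longrightarrow> g q u v = metric_rep A g c (snd c q) (coord A c q u) (coord A c q v)"
  by (simp add: metric_rep_snd)

lemma metric_rep_bilinear:
  assumes c: "c \<in> A" and x: "x \<in> snd c ` fst c"
  shows "bilinear (metric_rep A g c x)"
proof -
  obtain q where q: "q \<in> fst c" "x = snd c q" using x by auto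
  have "linear (vec A c q)" by (rule linear_vec[OF c q(1)])
  then show ?thesis
    unfolding bilinear_def q(2) metric_rep_snd[OF c q(1)]
    by (auto intro!: linearI simp: linear_add linear_cmul)
qed

lemma metric_rep_sym: "metric_rep A g c x u v = metric_rep A g c x v u"
  by (simp add: metric_rep_def Let_def g_sym)

lemma metric_rep_pos:
  assumes c: "c \<in> A" and x: "x \<in> snd c ` fst c" and v: "v \<noteq> 0"
  shows "metric_rep A g c x v v > 0"
proof -
  obtain q where q: "q \<in> fst c" "x = snd c q" using x by auto
  have "vec A c q v \<noteq> 0"
    using coord_vec[OF c q(1), of v] v linear_0[OF linear_coord[OF c q(1)]] by force
  then show ?thesis by (simp add: q(2) metric_rep_snd[OF c q(1)] g_pos)
qed

lemma metric_rep_smooth: "c \<in> A \<Longrightarrow> smooth_on (snd c ` fst c) (\<lambda>x. metric_rep A g c x u v)"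
  using metric by (simp add: riemannian_metric_def)

section \<open>Christoffel symbols in an arbitrary chart\<close>

definition dmetric :: "('m, 'e) chart \<Rightarrow> 'e \<Rightarrow> 'e \<Rightarrow> 'e \<Rightarrow> 'e \<Rightarrow> real" where
  "dmetric c x a u v = frechet_derivative (\<lambda>x. metric_rep A g c x u v) (at x) a"

lemma dmetric_has_derivative:
  "c \<in> A \<Longrightarrow> x \<in> snd c ` fst c \<Longrightarrow>
    ((\<lambda>x. metric_rep A g c x u v) has_derivative (\<lambda>a. dmetric c x a u v)) (at x)"
  unfolding dmetric_def by (rule smooth_on_has_derivative[OF metric_rep_smooth])

lemma dmetric_linear:
  "c \<in> A \<Longrightarrow> x \<in> snd c ` fst c \<Longrightarrow> linear (\<lambda>a. dmetric c x a u v)"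
  using dmetric_has_derivative has_derivative_linear by blast

lemma dmetric_sym: "dmetric c x a u v = dmetric c x a v u"
  by (simp add: dmetric_def metric_rep_sym[of c _ u v])

lemma dmetric_linear2:
  assumes c: "c \<in> A" and x: "x \<in> snd c ` fst c"
  shows "linear (\<lambda>u. dmetric c x a u v)"
proof (rule linearI)
  note op = open_chart_range[OF is_chart[OF c]]
  note bil = metric_rep_bilinear[OF c]
  fix u u' :: 'e and k :: real
  have "((\<lambda>x. metric_rep A g c x (u + u') v) has_derivative (\<lambda>a. dmetric c x a u v + dmetric c x a u' v)) (at x)"
    by (rule has_derivative_transform_within_open[OF has_derivative_add[OF
          dmetric_has_derivative[OF c x, of u v] dmetric_has_derivative[OF c x, of u' v]] op x])
      (simp add: bilinear_ladd[OF bil])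
  from has_derivative_unique[OF this dmetric_has_derivative[OF c x]]
  show "dmetric c x a (u + u') v = dmetric c x a u v + dmetric c x a u' v" by metis
  have "((\<lambda>x. metric_rep A g c x (k *\<^sub>R u) v) has_derivative (\<lambda>a. k *\<^sub>R dmetric c x a u v)) (at x)"
    by (rule has_derivative_transform_within_open[OF has_derivative_scaleR_right[OF
          dmetric_has_derivative[OF c x, of u v]] op x])
      (simp add: bilinear_lmul[OF bil])
  from has_derivative_unique[OF this dmetric_has_derivative[OF c x]]
  show "dmetric c x a (k *\<^sub>R u) v = k *\<^sub>R dmetric c x a u v" by metis
qed

lemma dmetric_linear3:
  "c \<in> A \<Longrightarrow> x \<in> snd c ` fst c \<Longrightarrow> linear (\<lambda>v. dmetric c x a u v)"
  using dmetric_linear2[of c x a u] by (simp add: dmetric_sym[of c x a u])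

definition koszul :: "('m, 'e) chart \<Rightarrow> 'e \<Rightarrow> 'e \<Rightarrow> 'e \<Rightarrow> 'e \<Rightarrow> real" where
  "koszul c x u v z = (dmetric c x u v z + dmetric c x v u z - dmetric c x z u v) / 2"

text \<open>\<open>christoffel\<close> is computed in the chart chosen at the point, and that choice
  jumps along a curve. Differentiation along curves needs the same symbols in one chart that is kept
  fixed.\<close>

definition chris :: "('m, 'e) chart \<Rightarrow> 'e \<Rightarrow> 'e \<Rightarrow> 'e \<Rightarrow> 'e" where
  "chris c x u v = (THE w. \<forall>z. metric_rep A g c x w z = koszul c x u v z)"

lemma christoffel_eq_chris:
  "christoffel A g p u v = chris (chart_at A p) (snd (chart_at A p) p) u v"
  unfolding christoffel_def chris_def koszul_def dmetric_def Let_def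
  by (simp add: metric_rep_snd)

context
  fixes c x assumes c: "c \<in> A" and x: "x \<in> snd c ` fst c"
begin

lemmas dmetric_lin = linear_add[OF dmetric_linear[OF c x]] linear_add[OF dmetric_linear2[OF c x]]
  linear_add[OF dmetric_linear3[OF c x]] linear_cmul[OF dmetric_linear[OF c x]]
  linear_cmul[OF dmetric_linear2[OF c x]] linear_cmul[OF dmetric_linear3[OF c x]]

lemma koszul_linear: "linear (\<lambda>z. koszul c x u v z)"
  unfolding koszul_def
  by (auto intro!: linearI simp: dmetric_lin add_divide_distrib diff_divide_distrib algebra_simps)

lemma metric_rep_chris: "metric_rep A g c x (chris c x u v) z = koszul c x u v z"
proof -
  have "\<exists>!w. \<forall>z. metric_rep A g c x w z = koszul c x u v z"
    by (rule positive_definite_riesz[OF metric_rep_bilinear[OF c x] metric_rep_pos[OF c x] koszul_linear])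
  from theI'[OF this] show ?thesis unfolding chris_def by blast
qed

lemma metric_rep_eqI:
  assumes "\<And>z. metric_rep A g c x w z = metric_rep A g c x w' z"
  shows "w = w'"
proof (rule ccontr)
  assume "w \<noteq> w'"
  then have "metric_rep A g c x (w - w') (w - w') > 0" by (intro metric_rep_pos c x) auto
  then show False by (simp add: bilinear_lsub[OF metric_rep_bilinear[OF c x]] assms)
qed

lemma chris_bilinear: "bilinear (chris c x)"
  unfolding bilinear_def
proof (intro conjI allI linearI)
  note bil = metric_rep_bilinear[OF c x]
  fix u v w :: 'e and k :: real
  show "chris c x u (v + w) = chris c x u v + chris c x u w"
    by (rule metric_rep_eqI, simp only: bilinear_ladd[OF bil] metric_rep_chris koszul_def dmetric_lin)
      (simp add: field_simps)
  show "chris c x u (k *\<^sub>R v) = k *\<^sub>R chris c x u v"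
    by (rule metric_rep_eqI, simp only: bilinear_lmul[OF bil] metric_rep_chris koszul_def dmetric_lin)
      (simp add: field_simps)
  show "chris c x (u + v) w = chris c x u w + chris c x v w"
    by (rule metric_rep_eqI, simp only: bilinear_ladd[OF bil] metric_rep_chris koszul_def dmetric_lin)
      (simp add: field_simps)
  show "chris c x (k *\<^sub>R u) v = k *\<^sub>R chris c x u v"
    by (rule metric_rep_eqI, simp only: bilinear_lmul[OF bil] metric_rep_chris koszul_def dmetric_lin)
      (simp add: field_simps)
qed

text \<open>Compatibility of the connection with the metric: adding the two Koszul formulas cancels
  every derivative of the metric except the one in the direction \<open>a\<close>.\<close>

lemma dmetric_eq_chris:
  "dmetric c x a u v = metric_rep A g c x (chris c x a u) v + metric_rep A g c x u (chris c x a v)"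
  using dmetric_sym[of c x a v u]
  by (simp add: metric_rep_sym[of c x u] metric_rep_chris koszul_def field_simps)

end

lemma metric_rep_curve_derivative:
  assumes c: "c \<in> A" and x: "x t \<in> snd c ` fst c" "(x has_vector_derivative x') (at t)"
    and u: "(u has_vector_derivative u') (at t)" and v: "(v has_vector_derivative v') (at t)"
  shows "((\<lambda>s. metric_rep A g c (x s) (u s) (v s)) has_vector_derivative
    (dmetric c (x t) x' (u t) (v t) + metric_rep A g c (x t) u' (v t) + metric_rep A g c (x t) (u t) v')) (at t)"
proof -
  note op = open_chart_range[OF is_chart[OF c]]
  have "isCont x t" using x(2) has_vector_derivative_continuous by blast
  then have ev: "\<forall>\<^sub>F s in nhds t. x s \<in> snd c ` fst c"
    by (rule isCont_eventually_in_open[where f = x and t = t, OF _ op x(1)])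
  have lin1: "\<forall>\<^sub>F s in nhds t. linear (\<lambda>u. metric_rep A g c (x s) u w)" for w
    using ev by (rule eventually_mono) (use metric_rep_bilinear[OF c] in \<open>simp add: bilinear_def\<close>)
  have "((\<lambda>s. metric_rep A g c (x s) (u s) w) has_vector_derivative
      metric_rep A g c (x t) u' w + dmetric c (x t) x' (u t) w) (at t)" for w
    by (rule linear_family_has_vector_derivative[OF lin1 _ u])
      (rule has_vector_derivative_compose_derivative[OF dmetric_has_derivative[OF c x(1)] x(2)])
  moreover have "\<forall>\<^sub>F s in nhds t. linear (metric_rep A g c (x s) (u s))"
    using ev by (rule eventually_mono) (use metric_rep_bilinear[OF c] in \<open>simp add: bilinear_def\<close>)
  ultimately have "((\<lambda>s. metric_rep A g c (x s) (u s) (v s)) has_vector_derivative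
      metric_rep A g c (x t) (u t) v' + (metric_rep A g c (x t) u' (v t) + dmetric c (x t) x' (u t) (v t))) (at t)"
    by (intro linear_family_has_vector_derivative[OF _ _ v])
  then show ?thesis by (simp add: ac_simps)
qed

lemma smooth_dmetric:
  "c \<in> A \<Longrightarrow> smooth_on (snd c ` fst c) (\<lambda>x. dmetric c x a u v)"
  unfolding dmetric_def by (rule smooth_on_deriv[OF metric_rep_smooth])

lemma smooth_koszul:
  assumes c: "c \<in> A"
  shows "smooth_on (snd c ` fst c) (\<lambda>x. koszul c x u v z)"
proof -
  note op = open_chart_range[OF is_chart[OF c]]
  have bl: "bounded_linear (\<lambda>y::real. y * b)" for b by (rule bounded_linear_mult_left)
  have "smooth_on (snd c ` fst c) (\<lambda>x. (dmetric c x u v z + (dmetric c x v u z + dmetric c x z u v * (-1))) * (1/2))"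
    by (intro smooth_on_bounded_linear_compose[OF _ bl op] smooth_on_add smooth_dmetric c op)
  then show ?thesis
    by (rule back_subst[of "smooth_on (snd c ` fst c)"]) (simp add: fun_eq_iff koszul_def)
qed

text \<open>The uniform bounds on a coordinate ball for the equations of geodesics and parallel
  fields. The constant sums those of the pairs of basis vectors.\<close>

lemma chris_lipschitz:
  assumes c: "c \<in> A" and B: "compact B" "convex B" "B \<subseteq> snd c ` fst c"
  obtains L where "L \<ge> 0" "\<And>x u v. x \<in> B \<Longrightarrow> norm (chris c x u v) \<le> L * (norm u * norm v)"
    "\<And>x y u v. x \<in> B \<Longrightarrow> y \<in> B \<Longrightarrow>
      norm (chris c x u v - chris c y u v) \<le> L * norm (x - y) * (norm u * norm v)"
proof -
  note inB = subsetD[OF B(3)]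
  have "\<exists>L\<ge>0. \<forall>x\<in>B. \<forall>y\<in>B. norm (chris c x u v) \<le> L \<and> norm (chris c x u v - chris c y u v) \<le> L * norm (x - y)" for u v
    by (rule positive_definite_solution_lipschitz[OF B metric_rep_bilinear[OF c inB] metric_rep_pos[OF c inB]
        metric_rep_smooth[OF c] koszul_linear[OF c inB] smooth_koszul[OF c] metric_rep_chris[OF c inB]])
  then have "\<forall>ij. \<exists>L\<ge>0. \<forall>x\<in>B. \<forall>y\<in>B. norm (chris c x (fst ij) (snd ij)) \<le> L \<and>
      norm (chris c x (fst ij) (snd ij) - chris c y (fst ij) (snd ij)) \<le> L * norm (x - y)"
    by blast
  then obtain LL where LL: "\<And>ij. LL ij \<ge> 0"
    "\<And>ij x. x \<in> B \<Longrightarrow> norm (chris c x (fst ij) (snd ij)) \<le> LL ij"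
    "\<And>ij x y. x \<in> B \<Longrightarrow> y \<in> B \<Longrightarrow> norm (chris c x (fst ij) (snd ij) - chris c y (fst ij) (snd ij)) \<le> LL ij * norm (x - y)"
    by metis
  define L where "L = (\<Sum>i\<in>(Basis::'e set). \<Sum>j\<in>(Basis::'e set). LL (i,j))"
  note bil = chris_bilinear[OF c inB]
  show thesis
  proof (rule that[of L])
    show "L \<ge> 0" unfolding L_def using LL by (auto intro!: sum_nonneg)
    fix x u v assume x: "x \<in> B"
    have "norm (chris c x u v) \<le> (\<Sum>i\<in>Basis. \<Sum>j\<in>Basis. norm (chris c x i j)) * (norm u * norm v)"
      by (rule bilinear_bound_Basis[OF bil[OF x]])
    also have "\<dots> \<le> L * (norm u * norm v)"
      unfolding L_def using LL(2)[OF x] by (intro mult_right_mono sum_mono) (auto simp: split_paired_all)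
    finally show "norm (chris c x u v) \<le> L * (norm u * norm v)" .
    fix y assume y: "y \<in> B"
    have "norm (chris c x u v - chris c y u v) \<le>
        (\<Sum>i\<in>Basis. \<Sum>j\<in>Basis. norm (chris c x i j - chris c y i j)) * (norm u * norm v)"
      by (rule bilinear_bound_Basis[OF bilinear_diff[OF bil[OF x] bil[OF y]]])
    also have "\<dots> \<le> (\<Sum>i\<in>Basis. \<Sum>j\<in>Basis. LL (i,j) * norm (x - y)) * (norm u * norm v)"
      using LL(3)[OF x y] by (intro mult_right_mono sum_mono) (auto simp: split_paired_all)
    finally show "norm (chris c x u v - chris c y u v) \<le> L * norm (x - y) * (norm u * norm v)"
      by (simp add: L_def sum_distrib_right)
  qed
qed

section \<open>Transformation under a change of charts\<close>

lemma metric_rep_change: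
  assumes "c \<in> A" "d \<in> A" "q \<in> fst c" "q \<in> fst d"
  shows "metric_rep A g c (snd c q) u v =
    metric_rep A g d (snd d q) (chart_change c d q u) (chart_change c d q v)"
  using assms by (simp add: metric_rep_snd vec_chart_change)

text \<open>The Hessian of the transition map, which measures the failure of the Christoffel symbols
  to be a tensor.\<close>

definition chart_change2 :: "('m, 'e) chart \<Rightarrow> ('m, 'e) chart \<Rightarrow> 'm \<Rightarrow> 'e \<Rightarrow> 'e \<Rightarrow> 'e" where
  "chart_change2 c d p a u =
    frechet_derivative (\<lambda>y. frechet_derivative (snd d \<circ> chart_inv c) (at y) u) (at (snd c p)) a"

context
  fixes c d p
  assumes cd: "c \<in> A" "d \<in> A" "p \<in> fst c" "p \<in> fst d"
begin

lemma open_overlap: "open (snd c ` (fst c \<inter> fst d))"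
  using cd by (intro open_chart_image open_chart_domain) auto

lemma p_overlap: "snd c p \<in> snd c ` (fst c \<inter> fst d)"
  using cd by auto

lemma chart_change2_has_derivative:
  "((\<lambda>y. frechet_derivative (snd d \<circ> chart_inv c) (at y) u) has_derivative (\<lambda>a. chart_change2 c d p a u)) (at (snd c p))"
  unfolding chart_change2_def
  by (rule smooth_on_has_derivative[OF smooth_on_deriv[OF smooth_transition[OF cd(1,2)]] p_overlap])

lemma chart_change2_sym: "chart_change2 c d p a u = chart_change2 c d p u a"
  unfolding chart_change2_def
  by (rule frechet_derivative_symmetric[OF smooth_transition[OF cd(1,2)] open_overlap p_overlap])

text \<open>The transformation law of the metric, differentiated along the straight line through
  \<open>snd c p\<close> in the direction \<open>a\<close>.\<close>

lemma dmetric_change: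
  "dmetric c (snd c p) a u v =
    dmetric d (snd d p) (chart_change c d p a) (chart_change c d p u) (chart_change c d p v)
    + metric_rep A g d (snd d p) (chart_change2 c d p a u) (chart_change c d p v)
    + metric_rep A g d (snd d p) (chart_change c d p u) (chart_change2 c d p a v)"
proof -
  define x where "x s = snd c p + s *\<^sub>R a" for s :: real
  have x0: "x 0 = snd c p" by (simp add: x_def)
  have x': "(x has_vector_derivative a) (at 0)"
    unfolding x_def by (auto intro!: derivative_eq_intros)
  let ?\<tau> = "snd d \<circ> chart_inv c"
  have \<tau>p: "?\<tau> (snd c p) = snd d p" using cd by simp
  have \<tau>': "((\<lambda>s. ?\<tau> (x s)) has_vector_derivative chart_change c d p a) (at 0)"
    by (rule has_vector_derivative_compose_derivative[OF _ x'])
      (use transition_has_derivative[OF cd] in \<open>simp only: x0\<close>)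
  have u': "((\<lambda>s. frechet_derivative ?\<tau> (at (x s)) u) has_vector_derivative chart_change2 c d p a u) (at 0)" for u
    by (rule has_vector_derivative_compose_derivative[OF _ x'])
      (use chart_change2_has_derivative in \<open>simp only: x0\<close>)
  have "?\<tau> (x 0) \<in> snd d ` fst d"
    using cd by (simp only: x0 \<tau>p) simp
  from metric_rep_curve_derivative[OF cd(2) this \<tau>' u' u', of u v]
  have D: "((\<lambda>s. metric_rep A g d (?\<tau> (x s)) (frechet_derivative ?\<tau> (at (x s)) u) (frechet_derivative ?\<tau> (at (x s)) v))
      has_vector_derivative
    (dmetric d (snd d p) (chart_change c d p a) (chart_change c d p u) (chart_change c d p v)
    + metric_rep A g d (snd d p) (chart_change2 c d p a u) (chart_change c d p v)
    + metric_rep A g d (snd d p) (chart_change c d p u) (chart_change2 c d p a v))) (at 0)"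
    by (simp only: x0 \<tau>p chart_change_def)
  have "continuous_on UNIV x" unfolding x_def by (intro continuous_intros)
  then have opx: "open (x -` (snd c ` (fst c \<inter> fst d)))"
    using open_overlap by (simp add: open_vimage)
  have "((\<lambda>s. metric_rep A g c (x s) u v) has_vector_derivative
    (dmetric d (snd d p) (chart_change c d p a) (chart_change c d p u) (chart_change c d p v)
    + metric_rep A g d (snd d p) (chart_change2 c d p a u) (chart_change c d p v)
    + metric_rep A g d (snd d p) (chart_change c d p u) (chart_change2 c d p a v))) (at 0)"
  proof (rule has_vector_derivative_transform_within_open[OF D opx])
    show "0 \<in> x -` snd c ` (fst c \<inter> fst d)" using p_overlap by (simp add: x0)
    fix s assume "s \<in> x -` snd c ` (fst c \<inter> fst d)"
    then obtain q where q: "q \<in> fst c" "q \<in> fst d" "x s = snd c q" by auto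
    then show "metric_rep A g d (?\<tau> (x s)) (frechet_derivative ?\<tau> (at (x s)) u) (frechet_derivative ?\<tau> (at (x s)) v) =
        metric_rep A g c (x s) u v"
      using metric_rep_change[OF cd(1,2) q(1,2)] cd by (simp add: chart_change_def)
  qed
  moreover have "((\<lambda>s. metric_rep A g c (x s) u v) has_vector_derivative dmetric c (snd c p) a u v) (at 0)"
    by (rule has_vector_derivative_compose_derivative[OF _ x'])
      (use dmetric_has_derivative[OF cd(1)] cd in \<open>simp add: x0\<close>)
  ultimately show ?thesis using vector_derivative_unique_at by blast
qed

text \<open>In the Koszul combination the derivatives of the Jacobian contribute six terms. Symmetry
  of the Hessian cancels four of them, and the other two add up to the term with
  \<open>chart_change2\<close>.\<close>

lemma chris_change:
  "chart_change c d p (chris c (snd c p) u v) =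
    chart_change2 c d p u v + chris d (snd d p) (chart_change c d p u) (chart_change c d p v)"
proof (rule metric_rep_eqI[OF cd(2), of "snd d p"])
  have x: "snd c p \<in> snd c ` fst c" and y: "snd d p \<in> snd d ` fst d" using cd by auto
  then show "snd d p \<in> snd d ` fst d" by simp
  fix z
  let ?C = "chart_change c d p" and ?H = "chart_change2 c d p" and ?G = "metric_rep A g d (snd d p)"
  \<comment> \<open>The test vector is written as an image under the Jacobian, because the metrics
    in the two charts are compared on such vectors.\<close>
  have z: "?C (chart_change d c p z) = z"
    using cd by (simp add: chart_change_comp chart_change_self)
  define z' where "z' = chart_change d c p z"
  have "?G (?C (chris c (snd c p) u v)) (?C z') = koszul c (snd c p) u v z'"
    using metric_rep_chris[OF cd(1) x, of u v z'] by (simp add: metric_rep_change[OF cd])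
  also have "\<dots> = koszul d (snd d p) (?C u) (?C v) (?C z') + ?G (?H u v) (?C z')"
    unfolding koszul_def dmetric_change
    using chart_change2_sym[of u v] chart_change2_sym[of u z'] chart_change2_sym[of v z']
      metric_rep_sym[of d "snd d p" "?C v" "?H z' u"] metric_rep_sym[of d "snd d p" "?C u" "?H v z'"]
      metric_rep_sym[of d "snd d p" "?C v" "?H u z'"]
    by (simp add: field_simps)
  also have "\<dots> = ?G (?H u v + chris d (snd d p) (?C u) (?C v)) (?C z')"
    by (simp add: bilinear_ladd[OF metric_rep_bilinear[OF cd(2) y]] metric_rep_chris[OF cd(2) y])
  finally show "?G (?C (chris c (snd c p) u v)) z = ?G (?H u v + chris d (snd d p) (?C u) (?C v)) z"
    by (simp add: z'_def z)
qed

end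

section \<open>The covariant derivative along a curve\<close>

lemma has_velocity_isCont: "has_velocity \<sigma> t v \<Longrightarrow> isCont \<sigma> t"
  by (simp add: has_velocity_def)

definition covd_in_chart :: "('m, 'e) chart \<Rightarrow> (real \<Rightarrow> 'm) \<Rightarrow> (real \<Rightarrow> 'e) \<Rightarrow> real \<Rightarrow> 'e \<Rightarrow> bool" where
  "covd_in_chart c \<sigma> V t W \<longleftrightarrow>
     ((\<lambda>s. coord A c (\<sigma> s) (V s)) has_vector_derivative
        (coord A c (\<sigma> t) W - chris c (snd c (\<sigma> t)) (coord A c (\<sigma> t) (velocity A \<sigma> t)) (coord A c (\<sigma> t) (V t)))) (at t)"

lemma has_covd_iff: "has_covd A g \<sigma> V t W \<longleftrightarrow> covd_in_chart (chart_at A (\<sigma> t)) \<sigma> V t W"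
  by (simp add: has_covd_def covd_in_chart_def christoffel_eq_chris)

text \<open>The Hessian term produced by differentiating the Jacobian along the curve cancels the
  one in the transformation of the Christoffel symbols.\<close>

lemma covd_in_chart_change:
  assumes v: "has_velocity \<sigma> t v" and cd: "c \<in> A" "d \<in> A" "\<sigma> t \<in> fst c" "\<sigma> t \<in> fst d"
    and V: "covd_in_chart c \<sigma> V t W"
  shows "covd_in_chart d \<sigma> V t W"
proof -
  have co: "isCont \<sigma> t" using v by (simp add: has_velocity_def)
  have vel: "velocity A \<sigma> t = v" by (rule has_velocity_velocity[OF v])
  let ?\<tau> = "snd d \<circ> chart_inv c"
  obtain U1 where U1: "open U1" "t \<in> U1" "\<And>s. s \<in> U1 \<Longrightarrow> \<sigma> s \<in> fst c"
    using isCont_open_vimage[OF co open_chart_domain[OF is_chart[OF cd(1)]] cd(3)] by blast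
  obtain U2 where U2: "open U2" "t \<in> U2" "\<And>s. s \<in> U2 \<Longrightarrow> \<sigma> s \<in> fst d"
    using isCont_open_vimage[OF co open_chart_domain[OF is_chart[OF cd(2)]] cd(4)] by blast
  have xv: "((\<lambda>s. snd c (\<sigma> s)) has_vector_derivative coord A c (\<sigma> t) v) (at t)"
    using has_velocity_chart[OF v cd(1,3)] by (simp add: o_def)
  have lin: "\<forall>\<^sub>F s in nhds t. linear (frechet_derivative ?\<tau> (at (snd c (\<sigma> s))))"
    unfolding eventually_nhds
    using U1 U2 linear_chart_change[OF cd(1,2)]
    by (intro exI[of _ "U1 \<inter> U2"]) (auto simp: chart_change_def)
  have "((\<lambda>s. frechet_derivative ?\<tau> (at (snd c (\<sigma> s))) (coord A c (\<sigma> s) (V s))) has_vector_derivative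
      (frechet_derivative ?\<tau> (at (snd c (\<sigma> t)))
        (coord A c (\<sigma> t) W - chris c (snd c (\<sigma> t)) (coord A c (\<sigma> t) v) (coord A c (\<sigma> t) (V t)))
      + chart_change2 c d (\<sigma> t) (coord A c (\<sigma> t) v) (coord A c (\<sigma> t) (V t)))) (at t)"
    by (rule linear_family_has_vector_derivative[OF lin
          has_vector_derivative_compose_derivative[OF chart_change2_has_derivative[OF cd] xv]])
      (use V vel in \<open>simp add: covd_in_chart_def\<close>)
  moreover have "frechet_derivative ?\<tau> (at (snd c (\<sigma> t)))
        (coord A c (\<sigma> t) W - chris c (snd c (\<sigma> t)) (coord A c (\<sigma> t) v) (coord A c (\<sigma> t) (V t)))
      + chart_change2 c d (\<sigma> t) (coord A c (\<sigma> t) v) (coord A c (\<sigma> t) (V t))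
    = coord A d (\<sigma> t) W - chris d (snd d (\<sigma> t)) (coord A d (\<sigma> t) v) (coord A d (\<sigma> t) (V t))"
    unfolding chart_change_def[symmetric] linear_diff[OF linear_chart_change[OF cd]] chris_change[OF cd]
    using cd by (simp add: chart_change_coord)
  ultimately have D: "((\<lambda>s. frechet_derivative ?\<tau> (at (snd c (\<sigma> s))) (coord A c (\<sigma> s) (V s))) has_vector_derivative
      (coord A d (\<sigma> t) W - chris d (snd d (\<sigma> t)) (coord A d (\<sigma> t) v) (coord A d (\<sigma> t) (V t)))) (at t)"
    by simp
  show ?thesis
    unfolding covd_in_chart_def vel
    by (rule has_vector_derivative_transform_within_open[OF D open_Int[OF U1(1) U2(1)]])
      (use U1 U2 cd chart_change_coord[OF cd(1,2)] in \<open>auto simp: chart_change_def\<close>)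
qed

lemma has_covd_chart:
  assumes v: "has_velocity \<sigma> t v" and c: "c \<in> A" "\<sigma> t \<in> fst c"
  shows "has_covd A g \<sigma> V t W \<longleftrightarrow> covd_in_chart c \<sigma> V t W"
  unfolding has_covd_iff
  using covd_in_chart_change[OF v] c chart_at_in by blast

lemma has_covd_metric:
  assumes v: "has_velocity \<sigma> t v" and V: "has_covd A g \<sigma> V t X" and W: "has_covd A g \<sigma> W t Y"
  shows "((\<lambda>s. g (\<sigma> s) (V s) (W s)) has_vector_derivative (g (\<sigma> t) X (W t) + g (\<sigma> t) (V t) Y)) (at t)"
proof -
  let ?c = "chart_at A (\<sigma> t)"
  let ?x = "\<lambda>s. snd ?c (\<sigma> s)" and ?G = "metric_rep A g ?c (snd ?c (\<sigma> t))"
  have c: "?c \<in> A" "\<sigma> t \<in> fst ?c" by auto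
  have x: "?x t \<in> snd ?c ` fst ?c" by simp
  have vel: "velocity A \<sigma> t = v" by (rule has_velocity_velocity[OF v])
  obtain U where U: "open U" "t \<in> U" "\<And>s. s \<in> U \<Longrightarrow> \<sigma> s \<in> fst ?c"
    using isCont_open_vimage[OF has_velocity_isCont[OF v] open_chart_domain[OF is_chart[OF c(1)]] c(2)]
    by blast
  have x': "(?x has_vector_derivative v) (at t)"
    using v by (simp add: has_velocity_def o_def)
  have V': "((\<lambda>s. coord A ?c (\<sigma> s) (V s)) has_vector_derivative (X - chris ?c (?x t) v (V t))) (at t)"
    and W': "((\<lambda>s. coord A ?c (\<sigma> s) (W s)) has_vector_derivative (Y - chris ?c (?x t) v (W t))) (at t)"
    using V W vel by (simp_all add: has_covd_iff covd_in_chart_def)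
  note bil = metric_rep_bilinear[OF c(1) x]
  have G: "g (\<sigma> t) a b = ?G a b" for a b
    using g_eq_metric_rep[OF c, of a b] by simp
  have "((\<lambda>s. metric_rep A g ?c (?x s) (coord A ?c (\<sigma> s) (V s)) (coord A ?c (\<sigma> s) (W s))) has_vector_derivative
     (g (\<sigma> t) X (W t) + g (\<sigma> t) (V t) Y)) (at t)"
    using metric_rep_curve_derivative[OF c(1) x x' V' W']
    by (simp add: G dmetric_eq_chris[OF c(1) x] bilinear_lsub[OF bil] bilinear_rsub[OF bil])
  then show ?thesis
    by (rule has_vector_derivative_transform_within_open[OF _ U(1,2)])
      (rule g_eq_metric_rep[OF c(1) U(3), symmetric])
qed

lemma has_covd_transform:
  assumes "has_covd A g \<sigma> V t X" "open U" "t \<in> U" "\<And>s. s \<in> U \<Longrightarrow> V s = W s"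
  shows "has_covd A g \<sigma> W t X"
  using assms(1) unfolding has_covd_def assms(4)[OF assms(3)]
  by (rule has_vector_derivative_transform_within_open[OF _ assms(2,3)]) (simp add: assms(4))

lemma has_covd_lincomb:
  assumes v: "has_velocity \<sigma> t v" and V: "has_covd A g \<sigma> V t X" and W: "has_covd A g \<sigma> W t Y"
  shows "has_covd A g \<sigma> (\<lambda>s. k *\<^sub>R V s + W s) t (k *\<^sub>R X + Y)"
proof -
  let ?c = "chart_at A (\<sigma> t)"
  have c: "?c \<in> A" "\<sigma> t \<in> fst ?c" by auto
  obtain U where U: "open U" "t \<in> U" "\<And>s. s \<in> U \<Longrightarrow> \<sigma> s \<in> fst ?c"
    using isCont_open_vimage[OF has_velocity_isCont[OF v] open_chart_domain[OF is_chart[OF c(1)]] c(2)]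
    by blast
  have bil: "bilinear (chris ?c (snd ?c (\<sigma> t)))" by (rule chris_bilinear) auto
  have "((\<lambda>s. k *\<^sub>R coord A ?c (\<sigma> s) (V s) + coord A ?c (\<sigma> s) (W s)) has_vector_derivative
      (k *\<^sub>R (X - chris ?c (snd ?c (\<sigma> t)) (velocity A \<sigma> t) (V t))
        + (Y - chris ?c (snd ?c (\<sigma> t)) (velocity A \<sigma> t) (W t)))) (at t)"
    using V W unfolding has_covd_iff covd_in_chart_def coord_chart_at
    by (intro has_vector_derivative_add bounded_linear.has_vector_derivative[OF bounded_linear_scaleR_right])
  then have "((\<lambda>s. coord A ?c (\<sigma> s) (k *\<^sub>R V s + W s)) has_vector_derivative
      (k *\<^sub>R (X - chris ?c (snd ?c (\<sigma> t)) (velocity A \<sigma> t) (V t))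
        + (Y - chris ?c (snd ?c (\<sigma> t)) (velocity A \<sigma> t) (W t)))) (at t)"
    by (rule has_vector_derivative_transform_within_open[OF _ U(1,2)])
      (use U(3) linear_coord[OF c(1)] in \<open>simp add: linear_add linear_cmul\<close>)
  then show ?thesis
    by (simp add: has_covd_iff covd_in_chart_def bilinear_radd[OF bil] bilinear_rmul[OF bil] algebra_simps)
qed

section \<open>Geodesics and parallel transport\<close>

lemma geodesic_has_velocity: "geodesic A g \<sigma> \<Longrightarrow> has_velocity \<sigma> t (velocity A \<sigma> t)"
  unfolding geodesic_def by (intro smooth_curve_has_velocity[of UNIV]) auto

lemma geodesic_isCont: "geodesic A g \<sigma> \<Longrightarrow> isCont \<sigma> t"
  using geodesic_has_velocity has_velocity_isCont by blast

lemma geodesic_chart_position: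
  assumes "geodesic A g \<sigma>" "c \<in> A" "\<sigma> t \<in> fst c"
  shows "((\<lambda>s. snd c (\<sigma> s)) has_vector_derivative coord A c (\<sigma> t) (velocity A \<sigma> t)) (at t)"
  using has_velocity_chart[OF geodesic_has_velocity[OF assms(1)] assms(2,3)] by (simp add: o_def)

lemma geodesic_chart_velocity:
  assumes "geodesic A g \<sigma>" "c \<in> A" "\<sigma> t \<in> fst c"
  shows "((\<lambda>s. coord A c (\<sigma> s) (velocity A \<sigma> s)) has_vector_derivative
    - chris c (snd c (\<sigma> t)) (coord A c (\<sigma> t) (velocity A \<sigma> t)) (coord A c (\<sigma> t) (velocity A \<sigma> t))) (at t)"
proof -
  have "has_covd A g \<sigma> (velocity A \<sigma>) t 0" using assms(1) by (simp add: geodesic_def)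
  then show ?thesis
    using has_covd_chart[OF geodesic_has_velocity[OF assms(1)] assms(2,3)] linear_0[OF linear_coord[OF assms(2,3)]]
    by (simp add: covd_in_chart_def)
qed

lemma chart_cball:
  assumes "c \<in> A" "x0 \<in> snd c ` fst c"
  obtains \<rho> where "\<rho> > 0" "cball x0 \<rho> \<subseteq> snd c ` fst c"
  using open_chart_range[OF is_chart[OF assms(1)]] assms(2) open_contains_cball by blast

lemma curve_in_chart_ball:
  fixes t0 :: real
  assumes c: "c \<in> A" "\<sigma> t0 \<in> fst c" and \<sigma>: "isCont \<sigma> t0" and \<rho>: "\<rho> > 0"
    and v: "isCont v t0"
  obtains \<delta> where "\<delta> > 0" "\<And>s. \<bar>s - t0\<bar> < \<delta> \<Longrightarrow> \<sigma> s \<in> fst c"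
    "\<And>s. \<bar>s - t0\<bar> < \<delta> \<Longrightarrow> snd c (\<sigma> s) \<in> cball (snd c (\<sigma> t0)) \<rho>"
    "\<And>s. \<bar>s - t0\<bar> < \<delta> \<Longrightarrow> norm (v s :: 'e) \<le> norm (v t0) + 1"
proof -
  have "isCont (\<lambda>s. snd c (\<sigma> s)) t0"
    by (rule isCont_o2[OF \<sigma> isCont_chart[OF is_chart[OF c(1)] c(2)]])
  then have "\<forall>\<^sub>F s in nhds t0. snd c (\<sigma> s) \<in> ball (snd c (\<sigma> t0)) \<rho>"
    using \<rho> by (intro isCont_eventually_in_open[where f = "\<lambda>s. snd c (\<sigma> s)"]) auto
  moreover have "\<forall>\<^sub>F s in nhds t0. \<sigma> s \<in> fst c"
    by (rule isCont_eventually_in_open[OF \<sigma> open_chart_domain[OF is_chart[OF c(1)]] c(2)])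
  moreover have "\<forall>\<^sub>F s in nhds t0. v s \<in> ball (v t0) 1"
    by (rule isCont_eventually_in_open[OF v]) auto
  ultimately have "\<forall>\<^sub>F s in nhds t0. snd c (\<sigma> s) \<in> ball (snd c (\<sigma> t0)) \<rho> \<and> \<sigma> s \<in> fst c \<and> v s \<in> ball (v t0) 1"
    by eventually_elim auto
  then obtain \<delta> where \<delta>: "\<delta> > 0" "\<And>s. dist s t0 < \<delta> \<Longrightarrow>
      snd c (\<sigma> s) \<in> ball (snd c (\<sigma> t0)) \<rho> \<and> \<sigma> s \<in> fst c \<and> v s \<in> ball (v t0) 1"
    unfolding eventually_nhds_metric by blast
  have "norm (v s) \<le> norm (v t0) + 1" if "\<bar>s - t0\<bar> < \<delta>" for s
    using \<delta>(2)[of s] that norm_triangle_sub[of "v s" "v t0"]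
    by (auto simp: dist_norm norm_minus_commute)
  with \<delta> show thesis
    by (intro that[of \<delta>]) (auto simp: dist_real_def less_imp_le)
qed

text \<open>Position and velocity in a chart solve a first-order system. On a ball where the
  Christoffel symbols are Lipschitz and the velocities are bounded by \<open>M\<close>, the
  difference of two solutions has a derivative bounded by a constant times itself.\<close>

lemma geodesic_unique_local:
  assumes g1: "geodesic A g \<sigma>" and g2: "geodesic A g \<tau>"
    and eq: "\<sigma> t0 = \<tau> t0" "velocity A \<sigma> t0 = velocity A \<tau> t0"
  shows "\<exists>\<delta>>0. \<forall>s. \<bar>s - t0\<bar> < \<delta> \<longrightarrow> \<sigma> s = \<tau> s"
proof -
  define c where "c = chart_at A (\<sigma> t0)"
  have c: "c \<in> A" "\<sigma> t0 \<in> fst c" "\<tau> t0 \<in> fst c"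
    unfolding c_def using chart_at_in[of "\<sigma> t0"] eq by auto
  let ?x = "\<lambda>s. snd c (\<sigma> s)" and ?y = "\<lambda>s. snd c (\<tau> s)"
  let ?v = "\<lambda>s. coord A c (\<sigma> s) (velocity A \<sigma> s)" and ?w = "\<lambda>s. coord A c (\<tau> s) (velocity A \<tau> s)"
  have x0: "?x t0 \<in> snd c ` fst c" using c by simp
  obtain \<rho> where \<rho>: "\<rho> > 0" "cball (?x t0) \<rho> \<subseteq> snd c ` fst c"
    using chart_cball[OF c(1) x0] by blast
  let ?B = "cball (?x t0) \<rho>"
  obtain L where L: "L \<ge> 0" "\<And>x u v. x \<in> ?B \<Longrightarrow> norm (chris c x u v) \<le> L * (norm u * norm v)"
    "\<And>x y u v. x \<in> ?B \<Longrightarrow> y \<in> ?B \<Longrightarrow>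
      norm (chris c x u v - chris c y u v) \<le> L * norm (x - y) * (norm u * norm v)"
    using chris_lipschitz[OF c(1) compact_cball convex_cball \<rho>(2)] by blast
  have cv: "isCont ?v t0" "isCont ?w t0"
    using geodesic_chart_velocity[OF g1 c(1,2)] geodesic_chart_velocity[OF g2 c(1,3)]
      has_vector_derivative_continuous by blast+
  obtain \<delta>1 where d1: "\<delta>1 > 0" "\<And>s. \<bar>s - t0\<bar> < \<delta>1 \<Longrightarrow> \<sigma> s \<in> fst c"
    "\<And>s. \<bar>s - t0\<bar> < \<delta>1 \<Longrightarrow> ?x s \<in> ?B" "\<And>s. \<bar>s - t0\<bar> < \<delta>1 \<Longrightarrow> norm (?v s) \<le> norm (?v t0) + 1"
    using curve_in_chart_ball[OF c(1,2) geodesic_isCont[OF g1] \<rho>(1) cv(1)] by blast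
  obtain \<delta>2 where d2: "\<delta>2 > 0" "\<And>s. \<bar>s - t0\<bar> < \<delta>2 \<Longrightarrow> \<tau> s \<in> fst c"
    "\<And>s. \<bar>s - t0\<bar> < \<delta>2 \<Longrightarrow> ?y s \<in> cball (?y t0) \<rho>" "\<And>s. \<bar>s - t0\<bar> < \<delta>2 \<Longrightarrow> norm (?w s) \<le> norm (?w t0) + 1"
    using curve_in_chart_ball[OF c(1,3) geodesic_isCont[OF g2] \<rho>(1) cv(2)] by blast
  define M where "M = norm (?v t0) + 1"
  define \<delta> where "\<delta> = min \<delta>1 \<delta>2"
  have M: "M \<ge> 0" and \<delta>: "\<delta> > 0" using d1(1) d2(1) by (auto simp: M_def \<delta>_def)
  have near: "\<sigma> s \<in> fst c" "\<tau> s \<in> fst c" "?x s \<in> ?B" "?y s \<in> ?B" "norm (?v s) \<le> M" "norm (?w s) \<le> M"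
    if "\<bar>s - t0\<bar> < \<delta>" for s
    using d1(2-)[of s] d2(2-)[of s] that eq by (auto simp: \<delta>_def M_def)
  let ?f = "\<lambda>s. (?x s - ?y s, ?v s - ?w s)"
  let ?f' = "\<lambda>s. (?v s - ?w s, - chris c (?x s) (?v s) (?v s) - - chris c (?y s) (?w s) (?w s))"
  have f': "(?f has_vector_derivative ?f' s) (at s)" if "\<bar>s - t0\<bar> < \<delta>" for s
    using near(1,2)[OF that]
    by (intro has_vector_derivative_Pair has_vector_derivative_diff geodesic_chart_position
        geodesic_chart_velocity g1 g2 c)
  have bd: "norm (?f' s) \<le> (1 + L * (M * M) + 2 * L * M) * norm (?f s)" if s: "\<bar>s - t0\<bar> < \<delta>" for s
  proof -
    note n = near[OF s]
    define F where "F = norm (?f s)"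
    have Fx: "norm (?x s - ?y s) \<le> F" and Fv: "norm (?v s - ?w s) \<le> F" and F0: "F \<ge> 0"
      unfolding F_def using norm_fst_le[of "?x s - ?y s" "?v s - ?w s"] norm_snd_le[of "?v s - ?w s" "?x s - ?y s"] by auto
    have yin: "?y s \<in> snd c ` fst c" using n(2) by simp
    note bil = chris_bilinear[OF c(1) yin]
    \<comment> \<open>The difference is split by changing first the base point and then the two
      velocity arguments one at a time. This yields the summands \<open>L * (M * M)\<close> and
      \<open>2 * L * M\<close> of the constant; the position component contributes the 1.\<close>
    have "- chris c (?x s) (?v s) (?v s) - - chris c (?y s) (?w s) (?w s) =
        - ((chris c (?x s) (?v s) (?v s) - chris c (?y s) (?v s) (?v s))
          + (chris c (?y s) (?v s - ?w s) (?v s) + chris c (?y s) (?w s) (?v s - ?w s)))"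
      by (simp add: bilinear_lsub[OF bil] bilinear_rsub[OF bil])
    then have "norm (- chris c (?x s) (?v s) (?v s) - - chris c (?y s) (?w s) (?w s)) \<le>
        norm (chris c (?x s) (?v s) (?v s) - chris c (?y s) (?v s) (?v s))
          + (norm (chris c (?y s) (?v s - ?w s) (?v s)) + norm (chris c (?y s) (?w s) (?v s - ?w s)))"
      by (simp only: norm_minus_cancel) (intro order_trans[OF norm_triangle_ineq] add_left_mono norm_triangle_ineq)
    also have "\<dots> \<le> L * F * (M * M) + (L * (F * M) + L * (M * F))"
    proof (intro add_mono)
      show "norm (chris c (?x s) (?v s) (?v s) - chris c (?y s) (?v s) (?v s)) \<le> L * F * (M * M)"
        by (rule order_trans[OF L(3)[OF n(3,4)]]) (intro mult_mono Fx n L mult_nonneg_nonneg F0 M order_refl norm_ge_zero)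
      show "norm (chris c (?y s) (?v s - ?w s) (?v s)) \<le> L * (F * M)"
        by (rule order_trans[OF L(2)[OF n(4)]]) (intro mult_mono Fv n L mult_nonneg_nonneg F0 M order_refl norm_ge_zero)
      show "norm (chris c (?y s) (?w s) (?v s - ?w s)) \<le> L * (M * F)"
        by (rule order_trans[OF L(2)[OF n(4)]]) (intro mult_mono Fv n L mult_nonneg_nonneg F0 M order_refl norm_ge_zero)
    qed
    finally have "norm (- chris c (?x s) (?v s) (?v s) - - chris c (?y s) (?w s) (?w s)) \<le>
        L * F * (M * M) + (L * (F * M) + L * (M * F))" .
    then have "norm (?f' s) \<le> F + (L * F * (M * M) + (L * (F * M) + L * (M * F)))"
      using Fv norm_Pair_le[of "?v s - ?w s" "- chris c (?x s) (?v s) (?v s) - - chris c (?y s) (?w s) (?w s)"]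
      by linarith
    then show ?thesis by (simp add: F_def[symmetric] algebra_simps)
  qed
  have "?f s = 0" if "\<bar>s - t0\<bar> < \<delta>" for s
  proof (rule linear_growth_imp_zero[where f = ?f and f' = ?f' and a = "t0 - \<delta>" and b = "t0 + \<delta>"
        and ?t0.0 = t0 and t = s and C = "1 + L * (M * M) + 2 * L * M"])
    fix s assume s: "t0 - \<delta> < s" "s < t0 + \<delta>"
    then have s': "\<bar>s - t0\<bar> < \<delta>" by linarith
    show "(?f has_vector_derivative ?f' s) (at s)" by (rule f'[OF s'])
    show "norm (?f' s) \<le> (1 + L * (M * M) + 2 * L * M) * norm (?f s)" by (rule bd[OF s'])
  qed (use that \<delta> eq in \<open>auto simp: zero_prod_def\<close>)
  then have "?x s = ?y s" if "\<bar>s - t0\<bar> < \<delta>" for s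
    using that by (simp add: zero_prod_def)
  then have "\<sigma> s = \<tau> s" if "\<bar>s - t0\<bar> < \<delta>" for s
    using that near(1,2)[OF that] chart_inv_snd[OF is_chart[OF c(1)]] by metis
  with \<delta> show ?thesis by blast
qed

text \<open>The set of times where positions and velocities agree is open by local uniqueness and
  closed by continuity, and the real line is connected.\<close>

lemma geodesic_unique:
  assumes g1: "geodesic A g \<sigma>" and g2: "geodesic A g \<tau>"
    and eq: "\<sigma> t0 = \<tau> t0" "velocity A \<sigma> t0 = velocity A \<tau> t0"
  shows "\<sigma> = \<tau>"
proof -
  define Z where "Z = {t. \<sigma> t = \<tau> t \<and> velocity A \<sigma> t = velocity A \<tau> t}"
  have "open Z"
    unfolding open_dist
  proof
    fix t assume "t \<in> Z"
    then obtain \<delta> where \<delta>: "\<delta> > 0" "\<And>s. \<bar>s - t\<bar> < \<delta> \<Longrightarrow> \<sigma> s = \<tau> s"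
      using geodesic_unique_local[OF g1 g2, of t] unfolding Z_def by blast
    have "s \<in> Z" if "\<bar>s - t\<bar> < \<delta>" for s
    proof -
      have "has_velocity \<tau> s (velocity A \<sigma> s)"
        by (rule has_velocity_transform[OF geodesic_has_velocity[OF g1], of "ball t \<delta>"])
          (use that \<delta> in \<open>auto simp: dist_real_def\<close>)
      then have "velocity A \<tau> s = velocity A \<sigma> s" by (rule has_velocity_velocity)
      then show ?thesis using \<delta>(2)[OF that] by (simp add: Z_def)
    qed
    with \<delta>(1) show "\<exists>e>0. \<forall>y. dist y t < e \<longrightarrow> y \<in> Z" unfolding dist_real_def by blast
  qed
  moreover have "open (- Z)"
    unfolding open_subopen[of "- Z"]
  proof
    fix t assume t: "t \<in> - Z"
    show "\<exists>T. open T \<and> t \<in> T \<and> T \<subseteq> - Z"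
    proof (cases "\<sigma> t = \<tau> t")
      case False
      have "open {t. \<sigma> t \<noteq> \<tau> t}"
        using geodesic_isCont[OF g1] geodesic_isCont[OF g2]
        by (intro open_Collect_neq continuous_at_imp_continuous_on) auto
      then show ?thesis using False by (intro exI[of _ "{t. \<sigma> t \<noteq> \<tau> t}"]) (auto simp: Z_def)
    next
      case True
      \<comment> \<open>Velocities can be compared by continuity only in a common chart, which is
        available because the positions agree at \<open>t\<close>.\<close>
      let ?c = "chart_at A (\<sigma> t)"
      have c: "?c \<in> A" "\<sigma> t \<in> fst ?c" "\<tau> t \<in> fst ?c" using chart_at_in[of "\<sigma> t"] True by auto
      let ?h = "\<lambda>s. coord A ?c (\<sigma> s) (velocity A \<sigma> s) - coord A ?c (\<tau> s) (velocity A \<tau> s)"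
      have cont: "isCont ?h t"
        using geodesic_chart_velocity[OF g1 c(1,2)] geodesic_chart_velocity[OF g2 c(1,3)]
          has_vector_derivative_continuous by (intro continuous_intros) blast+
      have ne: "?h t \<in> - {0}"
        using t True by (simp add: Z_def)
      have op: "open (- {0 :: 'e})" by (rule open_Compl[OF closed_singleton])
      obtain W where W: "open W" "t \<in> W" "\<And>s. s \<in> W \<Longrightarrow> ?h s \<in> - {0}"
        using isCont_open_vimage[where f = ?h and t = t, OF cont op ne] by blast
      have "s \<notin> Z" if "s \<in> W" for s
        using W(3)[OF that] by (auto simp: Z_def)
      with W(1,2) show ?thesis by blast
    qed
  qed
  then have "closed Z" by (simp add: closed_def)
  moreover have "t0 \<in> Z" using eq by (simp add: Z_def)
  ultimately have "Z = UNIV"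
    using connected_UNIV[where 'a = real] unfolding connected_clopen by force
  then show ?thesis by (auto simp: Z_def)
qed

lemma has_velocity_affine:
  assumes "has_velocity \<sigma> (a + b * t) v"
  shows "has_velocity (\<lambda>t. \<sigma> (a + b * t)) t (b *\<^sub>R v)"
  unfolding has_velocity_def
proof
  show "isCont (\<lambda>t. \<sigma> (a + b * t)) t"
    by (rule isCont_o2[where f = "\<lambda>t. a + b * t" and g = \<sigma>, OF _ has_velocity_isCont[OF assms]])
      (intro continuous_intros)
  have "((\<lambda>t. a + b * t) has_vector_derivative b) (at t)"
    by (auto intro!: derivative_eq_intros simp: has_real_derivative_iff_has_vector_derivative[symmetric])
  from vector_diff_chain_at[OF this, of "snd (chart_at A (\<sigma> (a + b * t))) \<circ> \<sigma>" v] assms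
  show "(snd (chart_at A (\<sigma> (a + b * t))) \<circ> (\<lambda>t. \<sigma> (a + b * t)) has_vector_derivative b *\<^sub>R v) (at t)"
    by (simp add: has_velocity_def o_def)
qed

text \<open>The geodesic equation is quadratic in the velocity, so both of its terms pick up the
  factor \<open>b\<close> squared. This is what makes the exponential of
  \<open>r *\<^sub>R \<nu> p\<close> the point at time \<open>r\<close> of one fixed
  geodesic.\<close>

lemma geodesic_scale:
  assumes \<sigma>: "geodesic A g \<sigma>"
  shows "geodesic A g (\<lambda>t. \<sigma> (b * t))" "velocity A (\<lambda>t. \<sigma> (b * t)) t = b *\<^sub>R velocity A \<sigma> (b * t)"
proof -
  have hv: "has_velocity (\<lambda>t. \<sigma> (b * t)) t (b *\<^sub>R velocity A \<sigma> (b * t))" for t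
    using has_velocity_affine[where a = 0] geodesic_has_velocity[OF \<sigma>] by simp
  then show vel: "velocity A (\<lambda>t. \<sigma> (b * t)) t = b *\<^sub>R velocity A \<sigma> (b * t)" for t
    by (rule has_velocity_velocity)
  have "smooth_map real_atlas A UNIV (\<lambda>t. \<sigma> (b * t))"
    using smooth_map_real_affine[of UNIV \<sigma> 0 b] \<sigma> by (simp add: geodesic_def)
  moreover have "has_covd A g (\<lambda>t. \<sigma> (b * t)) (velocity A (\<lambda>t. \<sigma> (b * t))) t 0" for t
  proof -
    let ?c = "chart_at A (\<sigma> (b * t))"
    have c: "?c \<in> A" "\<sigma> (b * t) \<in> fst ?c" by auto
    let ?v = "velocity A \<sigma> (b * t)"
    let ?\<Gamma> = "chris ?c (snd ?c (\<sigma> (b * t)))"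
    have bil: "bilinear ?\<Gamma>" by (rule chris_bilinear) auto
    obtain U where U: "open U" "t \<in> U" "\<And>s. s \<in> U \<Longrightarrow> \<sigma> (b * s) \<in> fst ?c"
      using isCont_open_vimage[OF has_velocity_isCont[OF hv[of t]] open_chart_domain[OF is_chart[OF c(1)]] c(2)] by blast
    have "((\<lambda>t. b * t) has_vector_derivative b) (at t)"
      by (auto intro!: derivative_eq_intros simp: has_real_derivative_iff_has_vector_derivative[symmetric])
    from vector_diff_chain_at[OF this geodesic_chart_velocity[OF \<sigma> c]]
    have "((\<lambda>s. b *\<^sub>R coord A ?c (\<sigma> (b * s)) (velocity A \<sigma> (b * s))) has_vector_derivative b *\<^sub>R (b *\<^sub>R - ?\<Gamma> ?v ?v)) (at t)"
      by (intro bounded_linear.has_vector_derivative[OF bounded_linear_scaleR_right]) (simp add: o_def)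
    then have "((\<lambda>s. coord A ?c (\<sigma> (b * s)) (b *\<^sub>R velocity A \<sigma> (b * s))) has_vector_derivative b *\<^sub>R (b *\<^sub>R - ?\<Gamma> ?v ?v)) (at t)"
      by (rule has_vector_derivative_transform_within_open[OF _ U(1,2)])
        (use U(3) linear_coord[OF c(1)] in \<open>simp add: linear_cmul\<close>)
    then show ?thesis
      unfolding has_covd_iff covd_in_chart_def vel
      by (simp add: bilinear_lmul[OF bil] bilinear_rmul[OF bil])
  qed
  ultimately show "geodesic A g (\<lambda>t. \<sigma> (b * t))" by (simp add: geodesic_def)
qed

lemma riem_exp_eq:
  assumes "geodesic A g \<sigma>" "\<sigma> 0 = p" "velocity A \<sigma> 0 = v"
  shows "riem_exp A g p v = \<sigma> 1"
  unfolding riem_exp_def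
proof (rule the_equality)
  show "\<exists>\<tau>. geodesic A g \<tau> \<and> \<tau> 0 = p \<and> velocity A \<tau> 0 = v \<and> \<sigma> 1 = \<tau> 1" using assms by blast
  fix q assume "\<exists>\<tau>. geodesic A g \<tau> \<and> \<tau> 0 = p \<and> velocity A \<tau> 0 = v \<and> q = \<tau> 1"
  then obtain \<tau> where \<tau>: "geodesic A g \<tau>" "\<tau> 0 = p" "velocity A \<tau> 0 = v" "q = \<tau> 1" by blast
  with geodesic_unique[OF \<tau>(1) assms(1), of 0] assms show "q = \<sigma> 1" by simp
qed

lemma normal_exp_eq_geodesic:
  assumes "geodesic A g \<sigma>" "\<sigma> 0 = p" "velocity A \<sigma> 0 = \<nu> p"
  shows "normal_exp A g \<nu> r p = \<sigma> r"
  unfolding normal_exp_def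
  using riem_exp_eq[OF geodesic_scale(1)[OF assms(1), of r], of p "r *\<^sub>R \<nu> p"] geodesic_scale(2)[OF assms(1), of r 0] assms
  by simp

section \<open>Parallel fields along a curve\<close>

definition parallel_on :: "(real \<Rightarrow> 'm) \<Rightarrow> real set \<Rightarrow> (real \<Rightarrow> 'e) \<Rightarrow> bool" where
  "parallel_on \<sigma> I V \<longleftrightarrow> (\<forall>t\<in>I. has_covd A g \<sigma> V t 0)"

lemma parallel_on_subset: "parallel_on \<sigma> I V \<Longrightarrow> I' \<subseteq> I \<Longrightarrow> parallel_on \<sigma> I' V"
  by (auto simp: parallel_on_def)

lemma parallel_on_transform:
  "parallel_on \<sigma> I V \<Longrightarrow> open I \<Longrightarrow> (\<And>s. s \<in> I \<Longrightarrow> V s = W s) \<Longrightarrow> parallel_on \<sigma> I W"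
  unfolding parallel_on_def using has_covd_transform by blast

context
  fixes \<sigma> :: "real \<Rightarrow> 'm" assumes sm: "smooth_map real_atlas A UNIV \<sigma>"
begin

lemma curve_velocity: "has_velocity \<sigma> t (velocity A \<sigma> t)"
  by (rule smooth_curve_has_velocity[OF sm]) auto

lemma curve_isCont: "isCont \<sigma> t"
  by (rule has_velocity_isCont[OF curve_velocity])

lemma parallel_inner_const:
  assumes "parallel_on \<sigma> {a<..<b} V" "parallel_on \<sigma> {a<..<b} W" "s \<in> {a<..<b}" "t \<in> {a<..<b}"
  shows "g (\<sigma> s) (V s) (W s) = g (\<sigma> t) (V t) (W t)"
proof (rule DERIV_isconst3[where f = "\<lambda>s. g (\<sigma> s) (V s) (W s)" and x = s and y = t and a = a and b = b])
  show "a < b" using assms(3) by auto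
  fix u assume "u \<in> {a<..<b}"
  then have "has_covd A g \<sigma> V u 0" "has_covd A g \<sigma> W u 0" using assms by (auto simp: parallel_on_def)
  from has_covd_metric[OF curve_velocity this]
  show "DERIV (\<lambda>s. g (\<sigma> s) (V s) (W s)) u :> 0"
    by (simp add: has_real_derivative_iff_has_vector_derivative)
qed (use assms in auto)

lemma parallel_lincomb:
  assumes "parallel_on \<sigma> I V" "parallel_on \<sigma> I W"
  shows "parallel_on \<sigma> I (\<lambda>s. k *\<^sub>R V s + W s)"
  using assms has_covd_lincomb[OF curve_velocity, of V _ 0 W 0 k] by (simp add: parallel_on_def)

text \<open>The difference of two parallel fields is parallel, so its squared length is constant and
  vanishes with its value at \<open>s\<close>.\<close>

lemma parallel_unique:
  assumes V: "parallel_on \<sigma> {a<..<b} V" and W: "parallel_on \<sigma> {a<..<b} W"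
    and s: "s \<in> {a<..<b}" "V s = W s" and t: "t \<in> {a<..<b}"
  shows "V t = W t"
proof -
  have p: "parallel_on \<sigma> {a<..<b} (\<lambda>s. (-1) *\<^sub>R V s + W s)"
    by (rule parallel_lincomb[OF V W])
  have "g (\<sigma> t) ((-1) *\<^sub>R V t + W t) ((-1) *\<^sub>R V t + W t) = 0"
    using parallel_inner_const[OF p p s(1) t] s(2) by simp
  then have "(-1) *\<^sub>R V t + W t = 0" by (simp only: g_eq_0_iff)
  then show ?thesis by simp
qed

text \<open>The initial value may be posed at any time of the interval, so that solutions can be
  continued in both directions when intervals are glued.\<close>

definition solvable_on :: "real \<Rightarrow> real \<Rightarrow> bool" where
  "solvable_on a b \<longleftrightarrow> (\<forall>s\<in>{a<..<b}. \<forall>w. \<exists>V. V s = w \<and> parallel_on \<sigma> {a<..<b} V)"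

lemma solvable_on_subset:
  assumes "solvable_on a b" "a \<le> a'" "b' \<le> b"
  shows "solvable_on a' b'"
  unfolding solvable_on_def
proof (intro ballI allI)
  fix s w assume s: "s \<in> {a'<..<b'}"
  have sub: "{a'<..<b'} \<subseteq> {a<..<b}" using assms by auto
  then obtain V where "V s = w" "parallel_on \<sigma> {a<..<b} V"
    using assms(1) s unfolding solvable_on_def by blast
  with parallel_on_subset[OF _ sub] show "\<exists>V. V s = w \<and> parallel_on \<sigma> {a'<..<b'} V" by blast
qed

lemma parallel_glue:
  assumes V: "parallel_on \<sigma> {a<..<b} V" and W: "parallel_on \<sigma> {c<..<d} W"
    and m: "a \<le> c" "c < m" "m < b" "b \<le> d" "V m = W m"
  shows "\<exists>U. parallel_on \<sigma> {a<..<d} U \<and> (\<forall>s\<in>{a<..<b}. U s = V s) \<and> (\<forall>s\<in>{c<..<d}. U s = W s)"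
proof -
  define U where "U s = (if s < m then V s else W s)" for s
  \<comment> \<open>Agreement at the single time \<open>m\<close> spreads over the overlap by
    uniqueness, so the glued field coincides with each piece on an open interval, as the covariant
    derivative requires.\<close>
  have eq: "V s = W s" if "s \<in> {c<..<b}" for s
    by (rule parallel_unique[of c b V W m])
      (use V W m that in \<open>auto intro: parallel_on_subset\<close>)
  have UV: "U s = V s" if "s \<in> {a<..<b}" for s
    using eq[of s] that m by (auto simp: U_def)
  have UW: "U s = W s" if "s \<in> {c<..<d}" for s
    using eq[of s] that m by (auto simp: U_def)
  have "parallel_on \<sigma> {a<..<b} U"
    by (rule parallel_on_transform[OF V]) (use UV in auto)
  moreover have "parallel_on \<sigma> {c<..<d} U"
    by (rule parallel_on_transform[OF W]) (use UW in auto)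
  moreover have "{a<..<d} \<subseteq> {a<..<b} \<union> {c<..<d}" using m by auto
  ultimately have "parallel_on \<sigma> {a<..<d} U"
    unfolding parallel_on_def by blast
  with UV UW show ?thesis by blast
qed

lemma solvable_on_glue:
  assumes ab: "solvable_on a b" and cd: "solvable_on c d" and o: "a \<le> c" "c < b" "b \<le> d"
  shows "solvable_on a d"
  unfolding solvable_on_def
proof (intro ballI allI)
  fix s w assume s: "s \<in> {a<..<d}"
  define m where "m = (c + b) / 2"
  have m: "c < m" "m < b" using o by (auto simp: m_def)
  show "\<exists>V. V s = w \<and> parallel_on \<sigma> {a<..<d} V"
  proof (cases "s < b")
    case True
    then obtain V where V: "V s = w" "parallel_on \<sigma> {a<..<b} V" using ab s unfolding solvable_on_def by force
    obtain W where W: "W m = V m" "parallel_on \<sigma> {c<..<d} W" using cd m o unfolding solvable_on_def by force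
    from parallel_glue[OF V(2) W(2) o(1) m o(3)] W(1) V(1) True s show ?thesis by force
  next
    case False
    then have "s \<in> {c<..<d}" using s o by auto
    then obtain W where W: "W s = w" "parallel_on \<sigma> {c<..<d} W" using cd unfolding solvable_on_def by force
    obtain V where V: "V m = W m" "parallel_on \<sigma> {a<..<b} V" using ab m o unfolding solvable_on_def by force
    from parallel_glue[OF V(2) W(2) o(1) m o(3)] W(1) V(1) \<open>s \<in> {c<..<d}\<close> show ?thesis by force
  qed
qed

text \<open>In a chart a parallel field solves the linear equation y' = - \<Gamma>(x', y), to which
  the local existence theorem applies on a short interval.\<close>

lemma solvable_on_local: "\<exists>\<delta>>0. solvable_on (t0 - \<delta>) (t0 + \<delta>)"
proof -
  define c where "c = chart_at A (\<sigma> t0)"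
  have c: "c \<in> A" "\<sigma> t0 \<in> fst c" by (auto simp: c_def)
  let ?x = "\<lambda>s. snd c (\<sigma> s)" and ?v = "\<lambda>s. coord A c (\<sigma> s) (velocity A \<sigma> s)"
  have x0: "?x t0 \<in> snd c ` fst c" using c by simp
  obtain \<rho> where \<rho>: "\<rho> > 0" "cball (?x t0) \<rho> \<subseteq> snd c ` fst c"
    using chart_cball[OF c(1) x0] by blast
  let ?B = "cball (?x t0) \<rho>"
  obtain L where L: "L \<ge> 0" "\<And>x u v. x \<in> ?B \<Longrightarrow> norm (chris c x u v) \<le> L * (norm u * norm v)"
    "\<And>x y u v. x \<in> ?B \<Longrightarrow> y \<in> ?B \<Longrightarrow>
      norm (chris c x u v - chris c y u v) \<le> L * norm (x - y) * (norm u * norm v)"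
    using chris_lipschitz[OF c(1) compact_cball convex_cball \<rho>(2)] by blast
  have dom: "open (UNIV \<inter> \<sigma> -` fst c)" "smooth_on (UNIV \<inter> \<sigma> -` fst c) (snd c \<circ> \<sigma>)"
    using open_curve_domain[OF sm open_UNIV c(1)] smooth_curve_smooth_on[OF sm c(1)] by auto
  have v_eq: "?v s = frechet_derivative (snd c \<circ> \<sigma>) (at s) 1" if "\<sigma> s \<in> fst c" for s
  proof -
    have "(snd c \<circ> \<sigma> has_derivative frechet_derivative (snd c \<circ> \<sigma>) (at s)) (at s)"
      using smooth_on_has_derivative[OF dom(2)] that by auto
    moreover have "(snd c \<circ> \<sigma> has_derivative (\<lambda>h. h *\<^sub>R ?v s)) (at s)"
      using has_velocity_chart[OF curve_velocity c(1) that] by (simp add: has_vector_derivative_def)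
    ultimately have "frechet_derivative (snd c \<circ> \<sigma>) (at s) = (\<lambda>h. h *\<^sub>R ?v s)"
      by (rule has_derivative_unique)
    then show ?thesis by simp
  qed
  have v_cont: "isCont ?v s" if s: "\<sigma> s \<in> fst c" for s
  proof -
    have "continuous_on (UNIV \<inter> \<sigma> -` fst c) (\<lambda>s. frechet_derivative (snd c \<circ> \<sigma>) (at s) 1)"
      by (rule smooth_on_continuous_on[OF smooth_on_deriv[OF dom(2)]])
    then have "continuous_on (UNIV \<inter> \<sigma> -` fst c) ?v"
      by (rule continuous_on_eq) (use v_eq in auto)
    then show ?thesis using dom(1) s continuous_on_eq_continuous_at by blast
  qed
  obtain \<delta>1 where d1: "\<delta>1 > 0" "\<And>s. \<bar>s - t0\<bar> < \<delta>1 \<Longrightarrow> \<sigma> s \<in> fst c"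
    "\<And>s. \<bar>s - t0\<bar> < \<delta>1 \<Longrightarrow> ?x s \<in> ?B" "\<And>s. \<bar>s - t0\<bar> < \<delta>1 \<Longrightarrow> norm (?v s) \<le> norm (?v t0) + 1"
    using curve_in_chart_ball[OF c curve_isCont \<rho>(1) v_cont[OF c(2)]] by blast
  define M where "M = norm (?v t0) + 1"
  have M: "M > 0" by (simp add: M_def add_nonneg_pos)
  \<comment> \<open>With this choice the operator bound \<open>L * M\<close> times the length
    \<open>2 * \<delta>\<close> of the interval is at most 1/2, as the contraction demands; half of
    \<open>\<delta>1\<close> keeps the closed interval inside the chart.\<close>
  define \<delta> where "\<delta> = min (\<delta>1 / 2) (1 / (4 * (L * M + 1)))"
  have LM: "L * M \<ge> 0" using L M by simp
  have \<delta>: "\<delta> > 0" "\<delta> < \<delta>1" using d1(1) LM by (auto simp: \<delta>_def)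
  have "L * M * \<delta> \<le> L * M * (1 / (4 * (L * M + 1)))"
    by (intro mult_left_mono LM) (simp add: \<delta>_def)
  also have "\<dots> \<le> 1 / 4" using LM by (simp add: field_simps)
  finally have LMd: "(L * M) * ((t0 + \<delta>) - (t0 - \<delta>)) \<le> 1/2" by simp
  let ?I = "{t0 - \<delta>..t0 + \<delta>}"
  have near: "\<sigma> s \<in> fst c" "?x s \<in> ?B" "norm (?v s) \<le> M" if "s \<in> ?I" for s
    using d1(2-)[of s] that \<delta> by (auto simp: M_def abs_le_iff abs_less_iff)
  define Q where "Q s y = - chris c (?x s) (?v s) y" for s y
  have bil: "bilinear (chris c (?x s))" if "s \<in> ?I" for s
    by (rule chris_bilinear[OF c(1)]) (use near(1)[OF that] in auto)
  have Qlin: "linear (Q s)" if "s \<in> ?I" for s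
    using bil[OF that] unfolding Q_def bilinear_def by (intro linear_compose_neg) auto
  have Qbd: "norm (Q s y) \<le> (L * M) * norm y" if s: "s \<in> ?I" for s y
  proof -
    have "norm (Q s y) \<le> L * (norm (?v s) * norm y)"
      unfolding Q_def norm_minus_cancel by (rule L(2)[OF near(2)[OF s]])
    also have "\<dots> \<le> L * (M * norm y)"
      using near(3)[OF s] L(1) by (intro mult_left_mono mult_right_mono) auto
    finally show ?thesis by simp
  qed
  have Qcont: "continuous_on ?I (\<lambda>s. Q s (y s))" if y: "continuous_on UNIV y" for y
  proof -
    have Gc: "continuous_on ?B (\<lambda>x. chris c x i j)" for i j
    proof (rule lipschitz_on_continuous_on[OF lipschitz_onI])
      show "dist (chris c x i j) (chris c y i j) \<le> (L * (norm i * norm j)) * dist x y" if "x \<in> ?B" "y \<in> ?B" for x y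
        using L(3)[OF that, of i j] by (simp add: dist_norm ac_simps)
      show "0 \<le> L * (norm i * norm j)" using L(1) by simp
    qed
    have "continuous_on ?I ?x"
      using isCont_o2[OF curve_isCont isCont_chart[OF is_chart[OF c(1)] near(1)]]
      by (intro continuous_at_imp_continuous_on) blast
    then have "continuous_on ?I (\<lambda>s. chris c (?x s) i j)" for i j
      by (rule continuous_on_compose2[OF Gc]) (use near(2) in blast)
    moreover have "continuous_on ?I ?v"
      using v_cont near(1) by (intro continuous_at_imp_continuous_on) blast
    moreover have "continuous_on ?I y" using y continuous_on_subset by blast
    ultimately have "continuous_on ?I (\<lambda>s. - (\<Sum>i\<in>Basis. \<Sum>j\<in>Basis. ((?v s \<bullet> i) * (y s \<bullet> j)) *\<^sub>R chris c (?x s) i j))"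
      by (intro continuous_intros)
    then show ?thesis
      by (rule continuous_on_eq) (simp add: Q_def bilinear_euclidean_expand[OF bil, symmetric])
  qed
  have "solvable_on (t0 - \<delta>) (t0 + \<delta>)"
    unfolding solvable_on_def
  proof (intro ballI allI)
    fix s w assume s: "s \<in> {t0 - \<delta><..<t0 + \<delta>}"
    then have "s \<in> ?I" by auto
    then obtain y where y: "y s = coord A c (\<sigma> s) w"
      "\<And>t. t \<in> {t0 - \<delta><..<t0 + \<delta>} \<Longrightarrow> (y has_vector_derivative Q t (y t)) (at t)"
      using linear_ode_local_existence[of "t0 - \<delta>" "t0 + \<delta>" Q "L * M" s "coord A c (\<sigma> s) w"]
        Qlin Qcont Qbd LM LMd by blast
    define V where "V t = vec A c (\<sigma> t) (y t)" for t
    have cV: "coord A c (\<sigma> t) (V t) = y t" if "t \<in> {t0 - \<delta><..<t0 + \<delta>}" for t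
      unfolding V_def by (rule coord_vec[OF c(1) near(1)]) (use that in auto)
    have "V s = w" unfolding V_def y(1) by (rule vec_coord[OF c(1) near(1)]) (use s in auto)
    moreover have "has_covd A g \<sigma> V t 0" if t: "t \<in> {t0 - \<delta><..<t0 + \<delta>}" for t
    proof -
      have tc: "\<sigma> t \<in> fst c" by (rule near) (use t in auto)
      have "((\<lambda>s. coord A c (\<sigma> s) (V s)) has_vector_derivative Q t (y t)) (at t)"
        by (rule has_vector_derivative_transform_within_open[OF y(2)[OF t] open_greaterThanLessThan t])
          (rule cV[symmetric])
      then show ?thesis
        using cV[OF t] linear_0[OF linear_coord[OF c(1) tc]]
        unfolding has_covd_chart[OF curve_velocity c(1) tc] covd_in_chart_def by (simp add: Q_def)
    qed
    ultimately show "\<exists>V. V s = w \<and> parallel_on \<sigma> {t0 - \<delta><..<t0 + \<delta>} V"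
      unfolding parallel_on_def by blast
  qed
  with \<delta>(1) show ?thesis by blast
qed

text \<open>Bisection: short intervals are solvable, and solvable intervals with a common endpoint
  are glued. The margin \<open>\<epsilon>\<close> makes them overlap.\<close>

lemma solvable_on_interval: "a \<le> b \<Longrightarrow> \<exists>\<epsilon>>0. solvable_on (a - \<epsilon>) (b + \<epsilon>)"
proof (induction rule: Bolzano)
  case (trans a b c)
  then obtain e1 e2 where e: "e1 > 0" "solvable_on (a - e1) (b + e1)" "e2 > 0" "solvable_on (b - e2) (c + e2)"
    by blast
  define e where "e = min e1 e2"
  have "solvable_on (a - e) (b + e)" "solvable_on (b - e) (c + e)"
    using e by (auto intro: solvable_on_subset simp: e_def)
  moreover have "e > 0" using e by (simp add: e_def)
  ultimately have "solvable_on (a - e) (c + e)"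
    using trans by (intro solvable_on_glue[of "a - e" "b + e" "b - e" "c + e"]) auto
  with \<open>e > 0\<close> show ?case by blast
next
  case (local x)
  obtain d where d: "d > 0" "solvable_on (x - d) (x + d)" using solvable_on_local by blast
  have "\<exists>\<epsilon>>0. solvable_on (a - \<epsilon>) (b + \<epsilon>)" if "a \<le> x \<and> x \<le> b \<and> b - a < d / 2" for a b
  proof -
    have "solvable_on (a - d/2) (b + d/2)"
      using that by (intro solvable_on_subset[OF d(2)]) auto
    then show ?thesis using d(1) half_gt_zero by blast
  qed
  then show ?case using half_gt_zero[OF d(1)] by blast
qed

text \<open>By uniqueness the solutions on growing intervals around 0 agree wherever two of them are
  defined, and so form one global field.\<close>

lemma parallel_exists: "\<exists>V. V 0 = w \<and> parallel_on \<sigma> UNIV V"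
proof -
  have "\<exists>V. V 0 = w \<and> parallel_on \<sigma> {- (real n + 1)<..<real n + 1} V" for n
  proof -
    obtain e where e: "e > 0" "solvable_on (- (real n + 1) - e) (real n + 1 + e)"
      using solvable_on_interval[of "- (real n + 1)" "real n + 1"] by auto
    have "solvable_on (- (real n + 1)) (real n + 1)"
      by (rule solvable_on_subset[OF e(2)]) (use e(1) in auto)
    then show ?thesis unfolding solvable_on_def by force
  qed
  then obtain V where V: "\<And>n. V n 0 = w" "\<And>n. parallel_on \<sigma> {- (real n + 1)<..<real n + 1} (V n)"
    by metis
  \<comment> \<open>The index is at least |t|, and the interval extends one unit beyond its index,
    so \<open>t\<close> is an interior point of the domain of the field that is used there.\<close>
  define U where "U t = V (nat \<lceil>\<bar>t\<bar>\<rceil>) t" for t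
  have in_ball: "t \<in> {- (real (nat \<lceil>\<bar>t\<bar>\<rceil>) + 1)<..<real (nat \<lceil>\<bar>t\<bar>\<rceil>) + 1}" for t :: real
  proof -
    have "\<bar>t\<bar> < real (nat \<lceil>\<bar>t\<bar>\<rceil>) + 1" using real_nat_ceiling_ge[of "\<bar>t\<bar>"] by linarith
    then show ?thesis unfolding greaterThanLessThan_iff abs_less_iff by linarith
  qed
  have eq: "V n t = V m t" if "t \<in> {- (real n + 1)<..<real n + 1}" "t \<in> {- (real m + 1)<..<real m + 1}" for n m t
  proof (rule parallel_unique[where V = "V n" and W = "V m" and t = t and s = 0 and a = "- (real (min n m) + 1)" and b = "real (min n m) + 1"])
    show "parallel_on \<sigma> {- (real (min n m) + 1)<..<real (min n m) + 1} (V n)"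
      by (rule parallel_on_subset[OF V(2)]) auto
    show "parallel_on \<sigma> {- (real (min n m) + 1)<..<real (min n m) + 1} (V m)"
      by (rule parallel_on_subset[OF V(2)]) auto
  qed (use that V(1) in \<open>auto simp: min_def\<close>)
  have "has_covd A g \<sigma> U t 0" for t
  proof (rule has_covd_transform)
    let ?n = "nat \<lceil>\<bar>t\<bar>\<rceil>"
    show "has_covd A g \<sigma> (V ?n) t 0"
      using V(2)[of ?n] in_ball[of t] by (simp add: parallel_on_def)
    show "t \<in> {- (real ?n + 1)<..<real ?n + 1}" by (rule in_ball)
    show "V ?n s = U s" if "s \<in> {- (real ?n + 1)<..<real ?n + 1}" for s
      unfolding U_def using that in_ball[of s] by (rule eq)
  qed auto
  moreover have "U 0 = w" using V(1) by (simp add: U_def)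
  ultimately show ?thesis unfolding parallel_on_def by blast
qed

lemma parallel_unique_UNIV:
  assumes "parallel_on \<sigma> UNIV V" "parallel_on \<sigma> UNIV W" "V s = W s"
  shows "V = W"
proof
  fix t
  define N where "N = \<bar>s\<bar> + \<bar>t\<bar> + 1"
  have "s \<in> {- N<..<N}" "t \<in> {- N<..<N}" unfolding N_def greaterThanLessThan_iff by linarith+
  then show "V t = W t"
    using parallel_unique[OF parallel_on_subset[OF assms(1) subset_UNIV] parallel_on_subset[OF assms(2) subset_UNIV] _ assms(3)]
    by blast
qed

lemma parallel_inner_const_UNIV:
  assumes "parallel_on \<sigma> UNIV V" "parallel_on \<sigma> UNIV W"
  shows "g (\<sigma> s) (V s) (W s) = g (\<sigma> t) (V t) (W t)"
proof -
  define N where "N = \<bar>s\<bar> + \<bar>t\<bar> + 1"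
  have "s \<in> {- N<..<N}" "t \<in> {- N<..<N}" unfolding N_def greaterThanLessThan_iff by linarith+
  then show ?thesis
    by (rule parallel_inner_const[OF parallel_on_subset[OF assms(1) subset_UNIV] parallel_on_subset[OF assms(2) subset_UNIV]])
qed

lemma parallel_transport_eq:
  assumes "parallel_on \<sigma> UNIV V"
  shows "parallel_transport A g \<sigma> t (V 0) = V t"
  unfolding parallel_transport_def
proof (rule the_equality)
  show "\<exists>V'. (\<forall>s. has_covd A g \<sigma> V' s 0) \<and> V' 0 = V 0 \<and> V' t = V t"
    using assms by (auto simp: parallel_on_def)
  fix w assume "\<exists>V'. (\<forall>s. has_covd A g \<sigma> V' s 0) \<and> V' 0 = V 0 \<and> V' t = w"
  then obtain V' where "parallel_on \<sigma> UNIV V'" "V' 0 = V 0" "V' t = w" by (auto simp: parallel_on_def)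
  with parallel_unique_UNIV[OF _ assms] show "w = V t" by blast
qed

lemma parallel_transport_parallel:
  "parallel_on \<sigma> UNIV (\<lambda>t. parallel_transport A g \<sigma> t w)" "parallel_transport A g \<sigma> 0 w = w"
proof -
  obtain V where V: "V 0 = w" "parallel_on \<sigma> UNIV V" using parallel_exists by blast
  have eq: "parallel_transport A g \<sigma> t w = V t" for t
    using parallel_transport_eq[OF V(2), of t] by (simp add: V(1))
  show "parallel_on \<sigma> UNIV (\<lambda>t. parallel_transport A g \<sigma> t w)" "parallel_transport A g \<sigma> 0 w = w"
    unfolding eq using V by simp_all
qed

lemma linear_parallel_transport: "linear (parallel_transport A g \<sigma> t)"
proof -
  have *: "parallel_transport A g \<sigma> t (k *\<^sub>R v + w) = k *\<^sub>R parallel_transport A g \<sigma> t v + parallel_transport A g \<sigma> t w" for k v w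
    using parallel_transport_eq[OF parallel_lincomb[OF parallel_transport_parallel(1) parallel_transport_parallel(1)], of t k v w]
    by (simp add: parallel_transport_parallel(2))
  show ?thesis
  proof (rule linearI)
    show "parallel_transport A g \<sigma> t (v + w) = parallel_transport A g \<sigma> t v + parallel_transport A g \<sigma> t w" for v w
      using *[of 1 v w] by simp
    have "parallel_transport A g \<sigma> t 0 = 0" using *[of "-1" 0 0] by simp
    then show "parallel_transport A g \<sigma> t (k *\<^sub>R v) = k *\<^sub>R parallel_transport A g \<sigma> t v" for k v
      using *[of k v 0] by simp
  qed
qed

lemma parallel_transport_isometry:
  "g (\<sigma> t) (parallel_transport A g \<sigma> t v) (parallel_transport A g \<sigma> t w) = g (\<sigma> 0) v w"
  using parallel_inner_const_UNIV[OF parallel_transport_parallel(1) parallel_transport_parallel(1), of t v w 0]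
  by (simp add: parallel_transport_parallel(2))

lemma surj_parallel_transport: "surj (parallel_transport A g \<sigma> t)"
proof (rule linear_injective_imp_surjective[OF linear_parallel_transport])
  show "inj (parallel_transport A g \<sigma> t)"
  proof (subst linear_injective_0[OF linear_parallel_transport], intro allI impI)
    fix v assume "parallel_transport A g \<sigma> t v = 0"
    then have "g (\<sigma> 0) v v = 0" using parallel_transport_isometry[of t v v] by simp
    then show "v = 0" by simp
  qed
qed simp

end
end

section \<open>The normal collar of an essential subset\<close>

locale normal_collar = riemannian A g
  for A :: "('m::t2_space, 'e::euclidean_space) chart set" and g +
  fixes K :: "'m set" and \<nu> :: "'m \<Rightarrow> 'e"
  assumes complete: "complete_metric A g"
    and essential: "essential_subset A g K \<nu>"
    and diffeo: "diffeo_between (prod_atlas real_atlas A) A ({0..} \<times> frontier K) (closure (- K))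
         (\<lambda>(r, p). normal_exp A g \<nu> r p)"
begin

abbreviation E :: "real \<Rightarrow> 'm \<Rightarrow> 'm" where "E \<equiv> normal_exp A g \<nu>"

abbreviation ray_velocity :: "'m \<Rightarrow> real \<Rightarrow> 'e" where "ray_velocity p \<equiv> velocity A (\<lambda>r. E r p)"

lemma geodesic_ray: "geodesic A g (\<lambda>r. E r p)"
  and E_0 [simp]: "E 0 p = p"
  and ray_velocity_0: "ray_velocity p 0 = \<nu> p"
proof -
  obtain \<sigma> where \<sigma>: "geodesic A g \<sigma>" "\<sigma> 0 = p" "velocity A \<sigma> 0 = \<nu> p"
    using complete unfolding complete_metric_def by blast
  have eq: "(\<lambda>r. E r p) = \<sigma>"
    by (rule ext) (rule normal_exp_eq_geodesic[where \<nu> = \<nu>, OF \<sigma>])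
  then have "E 0 p = \<sigma> 0" by (rule fun_cong)
  with eq \<sigma> show "geodesic A g (\<lambda>r. E r p)" "E 0 p = p" "ray_velocity p 0 = \<nu> p" by simp_all
qed

lemma smooth_ray: "smooth_map real_atlas A UNIV (\<lambda>r. E r p)"
  using geodesic_ray by (simp add: geodesic_def)

lemma ray_has_velocity: "has_velocity (\<lambda>r. E r p) r (ray_velocity p r)"
  by (rule geodesic_has_velocity[OF geodesic_ray])

lemma ray_velocity_parallel: "parallel_on (\<lambda>r. E r p) UNIV (ray_velocity p)"
  using geodesic_ray by (simp add: geodesic_def parallel_on_def)

lemma closed_K: "closed K"
  using essential by (simp add: essential_subset_def codim0_submanifold_def)

lemma frontier_subset_K: "frontier K \<subseteq> K"
  by (rule frontier_subset_closed[OF closed_K])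

lemma normal_unit: "p \<in> frontier K \<Longrightarrow> g p (\<nu> p) (\<nu> p) = 1"
  using essential by (simp add: essential_subset_def outward_unit_normal_def)

lemma normal_orthogonal: "p \<in> frontier K \<Longrightarrow> v \<in> bdry_tangent A K p \<Longrightarrow> g p (\<nu> p) v = 0"
  using essential by (simp add: essential_subset_def outward_unit_normal_def bdry_tangent_def)

lemma ray_unit_speed: "p \<in> frontier K \<Longrightarrow> g (E r p) (ray_velocity p r) (ray_velocity p r) = 1"
  using parallel_inner_const_UNIV[OF smooth_ray[of p] ray_velocity_parallel ray_velocity_parallel, of r 0]
  by (simp add: ray_velocity_0 normal_unit)

section \<open>Polar coordinates on the collar\<close>

definition E_inv :: "'m \<Rightarrow> real \<times> 'm" where
  "E_inv = inv_into ({0..} \<times> frontier K) (\<lambda>(r, p). E r p)"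

definition radius :: "'m \<Rightarrow> real" where "radius q = fst (E_inv q)"

definition foot :: "'m \<Rightarrow> 'm" where "foot q = snd (E_inv q)"

lemma E_bij: "bij_betw (\<lambda>(r, p). E r p) ({0..} \<times> frontier K) (closure (- K))"
  using diffeo by (simp add: diffeo_between_def)

text \<open>A point of \<open>K\<close> in the image of the collar lies on the boundary and is
  therefore also its own image at radius 0, which contradicts injectivity.\<close>

lemma E_in_complement:
  assumes p: "p \<in> frontier K" and r: "r > 0"
  shows "E r p \<in> - K"
proof
  assume K: "E r p \<in> K"
  have "E r p \<in> closure (- K)"
    using bij_betwE[OF E_bij] p r by fastforce
  then have "E r p \<in> frontier K"
    using K closed_K by (simp add: frontier_def closure_complement)
  then have "(r, p) = (0, E r p)"
    using inj_onD[OF bij_betw_imp_inj_on[OF E_bij], of "(r, p)" "(0, E r p)"] p r by simp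
  with r show False by simp
qed

lemma E_inv_E: "p \<in> frontier K \<Longrightarrow> r \<ge> 0 \<Longrightarrow> E_inv (E r p) = (r, p)"
  unfolding E_inv_def
  using inv_into_f_f[OF bij_betw_imp_inj_on[OF E_bij], of "(r, p)"] by simp

lemma radius_E: "p \<in> frontier K \<Longrightarrow> r \<ge> 0 \<Longrightarrow> radius (E r p) = r"
  and foot_E: "p \<in> frontier K \<Longrightarrow> r \<ge> 0 \<Longrightarrow> foot (E r p) = p"
  by (simp_all add: radius_def foot_def E_inv_E)

lemma closure_collar:
  assumes "q \<in> closure (- K)"
  shows "radius q \<ge> 0" "foot q \<in> frontier K" "E (radius q) (foot q) = q"
proof -
  have im: "q \<in> (\<lambda>(r, p). E r p) ` ({0..} \<times> frontier K)"
    using E_bij assms by (simp add: bij_betw_def)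
  have "E_inv q \<in> {0..} \<times> frontier K"
    unfolding E_inv_def by (rule inv_into_into[OF im])
  then show "radius q \<ge> 0" "foot q \<in> frontier K"
    by (auto simp: radius_def foot_def mem_Times_iff)
  have "(\<lambda>(r, p). E r p) (E_inv q) = q"
    unfolding E_inv_def by (rule f_inv_into_f[OF im])
  then show "E (radius q) (foot q) = q" by (simp add: radius_def foot_def split_beta)
qed

lemma complement_collar:
  assumes "q \<in> - K"
  shows "radius q > 0" "foot q \<in> frontier K" "E (radius q) (foot q) = q"
proof -
  have q: "q \<in> closure (- K)" using assms closure_subset by blast
  show "foot q \<in> frontier K" "E (radius q) (foot q) = q" using closure_collar[OF q] by auto
  then have "radius q \<noteq> 0"
    using frontier_subset_K assms by (metis ComplD E_0 subsetD)
  then show "radius q > 0" using closure_collar(1)[OF q] by simp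
qed

lemma open_complement: "open (- K)"
  using closed_K by (simp add: closed_def)

lemma prod_atlas_memI: "d \<in> A \<Longrightarrow> (UNIV \<times> fst d, map_prod id (snd d)) \<in> prod_atlas real_atlas A"
  unfolding prod_atlas_def real_atlas_def by force

lemma prod_chart_inv:
  assumes d: "d \<in> A" and y: "y \<in> snd d ` fst d"
  shows "chart_inv (UNIV \<times> fst d, map_prod id (snd d)) (r, y) = (r, chart_inv d y)"
proof -
  have "inj_on (snd d) (fst d)" using is_chart[OF d] by (simp add: is_chart_def)
  then have "inj_on (map_prod id (snd d)) (UNIV \<times> fst d)"
    by (intro map_prod_inj_on) auto
  moreover have "(r, chart_inv d y) \<in> UNIV \<times> fst d" using d y by simp
  ultimately have "inv_into (UNIV \<times> fst d) (map_prod id (snd d)) (map_prod id (snd d) (r, chart_inv d y)) = (r, chart_inv d y)"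
    by (rule inv_into_f_f)
  then show ?thesis using d y by (simp add: chart_inv_def[of "(UNIV \<times> fst d, map_prod id (snd d))"])
qed

text \<open>The local representative \<open>F\<close> is smooth also across \<open>r = 0\<close>, although \<open>E\<close> is only
  known to be smooth for \<open>r \<ge> 0\<close>.\<close>

lemma E_in_charts:
  assumes p: "p \<in> frontier K" and r0: "r0 \<ge> 0" and c: "c \<in> A" "E r0 p \<in> fst c" and d: "d \<in> A" "p \<in> fst d"
  obtains W F where "open W" "(r0, snd d p) \<in> W" "smooth_on W F"
    "\<And>r q. q \<in> frontier K \<Longrightarrow> q \<in> fst d \<Longrightarrow> r \<ge> 0 \<Longrightarrow> (r, snd d q) \<in> W \<Longrightarrow>
      E r q \<in> fst c \<and> snd c (E r q) = F (r, snd d q)"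
proof -
  let ?S = "{0..} \<times> frontier K" and ?f = "\<lambda>(r, p). E r p" and ?D = "(UNIV \<times> fst d, map_prod id (snd d)) :: (real \<times> 'm, real \<times> 'e) chart"
  have sm0: "smooth_map_on (prod_atlas real_atlas A) A ?S ?f" using diffeo by (simp add: diffeo_between_def)
  have mem: "(r0, p) \<in> ?S" using p r0 by simp
  obtain W0 h where W0: "open W0" "(r0, p) \<in> W0" "smooth_map (prod_atlas real_atlas A) A W0 h"
    "\<And>z. z \<in> ?S \<inter> W0 \<Longrightarrow> h z = ?f z"
    using bspec[OF sm0[unfolded smooth_map_on_def] mem] by (elim exE conjE) (rule that, assumption, assumption, assumption, erule bspec)
  define W where "W = snd ?D ` (fst ?D \<inter> W0 \<inter> h -` fst c)"
  define F where "F = snd c \<circ> h \<circ> chart_inv ?D"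
  have sm: "smooth_on W F"
    unfolding W_def F_def by (rule smooth_map_chart[OF W0(3) prod_atlas_memI[OF d(1)] c(1)])
  have opV: "open (W0 \<inter> h -` fst c)"
    using W0(1,3) open_chart_domain[OF is_chart[OF c(1)]] unfolding smooth_map_def
    by (intro continuous_open_preimage) auto
  \<comment> \<open>Rewriting \<open>W\<close> as a preimage under a continuous map shows that it is
    open.\<close>
  have W_eq: "W = (UNIV \<times> snd d ` fst d) \<inter> (\<lambda>z. (fst z, chart_inv d (snd z))) -` (W0 \<inter> h -` fst c)"
  proof (intro set_eqI iffI)
    fix z assume "z \<in> W"
    then obtain r q where "z = (r, snd d q)" "q \<in> fst d" "(r, q) \<in> W0 \<inter> h -` fst c" unfolding W_def by auto
    then show "z \<in> (UNIV \<times> snd d ` fst d) \<inter> (\<lambda>z. (fst z, chart_inv d (snd z))) -` (W0 \<inter> h -` fst c)"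
      using d by auto
  next
    fix z assume z: "z \<in> (UNIV \<times> snd d ` fst d) \<inter> (\<lambda>z. (fst z, chart_inv d (snd z))) -` (W0 \<inter> h -` fst c)"
    then obtain q where q: "q \<in> fst d" "snd z = snd d q" by auto
    have m1: "(fst z, q) \<in> UNIV \<times> fst d \<inter> W0 \<inter> h -` fst c" using q z d by auto
    have m2: "z = map_prod id (snd d) (fst z, q)" using q by (simp add: prod_eq_iff)
    show "z \<in> W" unfolding W_def fst_conv snd_conv by (subst m2) (rule imageI[OF m1])
  qed
  have "continuous_on (snd d ` fst d) (chart_inv d)" using is_chart[OF d(1)] by (simp add: is_chart_def)
  then have "continuous_on (UNIV \<times> snd d ` fst d) (\<lambda>z::real \<times> 'e. (fst z, chart_inv d (snd z)))"
    by (intro continuous_on_Pair continuous_on_fst continuous_on_id continuous_on_compose2[OF _ continuous_on_snd[OF continuous_on_id]]) auto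
  then have opW: "open W"
    unfolding W_eq using open_chart_range[OF is_chart[OF d(1)]]
    by (intro continuous_open_preimage opV open_Times) auto
  have rep: "E r q \<in> fst c \<and> snd c (E r q) = F (r, snd d q)"
    if q: "q \<in> frontier K" "q \<in> fst d" "r \<ge> 0" "(r, snd d q) \<in> W" for r q
  proof -
    have rq: "(r, q) \<in> W0 \<inter> h -` fst c" using q(4) q(2) d unfolding W_eq by auto
    then have "h (r, q) = E r q" using W0(4)[of "(r, q)"] q by auto
    moreover have "chart_inv ?D (r, snd d q) = (r, q)" using prod_chart_inv[OF d(1), of "snd d q" r] q d by auto
    ultimately show ?thesis using rq by (auto simp: F_def)
  qed
  have "h (r0, p) = E r0 p" using W0(2) W0(4)[of "(r0, p)"] p r0 by auto
  then have "(r0, snd d p) \<in> W" unfolding W_eq using W0(2) c d by auto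
  from opW this sm rep show thesis by (rule that)
qed

lemma E_inv_local:
  assumes q: "q \<in> closure (- K)"
  obtains W h where "open W" "q \<in> W" "smooth_map A (prod_atlas real_atlas A) W h"
    "\<And>z. z \<in> closure (- K) \<inter> W \<Longrightarrow> h z = E_inv z"
proof -
  have "smooth_map_on A (prod_atlas real_atlas A) (closure (- K)) E_inv"
    using diffeo by (simp add: diffeo_between_def E_inv_def)
  from bspec[OF this[unfolded smooth_map_on_def] q] show thesis
    by (elim exE conjE) (rule that, assumption, assumption, assumption, erule bspec)
qed

lemma continuous_E_inv: "continuous_on (closure (- K)) E_inv"
  unfolding continuous_on_eq_continuous_within
proof
  fix q assume q: "q \<in> closure (- K)"
  obtain W h where W: "open W" "q \<in> W" "smooth_map A (prod_atlas real_atlas A) W h"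
    "\<And>z. z \<in> closure (- K) \<inter> W \<Longrightarrow> h z = E_inv z"
    using E_inv_local[OF q] by blast
  have "continuous_on W h" using W(3) by (simp add: smooth_map_def)
  then have "isCont h q" using W(1,2) continuous_on_eq_continuous_at by blast
  then have "(h \<longlongrightarrow> h q) (at q within closure (- K))"
    unfolding isCont_def by (rule tendsto_within_subset) simp
  moreover have "\<forall>\<^sub>F z in at q within closure (- K). h z = E_inv z"
    unfolding eventually_at_topological using W(1,2,4) by blast
  ultimately have "(E_inv \<longlongrightarrow> h q) (at q within closure (- K))"
    by (rule Lim_transform_eventually)
  then show "continuous (at q within closure (- K)) E_inv"
    using W(4)[of q] W(2) q by (simp add: continuous_within)
qed

lemma continuous_radius: "continuous_on (closure (- K)) radius"
  unfolding radius_def by (intro continuous_on_fst continuous_E_inv)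

lemma continuous_foot: "continuous_on (closure (- K)) foot"
  unfolding foot_def by (intro continuous_on_snd continuous_E_inv)

lemma continuous_foot_complement: "continuous_on (- K) foot"
  by (rule continuous_on_subset[OF continuous_foot closure_subset])

text \<open>Outside \<open>K\<close> a local smooth extension agrees with \<open>E_inv\<close> on an
  open set, so smoothness in the two-sided sense follows.\<close>

lemma E_inv_smooth:
  assumes c: "c \<in> A" and d: "d \<in> A"
  shows "smooth_on (snd c ` (fst c \<inter> - K \<inter> foot -` fst d))
    (\<lambda>x. (radius (chart_inv c x), snd d (foot (chart_inv c x))))"
proof (rule smooth_on_local)
  fix x assume "x \<in> snd c ` (fst c \<inter> - K \<inter> foot -` fst d)"
  then obtain q where q: "x = snd c q" "q \<in> fst c" "q \<in> - K" "foot q \<in> fst d" by auto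
  have qc: "q \<in> closure (- K)" by (rule subsetD[OF closure_subset q(3)])
  obtain W h where W: "open W" "q \<in> W" "smooth_map A (prod_atlas real_atlas A) W h"
    "\<And>z. z \<in> closure (- K) \<inter> W \<Longrightarrow> h z = E_inv z"
    using E_inv_local[OF qc] by blast
  have W4: "h z = (radius z, foot z)" if "z \<in> W" "z \<in> - K" for z
    using W(4)[of z] that closure_subset[of "- K"] by (auto simp: radius_def foot_def)
  let ?D = "(UNIV \<times> fst d, map_prod id (snd d)) :: (real \<times> 'm, real \<times> 'e) chart"
  have sm: "smooth_on (snd c ` (fst c \<inter> W \<inter> h -` fst ?D)) (snd ?D \<circ> h \<circ> chart_inv c)"
    by (rule smooth_map_chart[OF W(3) c prod_atlas_memI[OF d]])
  define V where "V = W \<inter> (- K \<inter> foot -` fst d)"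
  have opV: "open V"
    unfolding V_def using open_chart_domain[OF is_chart[OF d]]
    by (intro open_Int W continuous_open_preimage[OF continuous_foot_complement open_complement])
  let ?U = "snd c ` (fst c \<inter> V)"
  have opU: "open ?U" by (rule open_chart_image[OF is_chart[OF c] opV])
  have "?U \<subseteq> snd c ` (fst c \<inter> W \<inter> h -` fst ?D)"
    using W4 by (auto simp: V_def)
  from smooth_on_subset[OF sm this]
  have "smooth_on ?U (\<lambda>x. (radius (chart_inv c x), snd d (foot (chart_inv c x))))"
  proof (subst smooth_on_cong[OF opU])
    fix x assume "x \<in> ?U"
    then obtain z where z: "x = snd c z" "z \<in> fst c" "z \<in> V" by auto
    then show "(radius (chart_inv c x), snd d (foot (chart_inv c x))) = (snd ?D \<circ> h \<circ> chart_inv c) x"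
      using W4[of z] c by (simp add: V_def)
  qed
  moreover have "x \<in> ?U" using q W(2) by (auto simp: V_def)
  ultimately show "\<exists>U. open U \<and> x \<in> U \<and> smooth_on U (\<lambda>x. (radius (chart_inv c x), snd d (foot (chart_inv c x))))"
    using opU by blast
qed

lemma open_foot_preimage: "d \<in> A \<Longrightarrow> open (- K \<inter> foot -` fst d)"
  using open_chart_domain[OF is_chart, of d]
  by (intro continuous_open_preimage[OF continuous_foot_complement open_complement]) auto

lemma open_foot_chart: "c \<in> A \<Longrightarrow> d \<in> A \<Longrightarrow> open (snd c ` (fst c \<inter> - K \<inter> foot -` fst d))"
  using open_chart_image[OF is_chart, of c] open_foot_preimage by (simp add: Int_assoc)

lemma radius_smooth:
  assumes c: "c \<in> A"
  shows "smooth_on (snd c ` (fst c \<inter> - K)) (\<lambda>x. radius (chart_inv c x))"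
proof (rule smooth_on_local)
  fix x assume "x \<in> snd c ` (fst c \<inter> - K)"
  then obtain q where q: "x = snd c q" "q \<in> fst c" "q \<in> - K" by auto
  let ?d = "chart_at A (foot q)"
  have d: "?d \<in> A" "foot q \<in> fst ?d" by auto
  have "smooth_on (snd c ` (fst c \<inter> - K \<inter> foot -` fst ?d)) (\<lambda>x. radius (chart_inv c x))"
    using smooth_on_bounded_linear_compose[OF E_inv_smooth[OF c d(1)] bounded_linear_fst open_foot_chart[OF c d(1)]]
    by simp
  moreover have "x \<in> snd c ` (fst c \<inter> - K \<inter> foot -` fst ?d)" using q d by auto
  ultimately show "\<exists>U. open U \<and> x \<in> U \<and> smooth_on U (\<lambda>x. radius (chart_inv c x))"
    using open_foot_chart[OF c d(1)] by blast
qed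

lemma foot_smooth:
  assumes c: "c \<in> A" and d: "d \<in> A"
  shows "smooth_on (snd c ` (fst c \<inter> - K \<inter> foot -` fst d)) (snd d \<circ> foot \<circ> chart_inv c)"
  using smooth_on_bounded_linear_compose[OF E_inv_smooth[OF c d] bounded_linear_snd open_foot_chart[OF c d]]
  by (simp add: o_def)

text \<open>A boundary chart flattens the boundary to a hyperplane: points with negative
  \<open>b\<close>-coordinate are interior to \<open>K\<close> by openness, and from a point with
  coordinate 0 an arbitrarily small step along \<open>b\<close> leaves \<open>K\<close>.\<close>

lemma boundary_chart:
  assumes p: "p \<in> frontier K"
  obtains c b where "smooth_atlas (insert c A)" "p \<in> fst c" "b \<noteq> 0"
    "\<And>q. q \<in> fst c \<Longrightarrow> q \<in> frontier K \<longleftrightarrow> snd c q \<bullet> b = 0"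
proof -
  have "codim0_submanifold A K" using essential by (simp add: essential_subset_def)
  then have "\<forall>p\<in>frontier K. \<exists>c\<in>maximal_atlas A. \<exists>b. b \<noteq> 0 \<and> p \<in> fst c \<and> snd c p \<bullet> b = 0 \<and>
      fst c \<inter> K = {q \<in> fst c. snd c q \<bullet> b \<le> 0}"
    unfolding codim0_submanifold_def by (elim conjE)
  from bspec[OF this p] obtain c b where c: "c \<in> maximal_atlas A" "b \<noteq> 0" "p \<in> fst c"
    "fst c \<inter> K = {q \<in> fst c. snd c q \<bullet> b \<le> 0}"
    by (elim bexE exE conjE) (rule that)
  then have atl: "smooth_atlas (insert c A)" by (simp add: maximal_atlas_def)
  then have ch: "is_chart c" by (simp add: smooth_atlas_def)
  have K_iff: "q \<in> K \<longleftrightarrow> snd c q \<bullet> b \<le> 0" if "q \<in> fst c" for q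
  proof -
    have "q \<in> fst c \<inter> K \<longleftrightarrow> q \<in> {q \<in> fst c. snd c q \<bullet> b \<le> 0}" by (simp only: c(4))
    then show ?thesis using that by simp
  qed
  have "q \<in> frontier K \<longleftrightarrow> snd c q \<bullet> b = 0" if q: "q \<in> fst c" for q
  proof
    assume fr: "q \<in> frontier K"
    then have "q \<in> K" using frontier_subset_K by blast
    then have le: "snd c q \<bullet> b \<le> 0" using K_iff[OF q] by simp
    show "snd c q \<bullet> b = 0"
    proof (rule ccontr)
      assume "snd c q \<bullet> b \<noteq> 0"
      then have lt: "snd c q \<in> {x. x \<bullet> b < 0}" using le by simp
      have "continuous_on (fst c) (snd c)" using ch by (simp add: is_chart_def)
      then have op: "open (fst c \<inter> snd c -` {x. x \<bullet> b < 0})"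
        by (rule continuous_open_preimage[OF _ open_chart_domain[OF ch]])
          (intro open_Collect_less continuous_intros)
      have "fst c \<inter> snd c -` {x. x \<bullet> b < 0} \<subseteq> K" using K_iff by auto
      then have "q \<in> interior K" using op q lt by (intro interiorI[of _ q]) auto
      then show False using fr by (simp add: frontier_def)
    qed
  next
    assume eq: "snd c q \<bullet> b = 0"
    then have qK: "q \<in> K" using K_iff[OF q] by simp
    have "q \<notin> interior K"
    proof
      assume int: "q \<in> interior K"
      have op: "open (snd c ` (fst c \<inter> interior K))" by (rule open_chart_image[OF ch open_interior])
      have "snd c q \<in> snd c ` (fst c \<inter> interior K)" using q int by auto
      then obtain e where e: "e > 0" "ball (snd c q) e \<subseteq> snd c ` (fst c \<inter> interior K)"
        using op open_contains_ball by blast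
      define s where "s = e / (2 * norm b)"
      have s: "s > 0" using e(1) c(2) by (simp add: s_def)
      have "snd c q + s *\<^sub>R b \<in> ball (snd c q) e"
        using c(2) e(1) by (simp add: s_def dist_norm)
      then have "snd c q + s *\<^sub>R b \<in> snd c ` (fst c \<inter> interior K)" using e(2) by blast
      then obtain q' where q': "q' \<in> fst c" "q' \<in> interior K" "snd c q' = snd c q + s *\<^sub>R b" by auto
      then have "q' \<in> K" using interior_subset by blast
      then have "snd c q' \<bullet> b \<le> 0" using K_iff[OF q'(1)] by simp
      then have "s * (b \<bullet> b) \<le> 0" using eq by (simp add: q'(3) inner_add_left)
      moreover have "s * (b \<bullet> b) > 0" using s c(2) by simp
      ultimately show False by simp
    qed
    then show "q \<in> frontier K" using qK closed_K by (simp add: frontier_def)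
  qed
  from atl c(3,2) this show thesis by (rule that)
qed

section \<open>The tangent space of the boundary\<close>

lemma curve_through_velocity:
  assumes "curve_through A S \<sigma> p v"
  shows "has_velocity \<sigma> 0 v" "\<sigma> 0 = p" "\<exists>\<epsilon>>0. \<forall>s. \<bar>s\<bar> < \<epsilon> \<longrightarrow> \<sigma> s \<in> S"
proof -
  obtain e where e: "e > 0" "smooth_map real_atlas A {-e<..<e} \<sigma>" "\<sigma> ` {-e<..<e} \<subseteq> S"
    and \<sigma>: "\<sigma> 0 = p" "velocity A \<sigma> 0 = v"
    using assms unfolding curve_through_def by blast
  show "has_velocity \<sigma> 0 v"
    using smooth_curve_has_velocity[OF e(2), of 0] e(1) \<sigma>(2) by simp
  show "\<sigma> 0 = p" by (rule \<sigma>(1))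
  have "\<sigma> s \<in> S" if "\<bar>s\<bar> < e" for s
    using e(3) that by (auto simp: image_subset_iff abs_less_iff)
  then show "\<exists>\<epsilon>>0. \<forall>s. \<bar>s\<bar> < \<epsilon> \<longrightarrow> \<sigma> s \<in> S" using e(1) by blast
qed

text \<open>Tangent vectors are those whose components in a boundary chart are orthogonal to
  \<open>b\<close>: along a curve in the boundary the \<open>b\<close>-coordinate vanishes, and a
  straight line orthogonal to \<open>b\<close> stays in the boundary. The normal is not among them,
  being a unit vector orthogonal to all tangent vectors.\<close>

lemma bdry_tangent_hyperplane:
  assumes p: "p \<in> frontier K"
  obtains l :: "'e \<Rightarrow> real" where "linear l" "l (\<nu> p) \<noteq> 0" "bdry_tangent A K p = {v. l v = 0}"
proof -
  obtain c b where c: "smooth_atlas (insert c A)" "p \<in> fst c" "b \<noteq> 0"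
    "\<And>q. q \<in> fst c \<Longrightarrow> q \<in> frontier K \<longleftrightarrow> snd c q \<bullet> b = 0"
    using boundary_chart[OF p] by blast
  \<comment> \<open>Adding the boundary chart to the atlas makes the rules for transition maps
    available for it, while \<open>chart_at A\<close> still chooses from \<open>A\<close>.\<close>
  interpret M: manifold "insert c A" by unfold_locales (rule c(1))
  have ch: "is_chart c" by simp
  let ?d = "chart_at A p"
  let ?C = "chart_change ?d c p" and ?C' = "chart_change c ?d p"
  have d: "?d \<in> insert c A" "p \<in> fst ?d" "c \<in> insert c A" using chart_at_in[of p] by auto
  have lin: "linear ?C" by (rule M.linear_chart_change[OF d(1,3,2) c(2)])
  define l where "l v = ?C v \<bullet> b" for v
  have CC': "?C (?C' u) = u" "?C' (?C v) = v" for u v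
    using M.chart_change_comp[of c ?d c p u] M.chart_change_comp[of ?d c ?d p v] d c(2)
    by (simp_all add: M.chart_change_self)
  have linl: "linear l" unfolding l_def using lin by (auto intro!: linearI simp: linear_add linear_cmul inner_add_left)
  have T: "bdry_tangent A K p = {v. l v = 0}"
  proof (intro set_eqI iffI)
    fix v assume "v \<in> bdry_tangent A K p"
    then obtain \<sigma> where \<sigma>: "curve_through A (frontier K) \<sigma> p v"
      by (auto simp: bdry_tangent_def tangent_space_def)
    note vel = curve_through_velocity[OF \<sigma>]
    have co: "isCont \<sigma> 0" by (rule has_velocity_isCont[OF vel(1)])
    have "(snd ?d \<circ> \<sigma> has_vector_derivative v) (at 0)" using vel(1,2) by (simp add: has_velocity_def)
    then have D: "(snd c \<circ> \<sigma> has_vector_derivative ?C v) (at 0)"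
      using M.chart_change_vector_derivative[of ?d c \<sigma> 0 v] d c(2) co vel(2) by simp
    have D1: "((\<lambda>s. (snd c \<circ> \<sigma>) s \<bullet> b) has_vector_derivative ?C v \<bullet> b) (at 0)"
      by (rule bounded_linear.has_vector_derivative[OF bounded_linear_inner_left D])
    obtain U where U: "open U" "0 \<in> U" "\<And>s. s \<in> U \<Longrightarrow> \<sigma> s \<in> fst c"
      using isCont_open_vimage[OF co open_chart_domain[OF ch]] vel(2) c(2) by blast
    obtain e where e: "e > 0" "\<And>s. \<bar>s\<bar> < e \<Longrightarrow> \<sigma> s \<in> frontier K" using vel(3) by blast
    have zero: "(snd c \<circ> \<sigma>) s \<bullet> b = 0" if "s \<in> U \<inter> {-e<..<e}" for s
    proof -
      have "\<bar>s\<bar> < e" using that by (simp add: abs_less_iff)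
      then show ?thesis using e(2)[of s] c(4)[OF U(3), of s] that by simp
    qed
    have "((\<lambda>s. 0) has_vector_derivative ?C v \<bullet> b) (at 0)"
      by (rule has_vector_derivative_transform_within_open[where S = "U \<inter> {-e<..<e}", OF D1 _ _ zero])
        (use U(1,2) e(1) in auto)
    then have "?C v \<bullet> b = 0" using vector_derivative_unique_at has_vector_derivative_const by blast
    then show "v \<in> {v. l v = 0}" by (simp add: l_def)
  next
    fix v assume v: "v \<in> {v. l v = 0}"
    define \<sigma> where "\<sigma> t = chart_inv c (snd c p + t *\<^sub>R ?C v)" for t
    have "snd c p \<in> snd c ` fst c" using c(2) by simp
    then obtain e where e: "e > 0" "ball (snd c p) e \<subseteq> snd c ` fst c"
      using open_chart_range[OF ch] open_contains_ball by blast
    \<comment> \<open>For times below this bound the line stays in the ball; the added 1 covers the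
      case \<open>?C v = 0\<close>.\<close>
    define e' where "e' = e / (norm (?C v) + 1)"
    have n: "norm (?C v) + 1 > 0" by (simp add: add_nonneg_pos)
    have e': "e' > 0" using e(1) n by (simp add: e'_def)
    have inr: "snd c p + t *\<^sub>R ?C v \<in> snd c ` fst c" if "t \<in> {-e'<..<e'}" for t
    proof -
      have "\<bar>t\<bar> < e'" using that by (simp add: abs_less_iff)
      have "\<bar>t\<bar> * norm (?C v) \<le> \<bar>t\<bar> * (norm (?C v) + 1)" by (intro mult_left_mono) auto
      also have "\<dots> < e' * (norm (?C v) + 1)" using \<open>\<bar>t\<bar> < e'\<close> n by (intro mult_strict_right_mono)
      also have "\<dots> = e" using n by (simp add: e'_def)
      finally have "snd c p + t *\<^sub>R ?C v \<in> ball (snd c p) e" by (simp add: dist_norm)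
      then show ?thesis using e(2) by blast
    qed
    have "smooth_map real_atlas A {-e'<..<e'} (\<lambda>t. (\<lambda>q. q) (chart_inv c (snd c p + t *\<^sub>R ?C v)))"
    proof (rule smooth_affine_curve[OF ch open_UNIV])
      fix d' assume "d' \<in> A"
      then show "smooth_on (snd c ` (fst c \<inter> UNIV \<inter> (\<lambda>q. q) -` fst d')) (snd d' \<circ> (\<lambda>q. q) \<circ> chart_inv c)"
        using M.smooth_transition[of c d'] by (simp add: o_def)
    qed (use inr in auto)
    then have sm: "smooth_map real_atlas A {-e'<..<e'} \<sigma>" by (simp add: \<sigma>_def[abs_def])
    have \<sigma>0: "\<sigma> 0 = p" using ch c(2) by (simp add: \<sigma>_def)
    have "\<sigma> t \<in> frontier K" if "t \<in> {-e'<..<e'}" for t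
    proof -
      have "\<sigma> t \<in> fst c" unfolding \<sigma>_def by (rule chart_inv_in[OF ch inr[OF that]])
      moreover have "snd c (\<sigma> t) \<bullet> b = snd c p \<bullet> b + t * l v"
        unfolding \<sigma>_def snd_chart_inv[OF ch inr[OF that]] by (simp add: inner_add_left l_def)
      moreover have "snd c p \<bullet> b = 0" using c(2,4) p by blast
      ultimately show ?thesis using v c(4) by simp
    qed
    moreover have "velocity A \<sigma> 0 = v"
    proof -
      have hv: "has_velocity \<sigma> 0 (velocity A \<sigma> 0)" using smooth_curve_has_velocity[OF sm, of 0] e' by simp
      then have D: "(snd ?d \<circ> \<sigma> has_vector_derivative velocity A \<sigma> 0) (at 0)" by (simp add: has_velocity_def \<sigma>0)
      have L: "((\<lambda>t. snd c p + t *\<^sub>R ?C v) has_vector_derivative ?C v) (at 0)"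
        by (auto intro!: derivative_eq_intros)
      have "(snd c \<circ> \<sigma> has_vector_derivative ?C v) (at 0)"
        by (rule has_vector_derivative_transform_within_open[OF L, of "{-e'<..<e'}"])
          (use e' inr ch in \<open>auto simp: \<sigma>_def\<close>)
      from M.chart_change_vector_derivative[of c ?d \<sigma> 0, OF _ _ _ _ has_velocity_isCont[OF hv] this]
      have "(snd ?d \<circ> \<sigma> has_vector_derivative ?C' (?C v)) (at 0)" using d c(2) by (simp add: \<sigma>0)
      with D show ?thesis using vector_derivative_unique_at CC'(2) by metis
    qed
    ultimately have "curve_through A (frontier K) \<sigma> p v"
      unfolding curve_through_def using sm e' \<sigma>0 by blast
    then show "v \<in> bdry_tangent A K p" by (auto simp: bdry_tangent_def tangent_space_def)
  qed
  have l\<nu>: "l (\<nu> p) \<noteq> 0"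
  proof
    assume "l (\<nu> p) = 0"
    then have "\<nu> p \<in> bdry_tangent A K p" using T by simp
    then have "g p (\<nu> p) (\<nu> p) = 0" by (rule normal_orthogonal[OF p])
    then show False using normal_unit[OF p] by simp
  qed
  show thesis by (rule that[OF linl l\<nu> T])
qed

lemma subspace_bdry_tangent: "p \<in> frontier K \<Longrightarrow> subspace (bdry_tangent A K p)"
  by (elim bdry_tangent_hyperplane) (auto simp: subspace_def linear_add linear_cmul linear_0)

text \<open>One hyperplane contained in another equals it: a vector orthogonal to the normal becomes
  tangent after subtracting a multiple of the normal, and orthogonality forces that multiple to be
  0.\<close>

lemma bdry_tangent_iff:
  assumes p: "p \<in> frontier K"
  shows "v \<in> bdry_tangent A K p \<longleftrightarrow> g p (\<nu> p) v = 0"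
proof
  assume v: "g p (\<nu> p) v = 0"
  obtain l :: "'e \<Rightarrow> real" where l: "linear l" "l (\<nu> p) \<noteq> 0" "bdry_tangent A K p = {v. l v = 0}"
    by (rule bdry_tangent_hyperplane[OF p])
  define k where "k = l v / l (\<nu> p)"
  have "l (v - k *\<^sub>R \<nu> p) = 0" using l(2) by (simp add: linear_diff[OF l(1)] linear_cmul[OF l(1)] k_def)
  then have "v - k *\<^sub>R \<nu> p \<in> bdry_tangent A K p" by (simp add: l(3))
  then have "g p (\<nu> p) (v - k *\<^sub>R \<nu> p) = 0" by (rule normal_orthogonal[OF p])
  then have "k = 0" using v normal_unit[OF p] by simp
  then show "v \<in> bdry_tangent A K p" using l(2,3) by (simp add: k_def)
qed (rule normal_orthogonal[OF p])

section \<open>The differential of the normal exponential map\<close>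

lemma d_exp_in_charts:
  assumes p: "p \<in> frontier K" and r: "r \<ge> 0" and c: "c \<in> A" "E r p \<in> fst c" and d: "d \<in> A" "p \<in> fst d"
    and W: "open W" "(r, snd d p) \<in> W" "smooth_on W F"
    and F: "\<And>q. q \<in> frontier K \<Longrightarrow> q \<in> fst d \<Longrightarrow> (r, snd d q) \<in> W \<Longrightarrow> E r q \<in> fst c \<and> snd c (E r q) = F (r, snd d q)"
    and v: "v \<in> bdry_tangent A K p"
  shows "coord A c (E r p) (d_exp A g K \<nu> r p v) = frechet_derivative F (at (r, snd d p)) (0, coord A d p v)"
proof -
  let ?w = "frechet_derivative F (at (r, snd d p)) (0, coord A d p v)"
  \<comment> \<open>\<open>differential\<close> describes the common velocity of the images of all
    curves with velocity \<open>v\<close>, so this velocity has to be computed for each of them and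
    seen not to depend on the curve.\<close>
  have vel: "velocity A (E r \<circ> \<sigma>) 0 = vec A c (E r p) ?w" if "curve_through A (frontier K) \<sigma> p v" for \<sigma>
  proof -
    note ct = curve_through_velocity[OF that]
    have co: "isCont \<sigma> 0" by (rule has_velocity_isCont[OF ct(1)])
    have "\<sigma> 0 \<in> fst d" using ct(2) d(2) by simp
    then obtain U where U: "open U" "0 \<in> U" "\<And>s. s \<in> U \<Longrightarrow> \<sigma> s \<in> fst d"
      using isCont_open_vimage[OF co open_chart_domain[OF is_chart[OF d(1)]]] by blast
    obtain e where e: "e > 0" "\<And>s. \<bar>s\<bar> < e \<Longrightarrow> \<sigma> s \<in> frontier K" using ct(3) by blast
    have y': "((\<lambda>s. snd d (\<sigma> s)) has_vector_derivative coord A d p v) (at 0)"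
      using has_velocity_chart[OF ct(1) d(1) \<open>\<sigma> 0 \<in> fst d\<close>] ct(2) by (simp add: o_def)
    have z': "((\<lambda>s. (r, snd d (\<sigma> s))) has_vector_derivative (0, coord A d p v)) (at 0)"
      by (intro has_vector_derivative_Pair has_vector_derivative_const y')
    have F': "(F has_derivative frechet_derivative F (at (r, snd d p))) (at (r, snd d (\<sigma> 0)))"
      using smooth_on_has_derivative[OF W(3,2)] ct(2) by simp
    have D: "((\<lambda>s. F (r, snd d (\<sigma> s))) has_vector_derivative ?w) (at 0)"
      by (rule has_vector_derivative_compose_derivative[where x = "\<lambda>s. (r, snd d (\<sigma> s))", OF F' z'])
    have "isCont (\<lambda>s. (r, snd d (\<sigma> s))) 0"
      using z' has_vector_derivative_continuous by blast
    then obtain U' where U': "open U'" "0 \<in> U'" "\<And>s. s \<in> U' \<Longrightarrow> (r, snd d (\<sigma> s)) \<in> W"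
      using isCont_open_vimage[where f = "\<lambda>s. (r, snd d (\<sigma> s))" and t = 0 and U = W] W(1,2) ct(2) by auto
    let ?N = "U \<inter> U' \<inter> {-e<..<e}"
    have N: "open ?N" "0 \<in> ?N" using U U' e(1) by auto
    have rep: "E r (\<sigma> s) \<in> fst c \<and> snd c (E r (\<sigma> s)) = F (r, snd d (\<sigma> s))" if "s \<in> ?N" for s
      using that U(3) U'(3) e(2)[of s] by (intro F) (auto simp: abs_less_iff)
    have "isCont (\<lambda>s. F (r, snd d (\<sigma> s))) 0" using D has_vector_derivative_continuous by blast
    moreover have "F (r, snd d (\<sigma> 0)) = snd c (E r p)" using rep[OF N(2)] ct(2) by simp
    ultimately have cF: "isCont (\<lambda>s. chart_inv c (F (r, snd d (\<sigma> s)))) 0"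
      using c isCont_chart_inv[OF is_chart[OF c(1)], of "snd c (E r p)"]
      by (intro isCont_o2[where f = "\<lambda>s. F (r, snd d (\<sigma> s))" and g = "chart_inv c"]) auto
    have "chart_inv c (F (r, snd d (\<sigma> s))) = (E r \<circ> \<sigma>) s" if "s \<in> ?N" for s
      using rep[OF that] c by (simp add: conjunct2[OF rep[OF that], symmetric])
    then have ev: "\<forall>\<^sub>F s in nhds 0. chart_inv c (F (r, snd d (\<sigma> s))) = (E r \<circ> \<sigma>) s"
      using N unfolding eventually_nhds by blast
    have co': "isCont (E r \<circ> \<sigma>) 0" using cF isCont_cong[OF ev] by (rule iffD1[rotated])
    have "(snd c \<circ> (E r \<circ> \<sigma>) has_vector_derivative ?w) (at 0)"
      by (rule has_vector_derivative_transform_within_open[OF D N]) (use rep in auto)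
    from has_velocityI[OF co' c(1) _ this] have "has_velocity (E r \<circ> \<sigma>) 0 (vec A c (E r p) ?w)"
      using ct(2) c(2) by simp
    then show ?thesis by (rule has_velocity_velocity)
  qed
  obtain \<sigma> where \<sigma>: "curve_through A (frontier K) \<sigma> p v"
    using v by (auto simp: bdry_tangent_def tangent_space_def)
  have "d_exp A g K \<nu> r p v = vec A c (E r p) ?w"
    unfolding d_exp_def differential_def
  proof (rule the_equality)
    show "\<exists>\<sigma>. curve_through A (frontier K) \<sigma> p v \<and> vec A c (E r p) ?w = velocity A (E r \<circ> \<sigma>) 0"
      using \<sigma> vel[OF \<sigma>] by auto
  qed (use vel in auto)
  then show ?thesis using c by simp
qed

text \<open>\<open>F\<close> represents \<open>E\<close> for nonnegative times only, so the two
  derivatives are compared within \<open>{0..}\<close>. They are still determined there, even at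
  \<open>r = 0\<close>, because \<open>r\<close> is a limit point of that set.\<close>

lemma ray_velocity_in_charts:
  assumes p: "p \<in> frontier K" and r: "r \<ge> 0" and c: "c \<in> A" "E r p \<in> fst c"
    and W: "open W" "(r, y0) \<in> W" "smooth_on W F"
    and F: "\<And>s. s \<ge> 0 \<Longrightarrow> (s, y0) \<in> W \<Longrightarrow> snd c (E s p) = F (s, y0)"
  shows "coord A c (E r p) (ray_velocity p r) = frechet_derivative F (at (r, y0)) (1, 0)"
proof -
  have "((\<lambda>s. (s, y0)) has_vector_derivative (1, 0)) (at r)"
    by (intro has_vector_derivative_Pair has_vector_derivative_const has_vector_derivative_id)
  from has_vector_derivative_compose_derivative[where x = "\<lambda>s. (s, y0)", OF smooth_on_has_derivative[OF W(3,2)] this]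
  have D: "((\<lambda>s. F (s, y0)) has_vector_derivative frechet_derivative F (at (r, y0)) (1, 0)) (at r within {0..})"
    by (rule has_vector_derivative_at_within)
  have D': "((\<lambda>s. snd c (E s p)) has_vector_derivative coord A c (E r p) (ray_velocity p r)) (at r within {0..})"
    using has_velocity_chart[OF ray_has_velocity c]
    by (auto intro: has_vector_derivative_at_within simp: o_def)
  have "continuous_on UNIV (\<lambda>s::real. (s, y0))" by (intro continuous_intros)
  then have opS: "open ((\<lambda>s. (s, y0)) -` W)" using W(1) by (rule open_vimage[rotated])
  then obtain e where e: "e > 0" "\<And>s. dist s r < e \<Longrightarrow> (s, y0) \<in> W"
    using W(2) unfolding open_dist by auto
  have "((\<lambda>s. snd c (E s p)) has_vector_derivative frechet_derivative F (at (r, y0)) (1, 0)) (at r within {0..})"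
    by (rule has_vector_derivative_transform_within[OF D e(1)]) (use r e(2) F in auto)
  moreover have "at r within {0..} \<noteq> bot"
  proof -
    have "r islimpt {0..}" by (rule islimpt_subset[of r "{r..r+1}"]) (use r in \<open>auto simp: islimpt_Icc\<close>)
    then show ?thesis by (simp add: trivial_limit_within)
  qed
  ultimately show ?thesis using D' vector_derivative_unique_within by blast
qed

lemma metric_rep_unit_speed:
  assumes q: "q \<in> frontier K" and r: "r \<ge> 0" and c: "c \<in> A" "E r q \<in> fst c"
    and W: "open W" "(r, y) \<in> W" "smooth_on W F"
    and F: "\<And>s. s \<ge> 0 \<Longrightarrow> (s, y) \<in> W \<Longrightarrow> snd c (E s q) = F (s, y)"
  shows "metric_rep A g c (F (r, y)) (frechet_derivative F (at (r, y)) (1, 0)) (frechet_derivative F (at (r, y)) (1, 0)) = 1"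
  using ray_unit_speed[OF q, of r] F[OF r W(2), symmetric]
    ray_velocity_in_charts[OF q r c W F] g_eq_metric_rep[OF c, of "ray_velocity q r" "ray_velocity q r"]
  by simp

lemma chris_sym: "c \<in> A \<Longrightarrow> x \<in> snd c ` fst c \<Longrightarrow> chris c x u v = chris c x v u"
  by (rule metric_rep_eqI[of c x]) (simp_all add: metric_rep_chris koszul_def dmetric_sym[of c x _ u v] add.commute)

text \<open>The Gauss lemma. With \<open>a = \<partial>\<^sub>r\<close> and \<open>b = d\<E>\<^sub>r v\<close>, torsion-freeness turns \<open>g(a, \<nabla>\<^sub>r b)\<close> into
  \<open>g(a, \<nabla>\<^sub>v a)\<close>, half the derivative of \<open>g(a, a) = 1\<close> along \<open>v\<close>.\<close>

lemma gauss_derivative: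
  assumes p: "p \<in> frontier K" and v: "v \<in> bdry_tangent A K p" and r: "r \<ge> 0"
  shows "((\<lambda>s. g (E s p) (ray_velocity p s) (d_exp A g K \<nu> s p v)) has_vector_derivative 0) (at r within {0..})"
proof -
  define c where "c = chart_at A (E r p)"
  define d where "d = chart_at A p"
  have c: "c \<in> A" "E r p \<in> fst c" and d: "d \<in> A" "p \<in> fst d" by (simp_all add: c_def d_def)
  obtain W F where W: "open W" "(r, snd d p) \<in> W" "smooth_on W F"
    and F: "\<And>s q. q \<in> frontier K \<Longrightarrow> q \<in> fst d \<Longrightarrow> s \<ge> 0 \<Longrightarrow> (s, snd d q) \<in> W \<Longrightarrow>
      E s q \<in> fst c \<and> snd c (E s q) = F (s, snd d q)"
    using E_in_charts[OF p r c d] by metis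
  define y0 where "y0 = snd d p"
  define u where "u = coord A d p v"
  let ?D = "\<lambda>z. frechet_derivative F (at z)"
  let ?z0 = "(r, y0)"
  let ?a = "?D ?z0 (1, 0)" and ?b = "?D ?z0 (0, u)"
  let ?m = "frechet_derivative (\<lambda>z. ?D z (0, u)) (at ?z0) (1, 0)"
  have W0: "?z0 \<in> W" using W(2) by (simp add: y0_def)
  have x0: "F ?z0 = snd c (E r p)" using F[OF p d(2) r W(2)] by (simp add: y0_def)
  then have xin: "F ?z0 \<in> snd c ` fst c" using c(2) by simp
  let ?G = "metric_rep A g c (F ?z0)"
  have D2: "((\<lambda>z. ?D z w) has_derivative frechet_derivative (\<lambda>z. ?D z w) (at ?z0)) (at ?z0)" for w
    by (rule smooth_on_has_derivative[OF smooth_on_deriv[OF W(3)] W0])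
  \<comment> \<open>Torsion-freeness: symmetry of the second derivatives of \<open>F\<close> is the
    coordinate form of \<nabla>_r b = \<nabla>_v a.\<close>
  have sym: "frechet_derivative (\<lambda>z. ?D z (1, 0)) (at ?z0) (0, u) = ?m"
    by (rule frechet_derivative_symmetric[OF W(3,1) W0])

  have line: "((\<lambda>s. (s, y0)) has_vector_derivative (1, 0)) (at r)"
    by (intro has_vector_derivative_Pair has_vector_derivative_const has_vector_derivative_id)
  have rep: "coord A c (E s p) (ray_velocity p s) = ?D (s, y0) (1, 0)"
    "coord A c (E s p) (d_exp A g K \<nu> s p v) = ?D (s, y0) (0, u)" "E s p \<in> fst c" "snd c (E s p) = F (s, y0)"
    if s: "s \<ge> 0" "(s, y0) \<in> W" for s
  proof -
    have inW: "(s, snd d p) \<in> W" using s(2) by (simp add: y0_def)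
    show Ec: "E s p \<in> fst c" "snd c (E s p) = F (s, y0)"
      using F[OF p d(2) s(1) inW] by (simp_all add: y0_def)
    show "coord A c (E s p) (ray_velocity p s) = ?D (s, y0) (1, 0)"
      by (rule ray_velocity_in_charts[OF p s(1) c(1) Ec(1) W(1) s(2) W(3)])
        (use F[OF p d(2)] in \<open>auto simp: y0_def\<close>)
    show "coord A c (E s p) (d_exp A g K \<nu> s p v) = ?D (s, y0) (0, u)"
      using d_exp_in_charts[OF p s(1) c(1) Ec(1) d W(1) inW W(3) F v] s(1) by (simp add: y0_def u_def)
  qed
  have x': "((\<lambda>s. F (s, y0)) has_vector_derivative ?a) (at r)"
    by (rule has_vector_derivative_compose_derivative[where x = "\<lambda>s. (s, y0)", OF smooth_on_has_derivative[OF W(3) W0] line])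
  have b': "((\<lambda>s. ?D (s, y0) (0, u)) has_vector_derivative ?m) (at r)"
    by (rule has_vector_derivative_compose_derivative[where x = "\<lambda>s. (s, y0)", OF D2 line])
  have a'0: "((\<lambda>s. ?D (s, y0) (1, 0)) has_vector_derivative frechet_derivative (\<lambda>z. ?D z (1, 0)) (at ?z0) (1, 0)) (at r)"
    by (rule has_vector_derivative_compose_derivative[where x = "\<lambda>s. (s, y0)", OF D2 line])
  have "continuous_on UNIV (\<lambda>s::real. (s, y0))" by (intro continuous_intros)
  then have opS: "open ((\<lambda>s. (s, y0)) -` W)" using W(1) by (rule open_vimage[rotated])
  then obtain e where e: "e > 0" "\<And>s. dist s r < e \<Longrightarrow> (s, y0) \<in> W"
    using W0 unfolding open_dist by auto
  have lim: "at r within {0..} \<noteq> bot"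
  proof -
    have "r islimpt {0..}" by (rule islimpt_subset[of r "{r..r+1}"]) (use r in \<open>auto simp: islimpt_Icc\<close>)
    then show ?thesis by (simp add: trivial_limit_within)
  qed
  have "((\<lambda>s. coord A c (E s p) (ray_velocity p s)) has_vector_derivative - chris c (F ?z0) ?a ?a) (at r within {0..})"
    using geodesic_chart_velocity[OF geodesic_ray c] rep(1,4)[OF r W0]
    by (auto intro: has_vector_derivative_at_within)
  moreover have "((\<lambda>s. coord A c (E s p) (ray_velocity p s)) has_vector_derivative
      frechet_derivative (\<lambda>z. ?D z (1, 0)) (at ?z0) (1, 0)) (at r within {0..})"
    by (rule has_vector_derivative_transform_within[OF has_vector_derivative_at_within[OF a'0] e(1)])
      (use r e(2) rep(1) in auto)
  \<comment> \<open>The geodesic equation expressed through the second radial derivative of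
    \<open>F\<close>.\<close>
  ultimately have acc: "frechet_derivative (\<lambda>z. ?D z (1, 0)) (at ?z0) (1, 0) = - chris c (F ?z0) ?a ?a"
    using lim vector_derivative_unique_within by blast
  note a' = a'0[unfolded acc]

  obtain \<sigma> where \<sigma>: "curve_through A (frontier K) \<sigma> p v"
    using v by (auto simp: bdry_tangent_def tangent_space_def)
  note ct = curve_through_velocity[OF \<sigma>]
  have co: "isCont \<sigma> 0" by (rule has_velocity_isCont[OF ct(1)])
  have \<sigma>0: "\<sigma> 0 \<in> fst d" using ct(2) d(2) by simp
  obtain U where U: "open U" "0 \<in> U" "\<And>s. s \<in> U \<Longrightarrow> \<sigma> s \<in> fst d"
    using isCont_open_vimage[OF co open_chart_domain[OF is_chart[OF d(1)]] \<sigma>0] by blast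
  obtain e' where e': "e' > 0" "\<And>s. \<bar>s\<bar> < e' \<Longrightarrow> \<sigma> s \<in> frontier K" using ct(3) by blast
  let ?y = "\<lambda>s. (r, snd d (\<sigma> s))"
  have y0: "?y 0 = ?z0" using ct(2) by (simp add: y0_def)
  have "((\<lambda>s. snd d (\<sigma> s)) has_vector_derivative u) (at 0)"
    using has_velocity_chart[OF ct(1) d(1) \<sigma>0] ct(2) by (simp add: o_def u_def)
  then have y': "(?y has_vector_derivative (0, u)) (at 0)"
    by (intro has_vector_derivative_Pair has_vector_derivative_const)
  then have "isCont ?y 0" using has_vector_derivative_continuous by blast
  moreover have "?y 0 \<in> W" using y0 W0 by simp
  ultimately obtain U' where U': "open U'" "0 \<in> U'" "\<And>s. s \<in> U' \<Longrightarrow> ?y s \<in> W"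
    using isCont_open_vimage[where f = ?y and t = 0 and U = W] W(1) by blast
  let ?N = "U \<inter> U' \<inter> {-e'<..<e'}"
  have N: "open ?N" "0 \<in> ?N" using U U' e'(1) by auto
  have unit: "metric_rep A g c (F (?y s)) (?D (?y s) (1, 0)) (?D (?y s) (1, 0)) = 1" if s: "s \<in> ?N" for s
  proof -
    have q: "\<sigma> s \<in> frontier K" "\<sigma> s \<in> fst d" "?y s \<in> W"
      using s U(3) U'(3) e'(2)[of s] by (auto simp: abs_less_iff)
    show ?thesis
      using metric_rep_unit_speed[OF q(1) r c(1) conjunct1[OF F[OF q(1,2) r q(3)]] W(1) q(3) W(3)] F[OF q(1,2)] by blast
  qed
  have F'z: "(F has_derivative ?D ?z0) (at (?y 0))"
    unfolding y0 by (rule smooth_on_has_derivative[OF W(3) W0])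
  have D2': "((\<lambda>z. ?D z (1, 0)) has_derivative frechet_derivative (\<lambda>z. ?D z (1, 0)) (at ?z0)) (at (?y 0))"
    unfolding y0 by (rule D2)
  have Fy': "((\<lambda>s. F (?y s)) has_vector_derivative ?b) (at 0)"
    by (rule has_vector_derivative_compose_derivative[where x = ?y, OF F'z y'])
  have Dy': "((\<lambda>s. ?D (?y s) (1, 0)) has_vector_derivative ?m) (at 0)"
    using has_vector_derivative_compose_derivative[where x = ?y, OF D2' y'] by (simp only: sym)
  have xin': "F (?y 0) \<in> snd c ` fst c" using xin by (simp only: y0)
  \<comment> \<open>Unit speed differentiated along the boundary curve \<open>\<sigma>\<close> at
    fixed \<open>r\<close>: the three terms of the product rule add up to the derivative of a
    constant.\<close>
  have "((\<lambda>s. 1) has_vector_derivative (dmetric c (F ?z0) ?b ?a ?a + ?G ?m ?a + ?G ?a ?m)) (at 0)"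
    using has_vector_derivative_transform_within_open[OF metric_rep_curve_derivative[OF c(1) xin' Fy' Dy' Dy'] N unit]
    by (simp only: y0)
  then have "dmetric c (F ?z0) ?b ?a ?a + ?G ?m ?a + ?G ?a ?m = 0"
    using vector_derivative_unique_at has_vector_derivative_const by blast
  then have am: "?G ?a ?m = - dmetric c (F ?z0) ?b ?a ?a / 2"
    using metric_rep_sym[of c "F ?z0" ?m ?a] by simp

  note bil = metric_rep_bilinear[OF c(1) xin]
  \<comment> \<open>The radial derivative of g(a, b). Metric compatibility splits the first summand
    into two Christoffel terms: one cancels against the acceleration, the other against
    \<open>am\<close> by symmetry of the Christoffel symbols.\<close>
  have "dmetric c (F ?z0) ?a ?a ?b + ?G (- chris c (F ?z0) ?a ?a) ?b + ?G ?a ?m = 0"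
    unfolding am dmetric_eq_chris[OF c(1) xin]
    using metric_rep_sym[of c "F ?z0" ?a "chris c (F ?z0) ?b ?a"] chris_sym[OF c(1) xin, of ?a ?b]
    by (simp add: bilinear_lneg[OF bil])
  then have "((\<lambda>s. metric_rep A g c (F (s, y0)) (?D (s, y0) (1, 0)) (?D (s, y0) (0, u))) has_vector_derivative 0) (at r)"
    using metric_rep_curve_derivative[where x = "\<lambda>s. F (s, y0)", OF c(1) xin x' a' b'] by simp
  then show ?thesis
    by (rule has_vector_derivative_transform_within[OF has_vector_derivative_at_within e(1)])
      (use r e(2) rep g_eq_metric_rep[OF c(1)] in auto)
qed

lemma d_exp_0:
  assumes p: "p \<in> frontier K" and v: "v \<in> bdry_tangent A K p"
  shows "d_exp A g K \<nu> 0 p v = v"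
proof -
  have E0: "E 0 \<circ> \<sigma> = \<sigma>" for \<sigma> :: "real \<Rightarrow> 'm" by (simp add: fun_eq_iff)
  obtain \<sigma> where \<sigma>: "curve_through A (frontier K) \<sigma> p v"
    using v by (auto simp: bdry_tangent_def tangent_space_def)
  show ?thesis
    unfolding d_exp_def differential_def E0
    by (rule the_equality) (use \<sigma> curve_through_velocity(1) has_velocity_velocity in blast)+
qed

text \<open>The inner product is constant in \<open>r\<close>, and at radius 0 it is that of the
  normal with a tangent vector.\<close>

lemma gauss:
  assumes p: "p \<in> frontier K" and v: "v \<in> bdry_tangent A K p" and r: "r \<ge> 0"
  shows "g (E r p) (ray_velocity p r) (d_exp A g K \<nu> r p v) = 0"
proof -
  obtain k where k: "\<And>s. s \<in> {0..} \<Longrightarrow> g (E s p) (ray_velocity p s) (d_exp A g K \<nu> s p v) = k"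
    using has_vector_derivative_zero_constant[of "{0::real..}", OF _ gauss_derivative[OF p v]] by auto
  have "k = g p (\<nu> p) v" using k[of 0] d_exp_0[OF p v] by (simp add: ray_velocity_0)
  then show ?thesis using k[of r] r normal_orthogonal[OF p v] by simp
qed

end

section \<open>The norm of the metric and the speed of curves\<close>

context riemannian
begin

lemma g_cauchy_schwarz: "\<bar>g p u v\<bar> \<le> gnorm g p u * gnorm g p v"
proof (cases "v = 0")
  case False
  then have pos: "g p v v > 0" by (rule g_pos)
  define k where "k = g p u v / g p v v"
  have "0 \<le> g p (u - k *\<^sub>R v) (u - k *\<^sub>R v)" by (rule g_nonneg)
  also have "\<dots> = g p u u - k * g p u v - k * g p v u + k * k * g p v v"
    by (simp add: algebra_simps)
  also have "\<dots> = g p u u - 2 * k * g p u v + k * k * g p v v"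
    unfolding g_sym[of p v u] by simp
  also have "\<dots> = g p u u - (g p u v)\<^sup>2 / g p v v"
    using pos by (simp add: k_def power2_eq_square field_simps)
  finally have "(g p u v)\<^sup>2 \<le> g p u u * g p v v" using pos by (simp add: field_simps)
  then have "sqrt ((g p u v)\<^sup>2) \<le> sqrt (g p u u * g p v v)" by (rule real_sqrt_le_mono)
  then show ?thesis by (simp add: gnorm_def real_sqrt_mult)
qed simp

lemma gnorm_triangle: "gnorm g p (u + v) \<le> gnorm g p u + gnorm g p v"
proof (rule power2_le_imp_le)
  have "(gnorm g p (u + v))\<^sup>2 = g p u u + g p u v + g p v u + g p v v"
    by (simp add: gnorm_sq)
  also have "\<dots> = g p u u + 2 * g p u v + g p v v"
    unfolding g_sym[of p v u] by simp
  also have "\<dots> \<le> g p u u + 2 * (gnorm g p u * gnorm g p v) + g p v v"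
    using g_cauchy_schwarz[of p u v] by simp
  also have "\<dots> = (gnorm g p u + gnorm g p v)\<^sup>2"
    by (simp add: power2_sum gnorm_sq)
  finally show "(gnorm g p (u + v))\<^sup>2 \<le> (gnorm g p u + gnorm g p v)\<^sup>2" .
qed simp

lemma gnorm_scale: "gnorm g p (k *\<^sub>R v) = \<bar>k\<bar> * gnorm g p v"
  by (simp add: gnorm_def real_sqrt_mult flip: mult.assoc)

lemma g_coercive: "\<exists>m>0. \<forall>v. m * (norm v)\<^sup>2 \<le> g p v v"
  using positive_definite_uniform_bound[of "{0::real}" "\<lambda>_. g p"] g_bilinear g_pos by auto

text \<open>Limits are taken in the topology of the model space, while the hypotheses measure in
  \<open>g\<close>. This comparison and its converse pass between the two.\<close>

lemma norm_le_gnorm: "\<exists>C\<ge>0. \<forall>v. norm v \<le> C * gnorm g p v"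
proof -
  obtain m where m: "m > 0" "\<And>v. m * (norm v)\<^sup>2 \<le> g p v v" using g_coercive by blast
  have "norm v \<le> sqrt (1 / m) * gnorm g p v" for v
  proof (rule power2_le_imp_le)
    show "(norm v)\<^sup>2 \<le> (sqrt (1 / m) * gnorm g p v)\<^sup>2"
      using m by (simp add: power_mult_distrib gnorm_sq field_simps)
  qed (use m in simp)
  then show ?thesis using m by (intro exI[of _ "sqrt (1 / m)"]) auto
qed

lemma gnorm_le_norm: "\<exists>C\<ge>0. \<forall>v. gnorm g p v \<le> C * norm v"
proof -
  define B where "B = (\<Sum>i\<in>(Basis :: 'e set). \<Sum>j\<in>(Basis :: 'e set). norm (g p i j))"
  have B: "B \<ge> 0" unfolding B_def by (intro sum_nonneg) auto
  have "gnorm g p v \<le> sqrt B * norm v" for v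
  proof (rule power2_le_imp_le)
    have "g p v v \<le> B * (norm v * norm v)"
      using bilinear_bound_Basis[OF g_bilinear, of p v v] unfolding B_def by simp
    then show "(gnorm g p v)\<^sup>2 \<le> (sqrt B * norm v)\<^sup>2"
      unfolding power_mult_distrib gnorm_sq using B by (simp add: power2_eq_square[of "norm v"])
  qed (use B in simp)
  then show ?thesis using B by (intro exI[of _ "sqrt B"]) auto
qed

lemma gnorm_neg: "gnorm g q (- v) = gnorm g q v"
  by (simp add: gnorm_def)

lemma gnorm_tendsto_iff: "(f \<longlongrightarrow> l) Fl \<longleftrightarrow> ((\<lambda>x. gnorm g q (f x - l)) \<longlongrightarrow> 0) Fl"
proof
  assume "(f \<longlongrightarrow> l) Fl"
  then have n: "((\<lambda>x. norm (f x - l)) \<longlongrightarrow> 0) Fl" by (simp add: tendsto_norm_zero_iff LIM_zero_iff)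
  obtain C where C: "C \<ge> 0" "\<And>v. gnorm g q v \<le> C * norm v" using gnorm_le_norm by blast
  show "((\<lambda>x. gnorm g q (f x - l)) \<longlongrightarrow> 0) Fl"
    by (rule Lim_null_comparison[OF _ tendsto_mult_right_zero[OF n, of C]]) (use C in auto)
next
  assume n: "((\<lambda>x. gnorm g q (f x - l)) \<longlongrightarrow> 0) Fl"
  obtain C where C: "C \<ge> 0" "\<And>v. norm v \<le> C * gnorm g q v" using norm_le_gnorm by blast
  have "((\<lambda>x. f x - l) \<longlongrightarrow> 0) Fl"
    by (rule Lim_null_comparison[OF _ tendsto_mult_right_zero[OF n, of C]]) (use C in auto)
  then show "(f \<longlongrightarrow> l) Fl" by (rule LIM_zero_cancel)
qed

lemma gnorm_tendsto: "(f \<longlongrightarrow> l) Fl \<Longrightarrow> ((\<lambda>x. gnorm g q (f x)) \<longlongrightarrow> gnorm g q l) Fl"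
proof -
  assume f: "(f \<longlongrightarrow> l) Fl"
  have "\<bar>gnorm g q u - gnorm g q v\<bar> \<le> gnorm g q (u - v)" for u v
    using gnorm_triangle[of q "u - v" v] gnorm_triangle[of q "- (u - v)" u] by (simp add: gnorm_neg del: minus_diff_eq)
  then have "((\<lambda>x. gnorm g q (f x) - gnorm g q l) \<longlongrightarrow> 0) Fl"
    by (intro Lim_null_comparison[OF _ f[unfolded gnorm_tendsto_iff[of _ _ _ q]]]) auto
  then show ?thesis by (rule LIM_zero_cancel)
qed

lemma coord_velocity_eq:
  assumes sm: "smooth_map real_atlas A W \<sigma>" and W: "open W" "t \<in> W" and c: "c \<in> A" "\<sigma> t \<in> fst c"
  shows "coord A c (\<sigma> t) (velocity A \<sigma> t) = frechet_derivative (snd c \<circ> \<sigma>) (at t) 1"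
proof -
  have "(snd c \<circ> \<sigma> has_derivative frechet_derivative (snd c \<circ> \<sigma>) (at t)) (at t)"
    using smooth_on_has_derivative[OF smooth_curve_smooth_on[OF sm c(1)]] W c by blast
  moreover have "(snd c \<circ> \<sigma> has_derivative (\<lambda>h. h *\<^sub>R coord A c (\<sigma> t) (velocity A \<sigma> t))) (at t)"
    using has_velocity_chart[OF smooth_curve_has_velocity[OF sm W] c] by (simp add: has_vector_derivative_def)
  ultimately have "frechet_derivative (snd c \<circ> \<sigma>) (at t) = (\<lambda>h. h *\<^sub>R coord A c (\<sigma> t) (velocity A \<sigma> t))"
    by (rule has_derivative_unique)
  then show ?thesis by simp
qed

lemma continuous_speed:
  assumes sm: "smooth_map real_atlas A W \<sigma>" and W: "open W"
  shows "continuous_on W (\<lambda>t. gnorm g (\<sigma> t) (velocity A \<sigma> t))"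
proof (rule continuous_at_imp_continuous_on, rule ballI)
  fix t assume t: "t \<in> W"
  let ?c = "chart_at A (\<sigma> t)"
  have c: "?c \<in> A" "\<sigma> t \<in> fst ?c" by auto
  let ?U = "W \<inter> \<sigma> -` fst ?c"
  let ?x = "snd ?c \<circ> \<sigma>"
  have U: "open ?U" "t \<in> ?U" using open_curve_domain[OF sm W c(1)] t by auto
  have smx: "smooth_on ?U ?x" by (rule smooth_curve_smooth_on[OF sm c(1)])
  have v: "((\<lambda>s. frechet_derivative ?x (at s) 1) has_vector_derivative
      frechet_derivative (\<lambda>s. frechet_derivative ?x (at s) 1) (at t) 1) (at t)"
    by (rule has_vector_derivative_compose_derivative[where x = "\<lambda>s. s",
          OF smooth_on_has_derivative[OF smooth_on_deriv[OF smx] U(2)] has_vector_derivative_id])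
  have x: "((\<lambda>s. ?x s) has_vector_derivative frechet_derivative ?x (at t) 1) (at t)"
    by (rule has_vector_derivative_compose_derivative[where x = "\<lambda>s. s",
          OF smooth_on_has_derivative[OF smx U(2)] has_vector_derivative_id])
  have xin: "?x t \<in> snd ?c ` fst ?c" by simp
  have "isCont (\<lambda>s. metric_rep A g ?c (?x s) (frechet_derivative ?x (at s) 1) (frechet_derivative ?x (at s) 1)) t"
    using metric_rep_curve_derivative[where x = ?x, OF c(1) xin x v v] has_vector_derivative_continuous by blast
  then have co: "isCont (\<lambda>s. sqrt (metric_rep A g ?c (?x s) (frechet_derivative ?x (at s) 1) (frechet_derivative ?x (at s) 1))) t"
    by (rule continuous_real_sqrt)
  have eq: "sqrt (metric_rep A g ?c (?x s) (frechet_derivative ?x (at s) 1) (frechet_derivative ?x (at s) 1))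
      = gnorm g (\<sigma> s) (velocity A \<sigma> s)" if s: "s \<in> ?U" for s
  proof -
    have sc: "s \<in> W" "\<sigma> s \<in> fst ?c" using s by auto
    show ?thesis
      unfolding gnorm_def g_eq_metric_rep[OF c(1) sc(2)] coord_velocity_eq[OF sm W sc(1) c(1) sc(2)] by simp
  qed
  have "\<forall>\<^sub>F s in nhds t. sqrt (metric_rep A g ?c (?x s) (frechet_derivative ?x (at s) 1) (frechet_derivative ?x (at s) 1))
      = gnorm g (\<sigma> s) (velocity A \<sigma> s)"
    using U eq unfolding eventually_nhds by blast
  with co isCont_cong[OF this] show "isCont (\<lambda>t. gnorm g (\<sigma> t) (velocity A \<sigma> t)) t" by simp
qed

lemma smooth_map_on_localD:
  assumes "smooth_map_on real_atlas A S \<sigma>" "t \<in> S"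
  obtains W h where "open W" "t \<in> W" "smooth_map real_atlas A W h" "\<And>s. s \<in> S \<inter> W \<Longrightarrow> h s = \<sigma> s"
  using bspec[OF assms(1)[unfolded smooth_map_on_def] assms(2)]
  by (elim exE conjE) (rule that, assumption, assumption, assumption, erule bspec)

text \<open>Interior times only: at an endpoint the curve need not continue smoothly, and
  \<open>velocity\<close> is a two-sided derivative.\<close>

lemma smooth_map_on_interior_velocity:
  assumes sm: "smooth_map_on real_atlas A {a..b} \<sigma>" and t: "t \<in> {a<..<b}"
  shows "has_velocity \<sigma> t (velocity A \<sigma> t)"
proof -
  have "t \<in> {a..b}" using t by auto
  from smooth_map_on_localD[OF sm this] obtain W h where W: "open W" "t \<in> W"
    "smooth_map real_atlas A W h" "\<And>s. s \<in> {a..b} \<inter> W \<Longrightarrow> h s = \<sigma> s" by metis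
  have "has_velocity \<sigma> t (velocity A h t)"
    by (rule has_velocity_transform[OF smooth_curve_has_velocity[OF W(3,1,2)], of "W \<inter> {a<..<b}"])
      (use W t in auto)
  then show ?thesis using has_velocity_velocity by metis
qed

lemma smooth_map_on_continuous:
  assumes sm: "smooth_map_on real_atlas A S \<sigma>"
  shows "continuous_on S \<sigma>"
  unfolding continuous_on_eq_continuous_within
proof
  fix t assume t: "t \<in> S"
  obtain W h where W: "open W" "t \<in> W" "smooth_map real_atlas A W h" "\<And>s. s \<in> S \<inter> W \<Longrightarrow> h s = \<sigma> s"
    using smooth_map_on_localD[OF sm t] by metis
  have "isCont h t" by (rule has_velocity_isCont[OF smooth_curve_has_velocity[OF W(3,1,2)]])
  then have "(h \<longlongrightarrow> h t) (at t within S)"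
    unfolding isCont_def by (rule tendsto_within_subset) simp
  moreover have "\<forall>\<^sub>F s in at t within S. h s = \<sigma> s"
    unfolding eventually_at_topological using W(1,2,4) by blast
  ultimately have "(\<sigma> \<longlongrightarrow> h t) (at t within S)"
    by (rule Lim_transform_eventually)
  then show "continuous (at t within S) \<sigma>"
    using W(4)[of t] W(2) t by (simp add: continuous_within)
qed

text \<open>Bisection again. On a short interval the speed is that of a smooth extension
  \<open>h\<close>, except at the two ends, where \<open>velocity\<close> may take a default value;
  two points do not affect integrability.\<close>

lemma speed_integrable:
  assumes sm: "smooth_map_on real_atlas A {a..b} \<sigma>" and ab: "a \<le> b"
  shows "(\<lambda>t. gnorm g (\<sigma> t) (velocity A \<sigma> t)) integrable_on {a..b}"
proof -
  let ?f = "\<lambda>t. gnorm g (\<sigma> t) (velocity A \<sigma> t)"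
  have "{a..b} \<subseteq> {a..b} \<longrightarrow> ?f integrable_on {a..b}"
    using ab
  proof (induction rule: Bolzano[where P = "\<lambda>u v. {u..v} \<subseteq> {a..b} \<longrightarrow> ?f integrable_on {u..v}"])
    case (trans u v w)
    show ?case
    proof
      assume sub: "{u..w} \<subseteq> {a..b}"
      then have "{u..v} \<subseteq> {a..b}" "{v..w} \<subseteq> {a..b}" using trans(3,4) by auto
      then show "?f integrable_on {u..w}"
        using trans Henstock_Kurzweil_Integration.integrable_combine[of u v w ?f] by blast
    qed
  next
    case (local x)
    then have x: "x \<in> {a..b}" by simp
    obtain W h where W: "open W" "x \<in> W" "smooth_map real_atlas A W h" "\<And>s. s \<in> {a..b} \<inter> W \<Longrightarrow> h s = \<sigma> s"
      using smooth_map_on_localD[OF sm x] by metis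
    obtain d where d: "d > 0" "ball x d \<subseteq> W" using W(1,2) open_contains_ball by blast
    have "?f integrable_on {u..v}" if uv: "u \<le> x \<and> x \<le> v \<and> v - u < d" and sub: "{u..v} \<subseteq> {a..b}" for u v
    proof -
      have inW: "{u..v} \<subseteq> W"
        using uv d(2) by (auto simp: dist_real_def abs_less_iff subset_iff)
      have "continuous_on {u..v} (\<lambda>t. gnorm g (h t) (velocity A h t))"
        by (rule continuous_on_subset[OF continuous_speed[OF W(3,1)] inW])
      then have "(\<lambda>t. gnorm g (h t) (velocity A h t)) integrable_on {u..v}"
        by (rule integrable_continuous_real)
      then show ?thesis
      proof (rule integrable_spike_finite[of "{u, v}", rotated 2])
        fix t assume "t \<in> {u..v} - {u, v}"
        then have t: "t \<in> {u<..<v}" by auto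
        then have tW: "t \<in> W" using inW by auto
        have eq: "h s = \<sigma> s" if "s \<in> {u<..<v}" for s
          using that inW sub by (intro W(4)) auto
        have "has_velocity \<sigma> t (velocity A h t)"
          by (rule has_velocity_transform[OF smooth_curve_has_velocity[OF W(3,1) tW] open_greaterThanLessThan t eq])
        then have "velocity A \<sigma> t = velocity A h t" by (rule has_velocity_velocity)
        then show "?f t = gnorm g (h t) (velocity A h t)" using eq[OF t] by simp
      qed simp
    qed
    then show ?case using d(1) by blast
  qed
  then show ?thesis by simp
qed

end

section \<open>Radial and tangential directions in the collar\<close>

context normal_collar
begin

text \<open>\<open>d_exp\<close> is a definite description with a meaning on the tangent space only,
  so its linearity is phrased through a linear map that agrees with it there.\<close>

lemma d_exp_linear_rep:
  assumes p: "p \<in> frontier K" and r: "r \<ge> 0"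
  obtains h where "linear h" "\<And>v. v \<in> bdry_tangent A K p \<Longrightarrow> d_exp A g K \<nu> r p v = h v"
proof -
  define c where "c = chart_at A (E r p)"
  define d where "d = chart_at A p"
  have c: "c \<in> A" "E r p \<in> fst c" and d: "d \<in> A" "p \<in> fst d" by (simp_all add: c_def d_def)
  obtain W F where W: "open W" "(r, snd d p) \<in> W" "smooth_on W F"
    and F: "\<And>s q. q \<in> frontier K \<Longrightarrow> q \<in> fst d \<Longrightarrow> s \<ge> 0 \<Longrightarrow> (s, snd d q) \<in> W \<Longrightarrow>
      E s q \<in> fst c \<and> snd c (E s q) = F (s, snd d q)"
    using E_in_charts[OF p r c d] by metis
  let ?h = "\<lambda>v. frechet_derivative F (at (r, snd d p)) (0, v)"
  have lin: "linear (frechet_derivative F (at (r, snd d p)))" by (rule linear_frechet_derivative[OF W(3,2)])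
  have "linear ?h"
  proof (rule linearI)
    show "?h (u + v) = ?h u + ?h v" for u v using linear_add[OF lin, of "(0, u)" "(0, v)"] by simp
    show "?h (k *\<^sub>R v) = k *\<^sub>R ?h v" for k v using linear_cmul[OF lin, of k "(0, v)"] by simp
  qed
  moreover have "d_exp A g K \<nu> r p v = ?h v" if v: "v \<in> bdry_tangent A K p" for v
    using d_exp_in_charts[OF p r c d W F[OF _ _ r] v] by (simp add: c_def d_def)
  ultimately show thesis by (rule that)
qed

definition dradius :: "'m \<Rightarrow> 'e \<Rightarrow> real" where
  "dradius q w = frechet_derivative (\<lambda>x. radius (chart_inv (chart_at A q) x)) (at (snd (chart_at A q) q)) w"

context
  fixes p :: 'm and r :: real
  assumes p: "p \<in> frontier K" and r: "r > 0"
begin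

text \<open>Every point of the straight line through \<open>E r p\<close> in the direction
  \<open>w\<close>, drawn in a chart, is \<open>F\<close> of its radius and its foot.
  Differentiating at time 0 writes \<open>w\<close> as a radial part plus the image of the velocity
  \<open>v\<close> of the foot.\<close>

lemma collar_decomposition:
  "\<exists>v\<in>bdry_tangent A K p. w = dradius (E r p) w *\<^sub>R ray_velocity p r + d_exp A g K \<nu> r p v"
proof -
  define q where "q = E r p"
  define c where "c = chart_at A q"
  define d where "d = chart_at A p"
  have c: "c \<in> A" "q \<in> fst c" "E r p \<in> fst c" and d: "d \<in> A" "p \<in> fst d" by (simp_all add: c_def d_def q_def)
  have r0: "r \<ge> 0" using r by simp
  obtain W F where W: "open W" "(r, snd d p) \<in> W" "smooth_on W F"
    and F: "\<And>s q. q \<in> frontier K \<Longrightarrow> q \<in> fst d \<Longrightarrow> s \<ge> 0 \<Longrightarrow> (s, snd d q) \<in> W \<Longrightarrow>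
      E s q \<in> fst c \<and> snd c (E s q) = F (s, snd d q)"
    using E_in_charts[OF p r0 c(1,3) d] by metis
  have qK: "q \<in> - K" unfolding q_def by (rule E_in_complement[OF p r])
  have foot_q: "foot q = p" and rad_q: "radius q = r"
    unfolding q_def using foot_E[OF p r0] radius_E[OF p r0] by auto
  define x0 where "x0 = snd c q"
  define S where "S = snd c ` (fst c \<inter> (- K \<inter> foot -` fst d))"
  have opS: "open S" unfolding S_def by (rule open_chart_image[OF is_chart[OF c(1)] open_foot_preimage[OF d(1)]])
  have x0S: "x0 \<in> S" unfolding S_def x0_def using c qK foot_q d by auto
  obtain e where e: "e > 0" "ball x0 e \<subseteq> S" using opS x0S open_contains_ball by blast
  define e' where "e' = e / (norm w + 1)"
  have n: "norm w + 1 > 0" by (simp add: add_nonneg_pos)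
  have e': "e' > 0" using e(1) n by (simp add: e'_def)
  have inS: "x0 + t *\<^sub>R w \<in> S" if "t \<in> {-e'<..<e'}" for t
  proof -
    have "\<bar>t\<bar> < e'" using that by (simp add: abs_less_iff)
    have "\<bar>t\<bar> * norm w \<le> \<bar>t\<bar> * (norm w + 1)" by (intro mult_left_mono) auto
    also have "\<dots> < e' * (norm w + 1)" using \<open>\<bar>t\<bar> < e'\<close> n by (intro mult_strict_right_mono)
    also have "\<dots> = e" using n by (simp add: e'_def)
    finally have "x0 + t *\<^sub>R w \<in> ball x0 e" by (simp add: dist_norm)
    then show ?thesis using e(2) by blast
  qed
  let ?\<tau> = "\<lambda>t. chart_inv c (x0 + t *\<^sub>R w)"
  have \<tau>: "?\<tau> t \<in> fst c" "?\<tau> t \<in> - K" "foot (?\<tau> t) \<in> fst d" "snd c (?\<tau> t) = x0 + t *\<^sub>R w"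
    if t: "t \<in> {-e'<..<e'}" for t
  proof -
    obtain z where "x0 + t *\<^sub>R w = snd c z" "z \<in> fst c" "z \<in> - K" "foot z \<in> fst d"
      using inS[OF t] unfolding S_def by auto
    then show "?\<tau> t \<in> fst c" "?\<tau> t \<in> - K" "foot (?\<tau> t) \<in> fst d" "snd c (?\<tau> t) = x0 + t *\<^sub>R w"
      using c(1) by simp_all
  qed
  have \<tau>0: "?\<tau> 0 = q" using c by (simp add: x0_def)
  let ?\<sigma> = "\<lambda>t. foot (?\<tau> t)"
  have sm: "smooth_map real_atlas A {-e'<..<e'} ?\<sigma>"
  proof (rule smooth_affine_curve[OF is_chart[OF c(1)] open_complement continuous_foot_complement foot_smooth[OF c(1)]])
    show "x0 + t *\<^sub>R w \<in> snd c ` (fst c \<inter> - K)" if "t \<in> {-e'<..<e'}" for t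
      using inS[OF that] unfolding S_def by auto
  qed
  define v where "v = velocity A ?\<sigma> 0"
  have \<sigma>0: "?\<sigma> 0 = p" using \<tau>0 foot_q by simp
  have ct: "curve_through A (frontier K) ?\<sigma> p v"
    unfolding curve_through_def v_def
  proof (intro conjI exI[of _ e'])
    show "?\<sigma> ` {-e'<..<e'} \<subseteq> frontier K" using complement_collar(2)[OF \<tau>(2)] by blast
  qed (use e' sm \<sigma>0 in auto)
  then have v: "v \<in> bdry_tangent A K p" by (auto simp: bdry_tangent_def tangent_space_def)
  have "(snd d \<circ> ?\<sigma> has_vector_derivative coord A d p v) (at 0)"
    using has_velocity_chart[OF curve_through_velocity(1)[OF ct] d(1)] \<sigma>0 d(2) by simp
  then have y': "((\<lambda>t. snd d (?\<sigma> t)) has_vector_derivative coord A d p v) (at 0)" by (simp add: o_def)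
  have lin: "((\<lambda>t. x0 + t *\<^sub>R w) has_vector_derivative w) (at 0)"
    by (auto intro!: derivative_eq_intros)
  have x0C: "x0 \<in> snd c ` (fst c \<inter> - K)" using c qK by (auto simp: x0_def)
  have dr: "((\<lambda>x. radius (chart_inv c x)) has_derivative dradius q) (at (x0 + 0 *\<^sub>R w))"
    using smooth_on_has_derivative[OF radius_smooth[OF c(1)] x0C]
    by (simp add: dradius_def[abs_def] c_def x0_def)
  have r': "((\<lambda>t. radius (?\<tau> t)) has_vector_derivative dradius q w) (at 0)"
    by (rule has_vector_derivative_compose_derivative[where x = "\<lambda>t. x0 + t *\<^sub>R w", OF dr lin])
  let ?z = "\<lambda>t. (radius (?\<tau> t), snd d (?\<sigma> t))"
  have z0: "?z 0 = (r, snd d p)" using \<tau>0 foot_q rad_q by simp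
  have z': "(?z has_vector_derivative (dradius q w, coord A d p v)) (at 0)"
    by (rule has_vector_derivative_Pair[OF r' y'])
  have F': "(F has_derivative frechet_derivative F (at (r, snd d p))) (at (?z 0))"
    unfolding z0 by (rule smooth_on_has_derivative[OF W(3,2)])
  have D: "((\<lambda>t. F (?z t)) has_vector_derivative frechet_derivative F (at (r, snd d p)) (dradius q w, coord A d p v)) (at 0)"
    by (rule has_vector_derivative_compose_derivative[where x = ?z, OF F' z'])
  have coz: "isCont ?z 0" using z' has_vector_derivative_continuous by blast
  have z0W: "?z 0 \<in> W" unfolding z0 by (rule W(2))
  obtain U where U: "open U" "0 \<in> U" "\<And>t. t \<in> U \<Longrightarrow> ?z t \<in> W"
    using isCont_open_vimage[where f = ?z and t = 0, OF coz W(1) z0W] by blast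
  have "((\<lambda>t. x0 + t *\<^sub>R w) has_vector_derivative frechet_derivative F (at (r, snd d p)) (dradius q w, coord A d p v)) (at 0)"
  proof (rule has_vector_derivative_transform_within_open[where S = "U \<inter> {-e'<..<e'}", OF D])
    fix t assume t: "t \<in> U \<inter> {-e'<..<e'}"
    then have te: "t \<in> {-e'<..<e'}" and tU: "t \<in> U" by auto
    note cc = complement_collar[OF \<tau>(2)[OF te]]
    have "snd c (E (radius (?\<tau> t)) (?\<sigma> t)) = F (?z t)"
      using F[OF cc(2) \<tau>(3)[OF te] less_imp_le[OF cc(1)] U(3)[OF tU]] by simp
    then show "F (?z t) = x0 + t *\<^sub>R w" using cc(3) \<tau>(4)[OF te] by simp
  qed (use U e' in auto)
  with lin have w: "w = frechet_derivative F (at (r, snd d p)) (dradius q w, coord A d p v)"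
    using vector_derivative_unique_at by blast
  have linF: "linear (frechet_derivative F (at (r, snd d p)))" by (rule linear_frechet_derivative[OF W(3,2)])
  have "(dradius q w, coord A d p v) = dradius q w *\<^sub>R (1, 0) + (0, coord A d p v)" by simp
  then have "w = dradius q w *\<^sub>R frechet_derivative F (at (r, snd d p)) (1, 0) + frechet_derivative F (at (r, snd d p)) (0, coord A d p v)"
    using w by (metis linear_add[OF linF] linear_cmul[OF linF])
  moreover have "coord A c (E r p) (d_exp A g K \<nu> r p v) = frechet_derivative F (at (r, snd d p)) (0, coord A d p v)"
    by (rule d_exp_in_charts[OF p r0 c(1,3) d W F[OF _ _ r0] v])
  moreover have "coord A c (E r p) (ray_velocity p r) = frechet_derivative F (at (r, snd d p)) (1, 0)"
    by (rule ray_velocity_in_charts[OF p r0 c(1,3) W(1,2,3)]) (use F[OF p d(2)] in auto)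
  ultimately have "w = dradius (E r p) w *\<^sub>R ray_velocity p r + d_exp A g K \<nu> r p v"
    by (simp add: c_def q_def)
  with v show ?thesis by blast
qed

text \<open>By the Gauss lemma the decomposition is orthogonal, so the radial velocity is the
  gradient of the radial coordinate.\<close>

lemma dradius_eq: "dradius (E r p) w = g (E r p) (ray_velocity p r) w"
proof -
  obtain v where v: "v \<in> bdry_tangent A K p" "w = dradius (E r p) w *\<^sub>R ray_velocity p r + d_exp A g K \<nu> r p v"
    using collar_decomposition[of w] by blast
  have "g (E r p) (ray_velocity p r) w = dradius (E r p) w"
    by (subst v(2)) (use gauss[OF p v(1)] ray_unit_speed[OF p] r in simp)
  then show ?thesis by simp
qed

text \<open>The foot map inverts \<open>E r\<close> on the boundary; differentiating
  \<open>foot (E r (\<sigma> s)) = \<sigma> s\<close> recovers \<open>v\<close> from its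
  image.\<close>

lemma d_exp_kernel:
  assumes v: "v \<in> bdry_tangent A K p" and zero: "d_exp A g K \<nu> r p v = 0"
  shows "v = 0"
proof -
  define q where "q = E r p"
  define c where "c = chart_at A q"
  define d where "d = chart_at A p"
  have c: "c \<in> A" "q \<in> fst c" "E r p \<in> fst c" and d: "d \<in> A" "p \<in> fst d" by (simp_all add: c_def d_def q_def)
  have r0: "r \<ge> 0" using r by simp
  obtain W F where W: "open W" "(r, snd d p) \<in> W" "smooth_on W F"
    and F: "\<And>s q. q \<in> frontier K \<Longrightarrow> q \<in> fst d \<Longrightarrow> s \<ge> 0 \<Longrightarrow> (s, snd d q) \<in> W \<Longrightarrow>
      E s q \<in> fst c \<and> snd c (E s q) = F (s, snd d q)"
    using E_in_charts[OF p r0 c(1,3) d] by metis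
  have qK: "q \<in> - K" unfolding q_def by (rule E_in_complement[OF p r])
  have foot_q: "foot q = p" unfolding q_def by (rule foot_E[OF p r0])
  obtain \<sigma> where \<sigma>: "curve_through A (frontier K) \<sigma> p v"
    using v by (auto simp: bdry_tangent_def tangent_space_def)
  note ct = curve_through_velocity[OF \<sigma>]
  have co: "isCont \<sigma> 0" by (rule has_velocity_isCont[OF ct(1)])
  have \<sigma>0: "\<sigma> 0 \<in> fst d" using ct(2) d(2) by simp
  obtain U where U: "open U" "0 \<in> U" "\<And>s. s \<in> U \<Longrightarrow> \<sigma> s \<in> fst d"
    using isCont_open_vimage[OF co open_chart_domain[OF is_chart[OF d(1)]] \<sigma>0] by blast
  obtain e where e: "e > 0" "\<And>s. \<bar>s\<bar> < e \<Longrightarrow> \<sigma> s \<in> frontier K" using ct(3) by blast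
  have y': "((\<lambda>s. snd d (\<sigma> s)) has_vector_derivative coord A d p v) (at 0)"
    using has_velocity_chart[OF ct(1) d(1) \<sigma>0] ct(2) by (simp add: o_def)
  let ?y = "\<lambda>s. (r, snd d (\<sigma> s))"
  have y0: "?y 0 = (r, snd d p)" using ct(2) by simp
  have z': "(?y has_vector_derivative (0, coord A d p v)) (at 0)"
    by (intro has_vector_derivative_Pair has_vector_derivative_const y')
  have coy: "isCont ?y 0" using z' has_vector_derivative_continuous by blast
  have y0W: "?y 0 \<in> W" unfolding y0 by (rule W(2))
  obtain U' where U': "open U'" "0 \<in> U'" "\<And>s. s \<in> U' \<Longrightarrow> ?y s \<in> W"
    using isCont_open_vimage[where f = ?y and t = 0, OF coy W(1) y0W] by blast
  have F': "(F has_derivative frechet_derivative F (at (r, snd d p))) (at (?y 0))"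
    unfolding y0 by (rule smooth_on_has_derivative[OF W(3,2)])
  have "coord A c (E r p) (d_exp A g K \<nu> r p v) = frechet_derivative F (at (r, snd d p)) (0, coord A d p v)"
    by (rule d_exp_in_charts[OF p r0 c(1,3) d W F[OF _ _ r0] v])
  then have "frechet_derivative F (at (r, snd d p)) (0, coord A d p v) = 0"
    using zero linear_0[OF linear_coord[OF c(1,3)]] by simp
  then have Fy: "((\<lambda>s. F (?y s)) has_vector_derivative 0) (at 0)"
    using has_vector_derivative_compose_derivative[where x = ?y, OF F' z'] by simp
  have Fy0: "F (?y 0) = snd c q" using F[OF p d(2) r0 W(2)] unfolding y0 by (simp add: q_def)
  have x0: "snd c q \<in> snd c ` (fst c \<inter> - K \<inter> foot -` fst d)" using c qK foot_q d by auto
  let ?Y = "snd d \<circ> foot \<circ> chart_inv c"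
  have Y': "(?Y has_derivative frechet_derivative ?Y (at (snd c q))) (at (F (?y 0)))"
    unfolding Fy0 by (rule smooth_on_has_derivative[OF foot_smooth[OF c(1) d(1)] x0])
  have D: "((\<lambda>s. ?Y (F (?y s))) has_vector_derivative frechet_derivative ?Y (at (snd c q)) 0) (at 0)"
    by (rule has_vector_derivative_compose_derivative[where x = "\<lambda>s. F (?y s)", OF Y' Fy])
  have "((\<lambda>s. snd d (\<sigma> s)) has_vector_derivative frechet_derivative ?Y (at (snd c q)) 0) (at 0)"
  proof (rule has_vector_derivative_transform_within_open[where S = "U \<inter> U' \<inter> {-e<..<e}", OF D])
    fix s assume s: "s \<in> U \<inter> U' \<inter> {-e<..<e}"
    have q: "\<sigma> s \<in> frontier K" "\<sigma> s \<in> fst d" "?y s \<in> W"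
      using s U(3) U'(3) e(2)[of s] by (auto simp: abs_less_iff)
    have FE: "E r (\<sigma> s) \<in> fst c" "F (?y s) = snd c (E r (\<sigma> s))" using F[OF q(1,2) r0 q(3)] by auto
    show "?Y (F (?y s)) = snd d (\<sigma> s)"
      unfolding FE(2) using c(1) FE(1) foot_E[OF q(1) r0] by simp
  qed (use U U' e in auto)
  with y' have "coord A d p v = frechet_derivative ?Y (at (snd c q)) 0"
    using vector_derivative_unique_at by blast
  also have "\<dots> = 0" by (rule linear_0[OF linear_frechet_derivative[OF foot_smooth[OF c(1) d(1)] x0]])
  finally show ?thesis by (simp add: d_def)
qed

text \<open>Injectivity is the triviality of the kernel. For the image, a vector orthogonal to the
  radial direction has \<open>dradius\<close> equal to 0, so its decomposition has no radial
  part.\<close>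

lemma d_exp_bij:
  "bij_betw (d_exp A g K \<nu> r p) (bdry_tangent A K p) {w. g (E r p) w (ray_velocity p r) = 0}"
proof (rule bij_betw_imageI)
  have r0: "r \<ge> 0" using r by simp
  obtain h where h: "linear h" "\<And>v. v \<in> bdry_tangent A K p \<Longrightarrow> d_exp A g K \<nu> r p v = h v"
    using d_exp_linear_rep[OF p r0] by metis
  note T = subspace_bdry_tangent[OF p]
  show "inj_on (d_exp A g K \<nu> r p) (bdry_tangent A K p)"
  proof (rule inj_onI)
    fix u v assume uv: "u \<in> bdry_tangent A K p" "v \<in> bdry_tangent A K p" "d_exp A g K \<nu> r p u = d_exp A g K \<nu> r p v"
    have "u - v \<in> bdry_tangent A K p" by (rule subspace_diff[OF T uv(1,2)])
    moreover from this have "d_exp A g K \<nu> r p (u - v) = 0"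
      using h(2) uv linear_diff[OF h(1)] by simp
    ultimately have "u - v = 0" by (rule d_exp_kernel)
    then show "u = v" by simp
  qed
  show "d_exp A g K \<nu> r p ` bdry_tangent A K p = {w. g (E r p) w (ray_velocity p r) = 0}"
  proof (intro set_eqI iffI)
    fix w assume "w \<in> {w. g (E r p) w (ray_velocity p r) = 0}"
    then have "dradius (E r p) w = 0" by (simp add: dradius_eq g_sym)
    with collar_decomposition[of w] show "w \<in> d_exp A g K \<nu> r p ` bdry_tangent A K p" by auto
  qed (use gauss[OF p _ r0] in \<open>auto simp: g_sym\<close>)
qed

end

section \<open>The distance to an essential subset\<close>

lemma radius_frontier: "q \<in> frontier K \<Longrightarrow> radius q = 0"
  using radius_E[of q 0] by simp

text \<open>The gradient of the radial coordinate is a unit vector, so by Cauchy-Schwarz the radius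
  grows no faster than arc length.\<close>

lemma radius_curve_derivative:
  assumes v: "has_velocity \<sigma> t v" and K: "\<sigma> t \<in> - K"
  obtains D where "((\<lambda>s. radius (\<sigma> s)) has_vector_derivative D) (at t)" "D \<le> gnorm g (\<sigma> t) v"
proof -
  let ?q = "\<sigma> t"
  let ?c = "chart_at A ?q"
  note cc = complement_collar[OF K]
  have c: "?c \<in> A" "?q \<in> fst ?c" by auto
  have x: "snd ?c ?q \<in> snd ?c ` (fst ?c \<inter> - K)" using K by auto
  have dr: "((\<lambda>x. radius (chart_inv ?c x)) has_derivative dradius ?q) (at ((snd ?c \<circ> \<sigma>) t))"
    using smooth_on_has_derivative[OF radius_smooth[OF c(1)] x] by (simp add: dradius_def[abs_def])
  have x': "((snd ?c \<circ> \<sigma>) has_vector_derivative v) (at t)" using v by (simp add: has_velocity_def)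
  have D: "((\<lambda>s. radius (chart_inv ?c ((snd ?c \<circ> \<sigma>) s))) has_vector_derivative dradius ?q v) (at t)"
    by (rule has_vector_derivative_compose_derivative[where x = "snd ?c \<circ> \<sigma>", OF dr x'])
  obtain U where U: "open U" "t \<in> U" "\<And>s. s \<in> U \<Longrightarrow> \<sigma> s \<in> fst ?c"
    using isCont_open_vimage[OF has_velocity_isCont[OF v] open_chart_domain[OF is_chart[OF c(1)]] c(2)] by blast
  have "((\<lambda>s. radius (\<sigma> s)) has_vector_derivative dradius ?q v) (at t)"
    by (rule has_vector_derivative_transform_within_open[OF D U(1,2)]) (use U(3) in simp)
  moreover have "dradius ?q v \<le> gnorm g ?q v"
  proof -
    let ?w = "ray_velocity (foot ?q) (radius ?q)"
    have "dradius ?q v = g ?q ?w v"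
      using dradius_eq[OF cc(2,1), of v] by (simp only: cc(3))
    also have "\<dots> \<le> gnorm g ?q ?w * gnorm g ?q v"
      using g_cauchy_schwarz[of ?q ?w v] by linarith
    also have "gnorm g ?q ?w = 1"
      using ray_unit_speed[OF cc(2), of "radius ?q"] by (simp add: gnorm_def cc(3))
    finally show ?thesis by simp
  qed
  ultimately show thesis by (rule that)
qed

text \<open>The start may lie on the boundary, where the radius is continuous but need not be
  differentiable along the curve. Hence the fundamental theorem with continuity at the ends and
  derivatives inside.\<close>

lemma radius_increase_collar:
  assumes sm: "smooth_map_on real_atlas A {a..b} \<sigma>" and ab: "a \<le> b"
    and start: "\<sigma> a \<in> closure (- K)" and out: "\<And>t. a < t \<Longrightarrow> t \<le> b \<Longrightarrow> \<sigma> t \<in> - K"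
  shows "radius (\<sigma> b) - radius (\<sigma> a) \<le> integral {a..b} (\<lambda>t. gnorm g (\<sigma> t) (velocity A \<sigma> t))"
proof -
  have cl: "\<sigma> t \<in> closure (- K)" if "t \<in> {a..b}" for t
    using start out[of t] that closure_subset[of "- K"] by (cases "t = a") auto
  have cont: "continuous_on {a..b} (\<lambda>t. radius (\<sigma> t))"
    by (rule continuous_on_compose2[OF continuous_radius smooth_map_on_continuous[OF sm]]) (use cl in blast)
  have "\<exists>D. ((\<lambda>s. radius (\<sigma> s)) has_vector_derivative D) (at t) \<and> D \<le> gnorm g (\<sigma> t) (velocity A \<sigma> t)"
    if t: "t \<in> {a<..<b}" for t
  proof -
    have "\<sigma> t \<in> - K" by (rule out) (use t in auto)
    from radius_curve_derivative[OF smooth_map_on_interior_velocity[OF sm t] this] show ?thesis by metis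
  qed
  then obtain D where D: "\<And>t. t \<in> {a<..<b} \<Longrightarrow> ((\<lambda>s. radius (\<sigma> s)) has_vector_derivative D t) (at t)"
    "\<And>t. t \<in> {a<..<b} \<Longrightarrow> D t \<le> gnorm g (\<sigma> t) (velocity A \<sigma> t)"
    by metis
  \<comment> \<open>The value 0 at the two ends keeps the integrand below the speed everywhere on
    the closed interval.\<close>
  let ?D = "\<lambda>t. if t \<in> {a<..<b} then D t else 0"
  have "(?D has_integral (radius (\<sigma> b) - radius (\<sigma> a))) {a..b}"
    by (rule fundamental_theorem_of_calculus_interior[OF ab cont]) (use D(1) in auto)
  moreover have "((\<lambda>t. gnorm g (\<sigma> t) (velocity A \<sigma> t)) has_integral
      integral {a..b} (\<lambda>t. gnorm g (\<sigma> t) (velocity A \<sigma> t))) {a..b}"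
    by (rule integrable_integral[OF speed_integrable[OF sm ab]])
  ultimately show ?thesis
    by (rule has_integral_le) (use D(2) in auto)
qed

text \<open>\<open>radius\<close> has no meaning in the interior of \<open>K\<close>. Extended by 0
  it can be followed along curves that pass through \<open>K\<close>.\<close>

definition radius0 :: "'m \<Rightarrow> real" where "radius0 q = (if q \<in> K then 0 else radius q)"

lemma radius0_nonneg: "radius0 q \<ge> 0"
  using complement_collar(1)[of q] by (auto simp: radius0_def less_imp_le)

text \<open>It suffices to look at the part of the curve after its last visit to \<open>K\<close>:
  that part runs in the collar and starts at radius 0.\<close>

lemma radius0_increase:
  assumes sm: "smooth_map_on real_atlas A {a..b} \<sigma>" and ab: "a \<le> b"
  shows "radius0 (\<sigma> b) - radius0 (\<sigma> a) \<le> integral {a..b} (\<lambda>t. gnorm g (\<sigma> t) (velocity A \<sigma> t))"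
proof (cases "\<sigma> b \<in> K")
  case True
  have "0 \<le> integral {a..b} (\<lambda>t. gnorm g (\<sigma> t) (velocity A \<sigma> t))"
    by (rule integral_nonneg[OF speed_integrable[OF sm ab]]) simp
  then show ?thesis using True radius0_nonneg[of "\<sigma> a"] by (simp add: radius0_def)
next
  case b: False
  define S where "S = {a..b} \<inter> \<sigma> -` K"
  have clS: "closed S" unfolding S_def
    by (rule continuous_closed_preimage[OF smooth_map_on_continuous[OF sm] _ closed_K]) simp
  show ?thesis
  proof (cases "S = {}")
    case True
    have out: "\<sigma> t \<in> - K" if "t \<in> {a..b}" for t using True that unfolding S_def by blast
    have "\<sigma> a \<in> - K" using out[of a] ab by simp
    moreover have "\<sigma> a \<in> closure (- K)" by (rule subsetD[OF closure_subset calculation])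
    ultimately show ?thesis
      using radius_increase_collar[OF sm ab _ out] b by (simp add: radius0_def)
  next
    case False
    define s where "s = Sup S"
    have bdd: "bdd_above S" unfolding S_def by (rule bdd_aboveI[of _ b]) auto
    have s: "s \<in> S" unfolding s_def by (rule closed_contains_Sup[OF False bdd clS])
    then have sab: "a \<le> s" "s \<le> b" "\<sigma> s \<in> K" by (auto simp: S_def)
    have sb: "s < b" using sab b by (cases "s = b") auto
    have out: "\<sigma> t \<in> - K" if "s < t" "t \<le> b" for t
    proof
      assume "\<sigma> t \<in> K"
      then have "t \<in> S" using that sab by (simp add: S_def)
      then have "t \<le> s" unfolding s_def using bdd by (rule cSup_upper)
      with that show False by simp
    qed
    have sub: "{s..b} \<subseteq> {a..b}" using sab by auto
    note smS = smooth_map_on_subset[OF sm sub]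
    have "(\<sigma> \<longlongrightarrow> \<sigma> s) (at s within {s..b})"
      using smooth_map_on_continuous[OF smS] sb unfolding continuous_on_def by auto
    then have lim: "(\<sigma> \<longlongrightarrow> \<sigma> s) (at s within {s<..b})"
      by (rule tendsto_within_subset) auto
    have nb: "at s within {s<..b} \<noteq> bot"
    proof -
      have "s islimpt {s<..b}" using sb by (auto simp: islimpt_greaterThanLessThan1 intro: islimpt_subset[of s "{s<..<b}"])
      then show ?thesis by (simp add: trivial_limit_within)
    qed
    have ev: "\<forall>\<^sub>F t in at s within {s<..b}. \<sigma> t \<in> closure (- K)"
      unfolding eventually_at_topological
      by (intro exI[of _ UNIV]) (use out closure_subset[of "- K"] in auto)
    \<comment> \<open>The last point in \<open>K\<close> is a limit of points outside
      \<open>K\<close>, hence a boundary point.\<close>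
    have cl: "\<sigma> s \<in> closure (- K)"
      by (rule Lim_in_closed_set[OF closed_closure ev nb lim])
    then have "\<sigma> s \<in> frontier K" using sab(3) closed_K by (simp add: frontier_def closure_complement)
    then have "radius (\<sigma> s) = 0" by (rule radius_frontier)
    then have "radius (\<sigma> b) \<le> integral {s..b} (\<lambda>t. gnorm g (\<sigma> t) (velocity A \<sigma> t))"
      using radius_increase_collar[OF smS sab(2) cl out] by simp
    also have "\<dots> \<le> integral {a..b} (\<lambda>t. gnorm g (\<sigma> t) (velocity A \<sigma> t))"
      by (rule integral_subset_le[OF sub speed_integrable[OF smS sab(2)] speed_integrable[OF sm ab]]) simp
    finally show ?thesis using b radius0_nonneg[of "\<sigma> a"] by (simp add: radius0_def)
  qed
qed

lemma radius0_le_curve_length: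
  assumes pw: "piecewise_smooth A \<sigma>" and 0: "\<sigma> 0 \<in> K"
  shows "radius0 (\<sigma> 1) \<le> curve_length A g \<sigma>"
proof -
  let ?f = "\<lambda>t. gnorm g (\<sigma> t) (velocity A \<sigma> t)"
  obtain ts where ts: "ts \<noteq> []" "sorted ts" "hd ts = 0" "last ts = 1"
    "\<And>i. Suc i < length ts \<Longrightarrow> smooth_map_on real_atlas A {ts ! i..ts ! Suc i} \<sigma>"
    using pw unfolding piecewise_smooth_def by (elim exE conjE) (rule that, assumption+, blast)
  have t0: "ts ! 0 = 0" using ts(1,3) by (simp add: hd_conv_nth)
  have "0 \<le> ts ! i \<and> ?f integrable_on {0..ts ! i} \<and> radius0 (\<sigma> (ts ! i)) - radius0 (\<sigma> 0) \<le> integral {0..ts ! i} ?f"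
    if "i < length ts" for i
    using that
  proof (induction i)
    case 0
    then show ?case using integrable_on_refl[of ?f "0::real"] by (simp add: t0)
  next
    case (Suc i)
    then have IH: "0 \<le> ts ! i" "?f integrable_on {0..ts ! i}"
      "radius0 (\<sigma> (ts ! i)) - radius0 (\<sigma> 0) \<le> integral {0..ts ! i} ?f" by auto
    have le: "ts ! i \<le> ts ! Suc i" using sorted_nth_mono[OF ts(2), of i "Suc i"] Suc.prems by simp
    have sm: "smooth_map_on real_atlas A {ts ! i..ts ! Suc i} \<sigma>" by (rule ts(5)[OF Suc.prems])
    have int: "?f integrable_on {0..ts ! Suc i}"
      by (rule Henstock_Kurzweil_Integration.integrable_combine[OF IH(1) le IH(2) speed_integrable[OF sm le]])
    have "integral {0..ts ! Suc i} ?f = integral {0..ts ! i} ?f + integral {ts ! i..ts ! Suc i} ?f"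
      using Henstock_Kurzweil_Integration.integral_combine[OF IH(1) le int] by simp
    then show ?case using int IH(1,3) le radius0_increase[OF sm le] by auto
  qed
  from this[of "length ts - 1"] ts(1,4) have "radius0 (\<sigma> 1) - radius0 (\<sigma> 0) \<le> integral {0..1} ?f"
    by (simp add: last_conv_nth)
  then show ?thesis using 0 by (simp add: radius0_def curve_length_def)
qed

text \<open>The radial geodesic, reparametrized to \<open>{0..1}\<close>, has length
  \<open>radius q\<close>, and no admissible curve is shorter; so the infimum is attained.\<close>

lemma distance_eq_radius:
  assumes q: "q \<in> - K"
  shows "distance_to A g K q = radius q"
proof -
  note cc = complement_collar[OF q]
  let ?p = "foot q" and ?r = "radius q"
  define \<tau> where "\<tau> t = E (?r * t) ?p" for t
  let ?L = "{curve_length A g \<sigma> |\<sigma>. piecewise_smooth A \<sigma> \<and> \<sigma> 0 \<in> K \<and> \<sigma> 1 = q}"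
  have geo: "geodesic A g \<tau>" and vel: "velocity A \<tau> t = ?r *\<^sub>R ray_velocity ?p (?r * t)" for t
    unfolding \<tau>_def[abs_def] by (rule geodesic_scale[OF geodesic_ray])+
  have "smooth_map_on real_atlas A {0..1} \<tau>"
    unfolding smooth_map_on_def using geo by (auto simp: geodesic_def intro!: exI[of _ UNIV] exI[of _ \<tau>])
  then have "piecewise_smooth A \<tau>"
    unfolding piecewise_smooth_def by (intro exI[of _ "[0, 1]"]) (auto simp: less_Suc_eq)
  moreover have "\<tau> 0 \<in> K" "\<tau> 1 = q" using cc frontier_subset_K by (auto simp: \<tau>_def)
  moreover have "gnorm g (\<tau> t) (velocity A \<tau> t) = ?r" for t
    unfolding vel gnorm_scale using ray_unit_speed[OF cc(2), of "?r * t"] cc(1) by (simp add: gnorm_def \<tau>_def)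
  then have "curve_length A g \<tau> = ?r" by (simp add: curve_length_def)
  ultimately have mem: "?r \<in> ?L" unfolding mem_Collect_eq by (intro exI[of _ \<tau>] conjI) simp_all
  have low: "?r \<le> l" if "l \<in> ?L" for l
  proof -
    obtain \<sigma> where \<sigma>: "l = curve_length A g \<sigma>" "piecewise_smooth A \<sigma>" "\<sigma> 0 \<in> K" "\<sigma> 1 = q"
      using \<open>l \<in> ?L\<close> by blast
    then show ?thesis using radius0_le_curve_length[OF \<sigma>(2,3)] q by (simp add: radius0_def)
  qed
  have "Inf ?L = ?r"
    by (rule cInf_eq_minimum[OF mem low])
  then show ?thesis by (simp add: distance_to_def)
qed

text \<open>Distance and radius agree on the open complement of \<open>K\<close>, so they have the
  same differential there, and the Gauss lemma has identified the gradient of the radius.\<close>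

lemma d_r_eq:
  assumes p: "p \<in> frontier K" and r: "r > 0"
  shows "d_r A g K (E r p) = ray_velocity p r"
proof -
  let ?q = "E r p"
  let ?c = "chart_at A ?q"
  have c: "?c \<in> A" "?q \<in> fst ?c" by auto
  have qK: "?q \<in> - K" by (rule E_in_complement[OF p r])
  let ?S = "snd ?c ` (fst ?c \<inter> - K)"
  have S: "open ?S" "snd ?c ?q \<in> ?S"
    using open_chart_image[OF is_chart[OF c(1)] open_complement] qK by auto
  have "(distance_to A g K \<circ> chart_inv ?c) x = radius (chart_inv ?c x)" if "x \<in> ?S" for x
    using that by (auto simp: distance_eq_radius)
  then have "frechet_derivative (distance_to A g K \<circ> chart_inv ?c) (at (snd ?c ?q)) = dradius ?q"
    unfolding dradius_def[abs_def] by (intro frechet_derivative_cong_open[OF S])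
  then have "d_r A g K ?q = (THE w. \<forall>v. g ?q w v = g ?q (ray_velocity p r) v)"
    by (simp add: d_r_def gradient_def dradius_eq[OF p r])
  also have "\<dots> = ray_velocity p r"
    by (rule the_equality) (auto intro: g_eqI)
  finally show ?thesis .
qed

lemma distance_E: "p \<in> frontier K \<Longrightarrow> r > 0 \<Longrightarrow> distance_to A g K (E r p) = r"
  using distance_eq_radius[OF E_in_complement] radius_E by simp

end

section \<open>The almost complex structure along radial geodesics\<close>

locale hermitian_collar = normal_collar A g K \<nu>
  for A :: "('m::t2_space, 'e::euclidean_space) chart set" and g and K :: "'m set" and \<nu> :: "'m \<Rightarrow> 'e" +
  fixes J :: "'m \<Rightarrow> 'e \<Rightarrow> 'e" and a :: real
  assumes hermitian: "almost_hermitian A g J"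
    and a_gt_1: "a > 1"
    and nabla_J_decay: "(\<lambda>p. tensor_norm2 g p (nabla_J A g J p))
         \<in> O[filtercomap (distance_to A g K) at_top](\<lambda>p. exp (- a * distance_to A g K p))"
begin

lemma J_linear: "linear (J p)"
  and J_J [simp]: "J p (J p v) = - v"
  and J_isometry [simp]: "g p (J p u) (J p v) = g p u v"
  using hermitian by (simp_all add: almost_hermitian_def)

lemma J_skew: "g p (J p u) v = - g p u (J p v)"
  using J_isometry[of p u "J p v"] by simp

lemma J_orth [simp]: "g p (J p u) u = 0" "g p u (J p u) = 0"
  using J_skew[of p u u] g_sym[of p u "J p u"] by auto

lemmas J_simps = linear_add[OF J_linear] linear_cmul[OF J_linear] linear_diff[OF J_linear] linear_neg[OF J_linear]

section \<open>The Leibniz rule for the almost complex structure\<close>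

definition J_rep :: "('m, 'e) chart \<Rightarrow> 'e \<Rightarrow> 'e \<Rightarrow> 'e" where
  "J_rep c x u = coord A c (chart_inv c x) (J (chart_inv c x) (vec A c (chart_inv c x) u))"

lemma J_rep_smooth: "c \<in> A \<Longrightarrow> smooth_on (snd c ` fst c) (\<lambda>x. J_rep c x u)"
  using hermitian by (simp add: almost_hermitian_def J_rep_def Let_def)

lemma J_rep_linear:
  assumes "c \<in> A" "x \<in> snd c ` fst c"
  shows "linear (J_rep c x)"
proof -
  have "chart_inv c x \<in> fst c" using assms by simp
  then have "linear (coord A c (chart_inv c x))" "linear (vec A c (chart_inv c x))"
    using assms by (simp_all add: linear_coord linear_vec)
  then show ?thesis
    unfolding J_rep_def by (auto intro!: linearI simp: linear_add linear_cmul J_simps)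
qed

text \<open>The extension of \<open>v\<close> has constant components, so its own derivative
  vanishes; what remains is the derivative of the components of \<open>J\<close> and two Christoffel
  terms.\<close>

lemma nabla_J_eq:
  fixes p defines "c \<equiv> chart_at A p"
  shows "nabla_J A g J p u v = frechet_derivative (\<lambda>x. J_rep c x v) (at (snd c p)) u
    + chris c (snd c p) u (J p v) - J p (chris c (snd c p) u v)"
proof -
  have c: "c \<in> A" "p \<in> fst c" by (simp_all add: c_def)
  have ext: "extend A p w p = w" for w by (simp add: extend_def)
  have "field_rep A c (\<lambda>q. J q (extend A p v q)) = (\<lambda>x. J_rep c x v)"
    by (simp add: fun_eq_iff field_rep_def J_rep_def extend_def c_def)
  moreover have "frechet_derivative (field_rep A c (extend A p v)) (at (snd c p)) u = 0"
  proof -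
    have "frechet_derivative (field_rep A c (extend A p v)) (at (snd c p)) = frechet_derivative (\<lambda>x. v) (at (snd c p))"
    proof (rule frechet_derivative_cong_open[OF open_chart_range[OF is_chart[OF c(1)]]])
      show "snd c p \<in> snd c ` fst c" using c by simp
      show "field_rep A c (extend A p v) x = v" if "x \<in> snd c ` fst c" for x
        using that c(1) by (simp add: field_rep_def extend_def c_def[symmetric])
    qed
    then show ?thesis by simp
  qed
  ultimately show ?thesis
    by (simp add: nabla_J_def nabla_def field_deriv_def ext christoffel_eq_chris c_def[symmetric])
qed

lemma has_covd_J:
  assumes v: "has_velocity \<sigma> t v" and V: "has_covd A g \<sigma> V t X"
  shows "has_covd A g \<sigma> (\<lambda>s. J (\<sigma> s) (V s)) t (nabla_J A g J (\<sigma> t) v (V t) + J (\<sigma> t) X)"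
proof -
  let ?c = "chart_at A (\<sigma> t)"
  let ?x = "\<lambda>s. snd ?c (\<sigma> s)"
  have c: "?c \<in> A" "\<sigma> t \<in> fst ?c" by auto
  have x: "?x t \<in> snd ?c ` fst ?c" by simp
  have vel: "velocity A \<sigma> t = v" by (rule has_velocity_velocity[OF v])
  obtain U where U: "open U" "t \<in> U" "\<And>s. s \<in> U \<Longrightarrow> \<sigma> s \<in> fst ?c"
    using isCont_open_vimage[OF has_velocity_isCont[OF v] open_chart_domain[OF is_chart[OF c(1)]] c(2)] by blast
  have x': "(?x has_vector_derivative v) (at t)" using v by (simp add: has_velocity_def o_def)
  have V': "((\<lambda>s. coord A ?c (\<sigma> s) (V s)) has_vector_derivative (X - chris ?c (?x t) v (V t))) (at t)"
    using V vel by (simp add: has_covd_iff covd_in_chart_def)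
  have lin: "\<forall>\<^sub>F s in nhds t. linear (J_rep ?c (?x s))"
    unfolding eventually_nhds using U J_rep_linear[OF c(1)] by (intro exI[of _ U]) auto
  have J': "((\<lambda>s. J_rep ?c (?x s) w) has_vector_derivative frechet_derivative (\<lambda>x. J_rep ?c x w) (at (?x t)) v) (at t)" for w
    by (rule has_vector_derivative_compose_derivative[OF smooth_on_has_derivative[OF J_rep_smooth[OF c(1)] x] x'])
  have Jt: "J_rep ?c (?x t) w = J (\<sigma> t) w" for w by (simp add: J_rep_def)
  have D: "((\<lambda>s. J_rep ?c (?x s) (coord A ?c (\<sigma> s) (V s))) has_vector_derivative
      (nabla_J A g J (\<sigma> t) v (V t) + J (\<sigma> t) X - chris ?c (?x t) v (J (\<sigma> t) (V t)))) (at t)"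
    using linear_family_has_vector_derivative[OF lin J' V']
    by (simp add: Jt nabla_J_eq J_simps algebra_simps)
  have "((\<lambda>s. coord A ?c (\<sigma> s) (J (\<sigma> s) (V s))) has_vector_derivative
      (nabla_J A g J (\<sigma> t) v (V t) + J (\<sigma> t) X - chris ?c (?x t) v (J (\<sigma> t) (V t)))) (at t)"
    by (rule has_vector_derivative_transform_within_open[OF D U(1,2)]) (use U(3) c(1) in \<open>simp add: J_rep_def\<close>)
  then show ?thesis by (simp add: has_covd_iff covd_in_chart_def vel)
qed

lemma nabla_J_bilinear: "bilinear (nabla_J A g J p)"
proof -
  let ?c = "chart_at A p"
  let ?x = "snd ?c p"
  have c: "?c \<in> A" and x: "?x \<in> snd ?c ` fst ?c" by auto
  note bil = chris_bilinear[OF c x]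
  note op = open_chart_range[OF is_chart[OF c]]
  have dJ: "((\<lambda>x. J_rep ?c x v) has_derivative frechet_derivative (\<lambda>x. J_rep ?c x v) (at ?x)) (at ?x)" for v
    by (rule smooth_on_has_derivative[OF J_rep_smooth[OF c] x])
  have lin1: "linear (frechet_derivative (\<lambda>x. J_rep ?c x v) (at ?x))" for v
    using dJ has_derivative_linear by blast
  have add: "frechet_derivative (\<lambda>x. J_rep ?c x (v + w)) (at ?x) =
      (\<lambda>u. frechet_derivative (\<lambda>x. J_rep ?c x v) (at ?x) u + frechet_derivative (\<lambda>x. J_rep ?c x w) (at ?x) u)" for v w
    by (rule frechet_derivative_at[symmetric], rule has_derivative_transform_within_open[OF has_derivative_add[OF dJ dJ] op x])
      (simp add: linear_add[OF J_rep_linear[OF c]])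
  have scale: "frechet_derivative (\<lambda>x. J_rep ?c x (k *\<^sub>R v)) (at ?x) =
      (\<lambda>u. k *\<^sub>R frechet_derivative (\<lambda>x. J_rep ?c x v) (at ?x) u)" for k v
    by (rule frechet_derivative_at[symmetric], rule has_derivative_transform_within_open[OF has_derivative_scaleR_right[OF dJ] op x])
      (simp add: linear_cmul[OF J_rep_linear[OF c]])
  show ?thesis
    unfolding bilinear_def nabla_J_eq
    by (auto intro!: linearI simp: add scale linear_add[OF lin1] linear_cmul[OF lin1] J_simps
        bilinear_ladd[OF bil] bilinear_radd[OF bil] bilinear_lmul[OF bil] bilinear_rmul[OF bil] algebra_simps)
qed

text \<open>A supremum dominates the members of its set once the set is bounded; bilinearity and the
  comparison of norms supply the bound.\<close>

lemma nabla_J_le_tensor_norm: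
  assumes "gnorm g p u \<le> 1" "gnorm g p v \<le> 1"
  shows "gnorm g p (nabla_J A g J p u v) \<le> tensor_norm2 g p (nabla_J A g J p)"
  unfolding tensor_norm2_def
proof (rule cSup_upper)
  obtain C where C: "C \<ge> 0" "\<And>v. norm v \<le> C * gnorm g p v" using norm_le_gnorm by blast
  obtain C' where C': "C' \<ge> 0" "\<And>v. gnorm g p v \<le> C' * norm v" using gnorm_le_norm by blast
  define B where "B = (\<Sum>i\<in>(Basis :: 'e set). \<Sum>j\<in>(Basis :: 'e set). norm (nabla_J A g J p i j))"
  have B: "B \<ge> 0" unfolding B_def by (intro sum_nonneg) auto
  show "bdd_above {gnorm g p (nabla_J A g J p u v) |u v. gnorm g p u \<le> 1 \<and> gnorm g p v \<le> 1}"
  proof (rule bdd_aboveI[of _ "C' * (B * (C * C))"], clarify)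
    fix u v assume uv: "gnorm g p u \<le> 1" "gnorm g p v \<le> 1"
    have n: "norm w \<le> C" if "gnorm g p w \<le> 1" for w
      using C(2)[of w] mult_left_mono[OF that C(1)] by simp
    have "gnorm g p (nabla_J A g J p u v) \<le> C' * norm (nabla_J A g J p u v)" by (rule C')
    also have "\<dots> \<le> C' * (B * (norm u * norm v))"
      using bilinear_bound_Basis[OF nabla_J_bilinear, of p u v] C'(1) unfolding B_def by (intro mult_left_mono)
    also have "\<dots> \<le> C' * (B * (C * C))"
      using n[OF uv(1)] n[OF uv(2)] B C'(1) C(1) by (intro mult_left_mono mult_mono) auto
    finally show "gnorm g p (nabla_J A g J p u v) \<le> C' * (B * (C * C))" .
  qed
qed (use assms in blast)

lemma nabla_J_decay_bound:
  obtains C R where "C \<ge> 0" "R > 0"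
    "\<And>p r. p \<in> frontier K \<Longrightarrow> r \<ge> R \<Longrightarrow>
      gnorm g (E r p) (nabla_J A g J (E r p) (ray_velocity p r) (ray_velocity p r)) \<le> C * exp (- a * r)"
proof -
  obtain C where C: "C > 0" "\<forall>\<^sub>F q in filtercomap (distance_to A g K) at_top.
      norm (tensor_norm2 g q (nabla_J A g J q)) \<le> C * norm (exp (- a * distance_to A g K q))"
    using nabla_J_decay by (elim landau_o.bigE)
  then obtain R where R: "\<And>q. distance_to A g K q \<ge> R \<Longrightarrow>
      norm (tensor_norm2 g q (nabla_J A g J q)) \<le> C * norm (exp (- a * distance_to A g K q))"
    unfolding eventually_filtercomap_at_top_linorder by blast
  show thesis
  \<comment> \<open>The maximum with 1 keeps \<open>r\<close> positive, where the distance from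
    \<open>E r p\<close> to \<open>K\<close> is known to be \<open>r\<close>.\<close>
  proof (rule that[of C "max R 1"])
    fix p r assume p: "p \<in> frontier K" and r: "max R 1 \<le> r"
    then have dist: "distance_to A g K (E r p) = r" by (intro distance_E) auto
    have "gnorm g (E r p) (ray_velocity p r) = 1" using ray_unit_speed[OF p] by (simp add: gnorm_def)
    then have "gnorm g (E r p) (nabla_J A g J (E r p) (ray_velocity p r) (ray_velocity p r))
        \<le> tensor_norm2 g (E r p) (nabla_J A g J (E r p))"
      by (intro nabla_J_le_tensor_norm) auto
    also have "\<dots> \<le> C * exp (- a * r)" using R[of "E r p"] r by (simp add: dist)
    finally show "gnorm g (E r p) (nabla_J A g J (E r p) (ray_velocity p r) (ray_velocity p r)) \<le> C * exp (- a * r)" .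
  qed (use C in auto)
qed

section \<open>The limit of the rotated radial direction in parallel frames\<close>

abbreviation transport :: "'m \<Rightarrow> real \<Rightarrow> 'e \<Rightarrow> 'e" where
  "transport p r \<equiv> parallel_transport A g (\<lambda>s. E s p) r"

lemma beta_r_eq:
  "p \<in> frontier K \<Longrightarrow> r > 0 \<Longrightarrow>
    beta_r A g J K \<nu> r p v = g (E r p) (J (E r p) (ray_velocity p r)) (transport p r v)"
  by (simp add: beta_r_def radial_transport_def d_r_eq Let_def)

lemma ray_velocity_transport: "ray_velocity p r = transport p r (\<nu> p)"
  using parallel_transport_eq[OF smooth_ray[of p] ray_velocity_parallel, of r] by (simp add: ray_velocity_0)

lemma gnorm_transport: "gnorm g (E r p) (transport p r v) = gnorm g p v"
  using parallel_transport_isometry[OF smooth_ray[of p], of r v v] by (simp add: gnorm_def)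

text \<open>The component of J\<partial>_r along a parallel field has a derivative of order e^{-ar},
  so it converges, with an error of the same order. The limits form \<beta>, which is represented by
  a vector \<open>b\<close>. The constants come before \<open>p\<close> because the decay of
  \<nabla>J is uniform over the boundary.\<close>

lemma J_radial_limit:
  obtains C R where "C \<ge> 0" "R > 0"
    "\<And>p. p \<in> frontier K \<Longrightarrow> \<exists>b. b \<in> bdry_tangent A K p \<and> g p b b = 1 \<and> (\<forall>v. beta A g J K \<nu> p v = g p b v) \<and>
      (\<forall>r\<ge>R. gnorm g (E r p) (J (E r p) (ray_velocity p r) - transport p r b) \<le> C * exp (- a * r))"
proof -
  obtain C R where CR: "C \<ge> 0" "R > 0"
    "\<And>p r. p \<in> frontier K \<Longrightarrow> r \<ge> R \<Longrightarrow>
      gnorm g (E r p) (nabla_J A g J (E r p) (ray_velocity p r) (ray_velocity p r)) \<le> C * exp (- a * r)"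
    using nabla_J_decay_bound by metis
  have a0: "a > 0" using a_gt_1 by simp
  show thesis
  proof (rule that[of "C / a" R])
    fix p assume p: "p \<in> frontier K"
    let ?X = "\<lambda>r. J (E r p) (ray_velocity p r)"
    define f where "f v r = g (E r p) (?X r) (transport p r v)" for v r
    have f': "(f v has_vector_derivative
        g (E r p) (nabla_J A g J (E r p) (ray_velocity p r) (ray_velocity p r)) (transport p r v)) (at r)" for v r
    proof -
      have "has_covd A g (\<lambda>s. E s p) (ray_velocity p) r 0"
        using ray_velocity_parallel by (simp add: parallel_on_def)
      from has_covd_J[OF ray_has_velocity this]
      have X: "has_covd A g (\<lambda>s. E s p) ?X r (nabla_J A g J (E r p) (ray_velocity p r) (ray_velocity p r))"
        by (simp add: linear_0[OF J_linear])
      have P: "has_covd A g (\<lambda>s. E s p) (\<lambda>s. transport p s v) r 0"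
        using parallel_transport_parallel(1)[OF smooth_ray] by (simp add: parallel_on_def)
      show ?thesis using has_covd_metric[OF ray_has_velocity X P] by (simp add: f_def[abs_def])
    qed
    have "\<bar>f v t - f v s\<bar> \<le> (C / a * gnorm g p v) * exp (- a * s)" if st: "R \<le> s" "s \<le> t" for v s t
    proof (cases "s = t")
      case True
      then show ?thesis using CR(1) a0 by simp
    next
      case False
      then have "s < t" using st by simp
      \<comment> \<open>An antiderivative of the bound on the derivative, and the origin of the
        factor 1/a.\<close>
      let ?\<phi> = "\<lambda>r. - (C / a * gnorm g p v) * exp (- a * r)"
      have \<phi>': "(?\<phi> has_vector_derivative C * gnorm g p v * exp (- a * r)) (at r)" for r
        unfolding has_real_derivative_iff_has_vector_derivative[symmetric]
        using a0 by (auto intro!: derivative_eq_intros)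
      have "norm (f v t - f v s) \<le> ?\<phi> t - ?\<phi> s"
      proof (rule differentiable_bound_general[OF \<open>s < t\<close> _ _ f' \<phi>'])
        show "continuous_on {s..t} (f v)"
          using f' has_vector_derivative_continuous by (intro continuous_at_imp_continuous_on) blast
        show "continuous_on {s..t} ?\<phi>" by (intro continuous_intros)
        fix r assume r: "s < r" "r < t"
        have "norm (g (E r p) (nabla_J A g J (E r p) (ray_velocity p r) (ray_velocity p r)) (transport p r v))
          \<le> gnorm g (E r p) (nabla_J A g J (E r p) (ray_velocity p r) (ray_velocity p r)) * gnorm g (E r p) (transport p r v)"
          using g_cauchy_schwarz by simp
        also have "\<dots> \<le> (C * exp (- a * r)) * gnorm g p v"
          unfolding gnorm_transport using CR(3)[OF p, of r] r st by (intro mult_right_mono) auto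
        finally show "norm (g (E r p) (nabla_J A g J (E r p) (ray_velocity p r) (ray_velocity p r)) (transport p r v))
          \<le> C * gnorm g p v * exp (- a * r)" by (simp add: ac_simps)
      qed
      also have "\<dots> \<le> (C / a * gnorm g p v) * exp (- a * s)"
        using CR(1) a0 by simp
      finally show ?thesis by simp
    qed
    then have "\<exists>L. (f v \<longlongrightarrow> L) at_top \<and> (\<forall>t\<ge>R. \<bar>f v t - L\<bar> \<le> (C / a * gnorm g p v) * exp (- a * t))" for v
      by (rule exp_cauchy_imp_limit[OF a0])
    then obtain L where L: "\<And>v. (f v \<longlongrightarrow> L v) at_top"
      "\<And>v t. t \<ge> R \<Longrightarrow> \<bar>f v t - L v\<bar> \<le> (C / a * gnorm g p v) * exp (- a * t)"
      by metis
    have \<beta>: "beta A g J K \<nu> p v = L v" for v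
    proof -
      have "((\<lambda>r. beta_r A g J K \<nu> r p v) \<longlongrightarrow> L v) at_top"
        by (rule Lim_transform_eventually[OF L(1)], rule eventually_mono[OF eventually_gt_at_top[of 0]])
          (simp add: f_def beta_r_eq[OF p])
      then show ?thesis unfolding beta_def by (intro tendsto_Lim) simp
    qed
    note linP = linear_parallel_transport[OF smooth_ray[of p]]
    have "linear L"
    proof (rule linearI)
      fix u v and k :: real
      have "((\<lambda>r. f u r + f v r) \<longlongrightarrow> L u + L v) at_top" by (intro tendsto_add L)
      moreover have "(\<lambda>r. f u r + f v r) = f (u + v)" by (simp add: fun_eq_iff f_def linear_add[OF linP])
      ultimately show "L (u + v) = L u + L v" using L(1) tendsto_unique[OF trivial_limit_at_top_linorder] by metis
      have "((\<lambda>r. k * f v r) \<longlongrightarrow> k * L v) at_top" by (intro tendsto_mult_left L)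
      moreover have "(\<lambda>r. k * f v r) = f (k *\<^sub>R v)" by (simp add: fun_eq_iff f_def linear_cmul[OF linP])
      ultimately have "L (k *\<^sub>R v) = k * L v" using L(1) tendsto_unique[OF trivial_limit_at_top_linorder] by metis
      then show "L (k *\<^sub>R v) = k *\<^sub>R L v" by simp
    qed
    from positive_definite_riesz[OF g_bilinear g_pos this, of p]
    obtain b where b: "\<And>v. g p b v = L v" by metis
    have close: "gnorm g (E r p) (?X r - transport p r b) \<le> C / a * exp (- a * r)" if r: "r \<ge> R" for r
    proof -
      let ?w = "?X r - transport p r b"
      \<comment> \<open>The error vector is itself the transport of some \<open>u\<close>. Testing
        with this \<open>u\<close> turns the estimates of components into an estimate of the
        length.\<close>
      obtain u where u: "?w = transport p r u" using surj_parallel_transport[OF smooth_ray[of p], of r] by (metis surjD)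
      have "(gnorm g (E r p) ?w)\<^sup>2 = g (E r p) ?w (transport p r u)" by (simp only: gnorm_sq u)
      also have "\<dots> = f u r - g p b u"
        using parallel_transport_isometry[OF smooth_ray[of p], of r b u] by (simp add: f_def)
      also have "\<dots> \<le> (C / a * gnorm g p u) * exp (- a * r)" using L(2)[OF r, of u] b by simp
      also have "gnorm g p u = gnorm g (E r p) ?w" by (simp only: u gnorm_transport)
      finally have le: "(gnorm g (E r p) ?w)\<^sup>2 \<le> (C / a * exp (- a * r)) * gnorm g (E r p) ?w" by (simp add: ac_simps)
      show ?thesis
      proof (cases "gnorm g (E r p) ?w = 0")
        case True
        then show ?thesis using CR(1) a0 by simp
      next
        case False
        then have "gnorm g (E r p) ?w > 0" by (simp add: less_le)
        with le show ?thesis unfolding power2_eq_square by (rule mult_right_le_imp_le)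
      qed
    qed
    \<comment> \<open>\<open>J\<close> and parallel transport are isometries, so the length of
      \<open>b\<close> differs from 1 by at most the error, for every large
      \<open>r\<close>.\<close>
    have "gnorm g p b = 1"
    proof -
      have e0: "((\<lambda>r. C / a * exp (- a * r)) \<longlongrightarrow> 0) at_top" by (rule exp_decay_tendsto_0[OF a0])
      have "\<bar>1 - gnorm g p b\<bar> \<le> C / a * exp (- a * r)" if r: "r \<ge> R" for r
      proof -
        have X1: "gnorm g (E r p) (?X r) = 1" using ray_unit_speed[OF p] by (simp add: gnorm_def)
        have "gnorm g (E r p) (?X r) \<le> gnorm g (E r p) (?X r - transport p r b) + gnorm g (E r p) (transport p r b)"
          using gnorm_triangle[of "E r p" "?X r - transport p r b" "transport p r b"] by simp
        moreover have "gnorm g (E r p) (transport p r b) \<le> gnorm g (E r p) (?X r - transport p r b) + gnorm g (E r p) (?X r)"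
          using gnorm_triangle[of "E r p" "(-1) *\<^sub>R (?X r - transport p r b)" "?X r"]
          unfolding gnorm_scale by (simp add: algebra_simps)
        ultimately show ?thesis using close[OF r] unfolding X1 gnorm_transport by linarith
      qed
      then have "\<forall>\<^sub>F r in at_top. \<bar>1 - gnorm g p b\<bar> \<le> C / a * exp (- a * r)"
        by (rule eventually_mono[OF eventually_ge_at_top[of R]])
      then have "\<bar>1 - gnorm g p b\<bar> \<le> 0" by (rule tendsto_lowerbound[OF e0]) simp
      then show ?thesis by simp
    qed
    then have "g p b b = 1" using gnorm_sq[of p b] by simp
    moreover have "b \<in> bdry_tangent A K p"
    proof -
      \<comment> \<open>\<partial>_r is the transported normal and J\<partial>_r is orthogonal to
        it, so the limit form vanishes on the normal and \<open>b\<close> is tangent to the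
        boundary.\<close>
      have "f (\<nu> p) = (\<lambda>r. 0)" by (simp add: fun_eq_iff f_def ray_velocity_transport[symmetric])
      then have "L (\<nu> p) = 0" using L(1)[of "\<nu> p"] tendsto_const_iff[OF trivial_limit_at_top_linorder] by metis
      then show ?thesis using b[of "\<nu> p"] by (simp add: bdry_tangent_iff[OF p] g_sym)
    qed
    ultimately show "\<exists>b. b \<in> bdry_tangent A K p \<and> g p b b = 1 \<and> (\<forall>v. beta A g J K \<nu> p v = g p b v) \<and>
      (\<forall>r\<ge>R. gnorm g (E r p) (?X r - transport p r b) \<le> C / a * exp (- a * r))"
      using close b \<beta> by (intro exI[of _ b]) auto
  qed (use CR a0 in auto)
qed

text \<open>The part of a competitor \<open>e\<close> orthogonal to \<open>b\<close> lies in the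
  kernel of \<beta>, so \<open>e\<close> is orthogonal to it and equals a multiple \<open>k\<close>
  of \<open>b\<close>. Unit length and the sign condition leave \<open>k = 1\<close>.\<close>

lemma e0_eq:
  assumes p: "p \<in> frontier K" and b: "b \<in> bdry_tangent A K p" "g p b b = 1" "\<And>v. beta A g J K \<nu> p v = g p b v"
  shows "e0 A g J K \<nu> p = b"
  unfolding e0_def
proof (rule the_equality)
  fix e assume e: "e \<in> bdry_tangent A K p \<and> g p e e = 1 \<and>
     (\<forall>v\<in>bdry_tangent A K p. beta A g J K \<nu> p v = 0 \<longrightarrow> g p e v = 0) \<and> beta A g J K \<nu> p e > 0"
  define k where "k = g p b e"
  note T = subspace_bdry_tangent[OF p]
  let ?v = "e - k *\<^sub>R b"
  have v: "?v \<in> bdry_tangent A K p" using e b T by (intro subspace_diff subspace_scale) auto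
  have bv: "g p b ?v = 0" using b(2) by (simp add: k_def)
  then have ev: "g p e ?v = 0" using e v b(3) by auto
  then have "1 - k * k = 0" using e g_sym[of p e b] by (simp add: k_def)
  have "k > 0" using e b(3) by (simp add: k_def)
  have "g p ?v ?v = 0"
    by (simp only: bilinear_lsub[OF g_bilinear] bilinear_lmul[OF g_bilinear] ev bv) simp
  then have "?v = 0" by (simp only: g_eq_0_iff)
  moreover have "k = 1"
  proof -
    have "(k - 1) * (k + 1) = 0" using \<open>1 - k * k = 0\<close> by (simp add: algebra_simps)
    then show ?thesis using \<open>k > 0\<close> by simp
  qed
  ultimately show "e = b" by simp
qed (use b in auto)

lemma E0_close:
  obtains C R where "C \<ge> 0" "R > 0"
    "\<And>p r. p \<in> frontier K \<Longrightarrow> r \<ge> R \<Longrightarrow>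
      gnorm g (E r p) (J (E r p) (ray_velocity p r) - E0 A g J K \<nu> r p) \<le> C * exp (- a * r)"
proof -
  obtain C R where CR: "C \<ge> 0" "R > 0"
    "\<And>p. p \<in> frontier K \<Longrightarrow> \<exists>b. b \<in> bdry_tangent A K p \<and> g p b b = 1 \<and> (\<forall>v. beta A g J K \<nu> p v = g p b v) \<and>
      (\<forall>r\<ge>R. gnorm g (E r p) (J (E r p) (ray_velocity p r) - transport p r b) \<le> C * exp (- a * r))"
    using J_radial_limit by metis
  have "gnorm g (E r p) (J (E r p) (ray_velocity p r) - E0 A g J K \<nu> r p) \<le> C * exp (- a * r)"
    if p: "p \<in> frontier K" and r: "r \<ge> R" for p r
  proof -
    obtain b where b: "b \<in> bdry_tangent A K p" "g p b b = 1" "\<And>v. beta A g J K \<nu> p v = g p b v"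
      "\<And>r. r \<ge> R \<Longrightarrow> gnorm g (E r p) (J (E r p) (ray_velocity p r) - transport p r b) \<le> C * exp (- a * r)"
      using CR(3)[OF p] by blast
    have "E0 A g J K \<nu> r p = transport p r b"
      using e0_eq[OF p b(1,2,3)] by (simp add: E0_def radial_transport_def)
    then show ?thesis using b(4)[OF r] by simp
  qed
  with CR(1,2) show thesis by (rule that)
qed

end

section \<open>The limit tensors\<close>

locale limit_tensors = hermitian_collar A g K \<nu> J a
  for A :: "('m::t2_space, 'e::euclidean_space) chart set" and g and K :: "'m set" and \<nu> :: "'m \<Rightarrow> 'e"
    and J and a +
  fixes \<eta>0 :: "'m \<Rightarrow> 'e \<Rightarrow> real" and \<gamma> :: "'m \<Rightarrow> 'e \<Rightarrow> 'e \<Rightarrow> real" and \<phi> :: "'m \<Rightarrow> 'e \<Rightarrow> 'e" and p :: 'm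
  assumes eta_lim: "unif_lim_form A g K (eta_r A g J K \<nu>) \<eta>0"
    and gamma_lim: "unif_lim_bilin A g K (gamma_r A g J K \<nu>) \<gamma>"
    and phi_lim: "unif_lim_endo A g K (phi_r A g J K \<nu>) \<phi>"
    and p: "p \<in> frontier K"
begin

abbreviation "T \<equiv> bdry_tangent A K p"
abbreviation "D r \<equiv> d_exp A g K \<nu> r p"
abbreviation "X r \<equiv> J (E r p) (ray_velocity p r)"
abbreviation "\<eta>r r \<equiv> eta_r A g J K \<nu> r p"
abbreviation "\<gamma>r r \<equiv> gamma_r A g J K \<nu> r p"
abbreviation "\<phi>r r \<equiv> phi_r A g J K \<nu> r p"

lemma T: "subspace T" by (rule subspace_bdry_tangent[OF p])

text \<open>Orthogonal projection onto the tangent space of the boundary. Composition with it turns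
  maps that are linear only on \<open>T\<close> into linear maps of the whole model space, which are
  continuous.\<close>

definition proj_T :: "'e \<Rightarrow> 'e" where "proj_T v = v - g p (\<nu> p) v *\<^sub>R \<nu> p"

lemma proj_T_in: "proj_T v \<in> T"
  using normal_unit[OF p] by (simp add: proj_T_def bdry_tangent_iff[OF p])

lemma proj_T_id: "v \<in> T \<Longrightarrow> proj_T v = v"
  by (simp add: proj_T_def bdry_tangent_iff[OF p])

lemma linear_proj_T: "linear proj_T"
  by (auto intro!: linearI simp: proj_T_def scaleR_left_distrib algebra_simps)

lemma tendsto_on_T:
  fixes h :: "'e \<Rightarrow> 'b::real_normed_vector"
  assumes add: "\<And>u v. u \<in> T \<Longrightarrow> v \<in> T \<Longrightarrow> h (u + v) = h u + h v"
    and scale: "\<And>k v. v \<in> T \<Longrightarrow> h (k *\<^sub>R v) = k *\<^sub>R h v"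
    and y: "(y \<longlongrightarrow> l) Fl" "\<forall>\<^sub>F x in Fl. y x \<in> T" "l \<in> T"
  shows "((\<lambda>x. h (y x)) \<longlongrightarrow> h l) Fl"
proof -
  have "linear (\<lambda>v. h (proj_T v))"
    by (rule linearI) (simp_all add: linear_add[OF linear_proj_T] linear_cmul[OF linear_proj_T] add scale proj_T_in)
  then have "((\<lambda>x. h (proj_T (y x))) \<longlongrightarrow> h (proj_T l)) Fl"
    by (rule bounded_linear.tendsto[OF linear_conv_bounded_linear[THEN iffD1] y(1)])
  then have "((\<lambda>x. h (proj_T (y x))) \<longlongrightarrow> h l) Fl" by (simp only: proj_T_id[OF y(3)])
  then show ?thesis
    by (rule Lim_transform_eventually) (use y(2) in \<open>auto elim!: eventually_mono simp: proj_T_id\<close>)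
qed

lemma closed_T: "closed T" by (rule closed_subspace[OF T])

section \<open>Uniform limits at moving vectors\<close>

lemma eta_diff_tendsto:
  assumes y: "(y \<longlongrightarrow> l) at_top" "\<forall>\<^sub>F r in at_top. y r \<in> T"
  shows "((\<lambda>r. \<eta>r r (y r) - \<eta>0 p (y r)) \<longlongrightarrow> 0) at_top"
proof (rule tendsto_zero_of_uniform[OF _ gnorm_tendsto[OF y(1), of p]])
  fix \<epsilon> :: real assume "\<epsilon> > 0"
  then have "\<forall>\<^sub>F r in at_top. \<forall>p\<in>frontier K. \<forall>v\<in>bdry_tangent A K p. \<bar>eta_r A g J K \<nu> r p v - \<eta>0 p v\<bar> \<le> \<epsilon> * gnorm g p v"
    using eta_lim by (simp add: unif_lim_form_def)
  with y(2) show "\<forall>\<^sub>F r in at_top. norm (\<eta>r r (y r) - \<eta>0 p (y r)) \<le> \<epsilon> * gnorm g p (y r)"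
    by eventually_elim (use p in auto)
qed

lemma phi_diff_tendsto:
  assumes y: "(y \<longlongrightarrow> l) at_top" "\<forall>\<^sub>F r in at_top. y r \<in> T"
  shows "((\<lambda>r. \<phi>r r (y r) - \<phi> p (y r)) \<longlongrightarrow> 0) at_top"
proof -
  have "((\<lambda>r. gnorm g p (\<phi>r r (y r) - \<phi> p (y r))) \<longlongrightarrow> 0) at_top"
  proof (rule tendsto_zero_of_uniform[OF _ gnorm_tendsto[OF y(1), of p]])
    fix \<epsilon> :: real assume "\<epsilon> > 0"
    then have "\<forall>\<^sub>F r in at_top. \<forall>p\<in>frontier K. \<forall>v\<in>bdry_tangent A K p.
        gnorm g p (phi_r A g J K \<nu> r p v - \<phi> p v) \<le> \<epsilon> * gnorm g p v"
      using phi_lim by (simp add: unif_lim_endo_def)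
    with y(2) show "\<forall>\<^sub>F r in at_top. norm (gnorm g p (\<phi>r r (y r) - \<phi> p (y r))) \<le> \<epsilon> * gnorm g p (y r)"
      by eventually_elim (use p in auto)
  qed
  then show ?thesis using gnorm_tendsto_iff[of "\<lambda>r. \<phi>r r (y r) - \<phi> p (y r)" 0 at_top p] by simp
qed

lemma gamma_diff_tendsto:
  assumes y: "(y \<longlongrightarrow> l) at_top" "\<forall>\<^sub>F r in at_top. y r \<in> T"
    and z: "(z \<longlongrightarrow> k) at_top" "\<forall>\<^sub>F r in at_top. z r \<in> T"
  shows "((\<lambda>r. \<gamma>r r (y r) (z r) - \<gamma> p (y r) (z r)) \<longlongrightarrow> 0) at_top"
proof (rule tendsto_zero_of_uniform[OF _ tendsto_mult[OF gnorm_tendsto[OF y(1), of p] gnorm_tendsto[OF z(1), of p]]])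
  fix \<epsilon> :: real assume "\<epsilon> > 0"
  then have "\<forall>\<^sub>F r in at_top. \<forall>p\<in>frontier K. \<forall>u\<in>bdry_tangent A K p. \<forall>v\<in>bdry_tangent A K p.
      \<bar>gamma_r A g J K \<nu> r p u v - \<gamma> p u v\<bar> \<le> \<epsilon> * (gnorm g p u * gnorm g p v)"
    using gamma_lim by (simp add: unif_lim_bilin_def)
  with y(2) z(2) show "\<forall>\<^sub>F r in at_top. norm (\<gamma>r r (y r) (z r) - \<gamma> p (y r) (z r)) \<le> \<epsilon> * (gnorm g p (y r) * gnorm g p (z r))"
    by eventually_elim (use p in auto)
qed

lemma eta_tendsto: "v \<in> T \<Longrightarrow> ((\<lambda>r. \<eta>r r v) \<longlongrightarrow> \<eta>0 p v) at_top"
  using eta_diff_tendsto[OF tendsto_const, of v] by (simp add: LIM_zero_iff)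

lemma phi_tendsto: "v \<in> T \<Longrightarrow> ((\<lambda>r. \<phi>r r v) \<longlongrightarrow> \<phi> p v) at_top"
  using phi_diff_tendsto[OF tendsto_const, of v] by (simp add: LIM_zero_iff)

lemma gamma_tendsto: "u \<in> T \<Longrightarrow> v \<in> T \<Longrightarrow> ((\<lambda>r. \<gamma>r r u v) \<longlongrightarrow> \<gamma> p u v) at_top"
  using gamma_diff_tendsto[OF tendsto_const _ tendsto_const, of u v] by (simp add: LIM_zero_iff)

section \<open>The pulled back structures at a finite radius\<close>

lemma D_lin:
  assumes "r \<ge> 0" "u \<in> T" "v \<in> T"
  shows "D r (u + v) = D r u + D r v" "D r (k *\<^sub>R u) = k *\<^sub>R D r u" "D r (u - v) = D r u - D r v"
proof -
  obtain h where h: "linear h" "\<And>v. v \<in> T \<Longrightarrow> D r v = h v" using d_exp_linear_rep[OF p assms(1)] by metis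
  show "D r (u + v) = D r u + D r v" "D r (k *\<^sub>R u) = k *\<^sub>R D r u" "D r (u - v) = D r u - D r v"
    using assms subspace_add[OF T] subspace_scale[OF T] subspace_diff[OF T] h
    by (simp_all add: linear_add linear_cmul linear_diff)
qed

lemma eta_r_lin:
  assumes "r \<ge> 0" "u \<in> T" "v \<in> T"
  shows "\<eta>r r (u + v) = \<eta>r r u + \<eta>r r v" "\<eta>r r (k *\<^sub>R u) = k * \<eta>r r u"
  using D_lin[OF assms] by (simp_all add: eta_r_def algebra_simps)

lemma gamma_r_lin:
  assumes "r \<ge> 0" "u \<in> T" "v \<in> T"
  shows "\<gamma>r r (u + v) w = \<gamma>r r u w + \<gamma>r r v w" "\<gamma>r r (k *\<^sub>R u) w = k * \<gamma>r r u w"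
    "\<gamma>r r w (u + v) = \<gamma>r r w u + \<gamma>r r w v" "\<gamma>r r w (k *\<^sub>R u) = k * \<gamma>r r w u"
  using D_lin[OF assms] eta_r_lin[OF assms] by (simp_all add: gamma_r_def g_r_def algebra_simps)

context
  fixes r :: real assumes r: "r > 0"
begin

lemma d_r: "d_r A g K (E r p) = ray_velocity p r" by (rule d_r_eq[OF p r])

lemma D_orth: "v \<in> T \<Longrightarrow> g (E r p) (D r v) (ray_velocity p r) = 0"
  using gauss[OF p, of v r] r by (simp add: g_sym)

lemma Phi_eq: "g (E r p) w (ray_velocity p r) = 0 \<Longrightarrow>
    Phi A g J K (E r p) w = J (E r p) w + g (E r p) w (X r) *\<^sub>R ray_velocity p r"
  by (simp add: Phi_def proj_r_def d_r J_skew[of _ w])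

text \<open>\<open>Phi\<close> keeps the orthogonal complement of \<partial>_r, which is the image
  of \<open>D r\<close>, so the inverse in \<open>phi_r\<close> is a genuine one.\<close>

lemma phi_r_in: "v \<in> T \<Longrightarrow> \<phi>r r v \<in> T"
  and D_phi_r: "v \<in> T \<Longrightarrow> D r (\<phi>r r v) = J (E r p) (D r v) + g (E r p) (D r v) (X r) *\<^sub>R ray_velocity p r"
proof -
  assume v: "v \<in> T"
  let ?w = "Phi A g J K (E r p) (D r v)"
  have w: "?w = J (E r p) (D r v) + g (E r p) (D r v) (X r) *\<^sub>R ray_velocity p r"
    by (rule Phi_eq[OF D_orth[OF v]])
  have "g (E r p) ?w (ray_velocity p r) = 0"
    unfolding w using ray_unit_speed[OF p, of r] by (simp add: J_skew)
  then have im: "?w \<in> D r ` T" using d_exp_bij[OF p r] by (simp add: bij_betw_def)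
  show "\<phi>r r v \<in> T" unfolding phi_r_def by (rule inv_into_into[OF im])
  show "D r (\<phi>r r v) = J (E r p) (D r v) + g (E r p) (D r v) (X r) *\<^sub>R ray_velocity p r"
    unfolding phi_r_def f_inv_into_f[OF im] by (rule w)
qed

lemma D_inj: "u \<in> T \<Longrightarrow> v \<in> T \<Longrightarrow> D r u = D r v \<Longrightarrow> u = v"
  using d_exp_bij[OF p r] unfolding bij_betw_def inj_on_def by blast

lemma phi_r_lin:
  assumes "u \<in> T" "v \<in> T"
  shows "\<phi>r r (u + v) = \<phi>r r u + \<phi>r r v" "\<phi>r r (k *\<^sub>R u) = k *\<^sub>R \<phi>r r u"
proof -
  have r0: "r \<ge> 0" using r by simp
  have uv: "u + v \<in> T" "k *\<^sub>R u \<in> T" using assms subspace_add[OF T] subspace_scale[OF T] by auto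
  have im: "\<phi>r r u \<in> T" "\<phi>r r v \<in> T" using phi_r_in assms by auto
  show "\<phi>r r (u + v) = \<phi>r r u + \<phi>r r v"
    by (rule D_inj[OF phi_r_in[OF uv(1)] subspace_add[OF T im]])
      (simp add: D_phi_r uv assms D_lin[OF r0 im] D_lin[OF r0 assms] J_simps scaleR_left_distrib)
  show "\<phi>r r (k *\<^sub>R u) = k *\<^sub>R \<phi>r r u"
    by (rule D_inj[OF phi_r_in[OF uv(2)] subspace_scale[OF T im(1)]])
      (simp add: D_phi_r uv assms D_lin[OF r0 im] D_lin[OF r0 assms] J_simps scaleR_right_distrib)
qed

lemma phi_r_orth: "v \<in> T \<Longrightarrow> g (E r p) (D r (\<phi>r r v)) (X r) = 0"
  unfolding D_phi_r using D_orth by simp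

lemma phi_r_inner:
  assumes "u \<in> T" "v \<in> T"
  shows "g (E r p) (D r (\<phi>r r u)) (D r (\<phi>r r v)) =
    g (E r p) (D r u) (D r v) - g (E r p) (D r u) (X r) * g (E r p) (D r v) (X r)"
proof -
  let ?q = "E r p" and ?d = "ray_velocity p r"
  have s: "g ?q ?d (J ?q (D r v)) = - g ?q (D r v) (X r)"
    using J_skew[of ?q "D r v" ?d] g_sym[of ?q ?d "J ?q (D r v)"] by simp
  show ?thesis
    unfolding D_phi_r[OF assms(1)] D_phi_r[OF assms(2)]
    using ray_unit_speed[OF p, of r] s by (simp add: J_skew[of ?q "D r u" ?d] algebra_simps)
qed

lemma phi_r_norm: "v \<in> T \<Longrightarrow> gnorm g (E r p) (D r (\<phi>r r v)) \<le> gnorm g (E r p) (D r v)"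
  unfolding gnorm_def by (rule real_sqrt_le_mono) (simp add: phi_r_inner)

text \<open>\<open>\<xi>\<close> is the pullback of J\<partial>_r. That one vector serves for all
  \<open>v\<close> is what later allows its behaviour to be read off from a single
  \<open>v\<close>.\<close>

lemma phi_r_phi_r: "\<exists>\<xi>\<in>T. \<forall>v\<in>T. \<phi>r r (\<phi>r r v) + v = g (E r p) (D r v) (X r) *\<^sub>R \<xi>"
proof -
  have r0: "r \<ge> 0" using r by simp
  have "X r \<in> D r ` T" using d_exp_bij[OF p r] by (simp add: bij_betw_def J_skew)
  then obtain \<xi> where \<xi>: "\<xi> \<in> T" "X r = D r \<xi>" by auto
  have "\<phi>r r (\<phi>r r v) + v = g (E r p) (D r v) (X r) *\<^sub>R \<xi>" if v: "v \<in> T" for v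
  proof (rule D_inj)
    have im: "\<phi>r r v \<in> T" "\<phi>r r (\<phi>r r v) \<in> T" using v phi_r_in by auto
    show "\<phi>r r (\<phi>r r v) + v \<in> T" by (rule subspace_add[OF T im(2) v])
    show "g (E r p) (D r v) (X r) *\<^sub>R \<xi> \<in> T" by (rule subspace_scale[OF T \<xi>(1)])
    have "D r (\<phi>r r (\<phi>r r v) + v) = g (E r p) (D r v) (X r) *\<^sub>R X r"
      using phi_r_orth[OF v] by (simp add: D_lin[OF r0 im(2) v] D_phi_r[OF im(1)] D_phi_r[OF v] J_simps)
    also have "\<dots> = D r (g (E r p) (D r v) (X r) *\<^sub>R \<xi>)"
      using D_lin(2)[OF r0 \<xi>(1) \<xi>(1)] \<xi>(2) by simp
    finally show "D r (\<phi>r r (\<phi>r r v) + v) = D r (g (E r p) (D r v) (X r) *\<^sub>R \<xi>)" .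
  qed
  with \<xi>(1) show ?thesis by blast
qed

end

section \<open>Algebra of the limit tensors\<close>

lemma phi_in: "v \<in> T \<Longrightarrow> \<phi> p v \<in> T"
  by (rule Lim_in_closed_set[OF closed_T _ _ phi_tendsto])
    (auto intro!: eventually_mono[OF eventually_gt_at_top[of 0]] phi_r_in)

lemma eta_lin:
  assumes "u \<in> T" "v \<in> T"
  shows "\<eta>0 p (u + v) = \<eta>0 p u + \<eta>0 p v" "\<eta>0 p (k *\<^sub>R u) = k * \<eta>0 p u"
proof -
  have uv: "u + v \<in> T" "k *\<^sub>R u \<in> T" using assms subspace_add[OF T] subspace_scale[OF T] by auto
  show "\<eta>0 p (u + v) = \<eta>0 p u + \<eta>0 p v"
    by (rule limit_unique_ev[OF eta_tendsto[OF uv(1)] tendsto_add[OF eta_tendsto[OF assms(1)] eta_tendsto[OF assms(2)]]])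
      (simp add: eta_r_lin assms)
  show "\<eta>0 p (k *\<^sub>R u) = k * \<eta>0 p u"
    by (rule limit_unique_ev[OF eta_tendsto[OF uv(2)] tendsto_mult_left[OF eta_tendsto[OF assms(1)]]])
      (simp add: eta_r_lin[OF _ assms])
qed

lemma phi_lin:
  assumes "u \<in> T" "v \<in> T"
  shows "\<phi> p (u + v) = \<phi> p u + \<phi> p v" "\<phi> p (k *\<^sub>R u) = k *\<^sub>R \<phi> p u"
proof -
  have uv: "u + v \<in> T" "k *\<^sub>R u \<in> T" using assms subspace_add[OF T] subspace_scale[OF T] by auto
  show "\<phi> p (u + v) = \<phi> p u + \<phi> p v"
    by (rule limit_unique_ev[OF phi_tendsto[OF uv(1)] tendsto_add[OF phi_tendsto[OF assms(1)] phi_tendsto[OF assms(2)]]])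
      (rule phi_r_lin[OF _ assms])
  show "\<phi> p (k *\<^sub>R u) = k *\<^sub>R \<phi> p u"
    by (rule limit_unique_ev[OF phi_tendsto[OF uv(2)] tendsto_scaleR[OF tendsto_const phi_tendsto[OF assms(1)]]])
      (rule phi_r_lin[OF _ assms])
qed

lemma gamma_lin:
  assumes "u \<in> T" "v \<in> T" "w \<in> T"
  shows "\<gamma> p (u + v) w = \<gamma> p u w + \<gamma> p v w" "\<gamma> p (k *\<^sub>R u) w = k * \<gamma> p u w"
    "\<gamma> p w (u + v) = \<gamma> p w u + \<gamma> p w v" "\<gamma> p w (k *\<^sub>R u) = k * \<gamma> p w u"
proof -
  have uv: "u + v \<in> T" "k *\<^sub>R u \<in> T" using assms subspace_add[OF T] subspace_scale[OF T] by auto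
  note t = gamma_tendsto
  show "\<gamma> p (u + v) w = \<gamma> p u w + \<gamma> p v w"
    by (rule limit_unique_ev[OF t[OF uv(1) assms(3)] tendsto_add[OF t[OF assms(1,3)] t[OF assms(2,3)]]])
      (simp add: gamma_r_lin[OF _ assms(1,2)])
  show "\<gamma> p (k *\<^sub>R u) w = k * \<gamma> p u w"
    by (rule limit_unique_ev[OF t[OF uv(2) assms(3)] tendsto_mult_left[OF t[OF assms(1,3)]]])
      (simp add: gamma_r_lin[OF _ assms(1,2)])
  show "\<gamma> p w (u + v) = \<gamma> p w u + \<gamma> p w v"
    by (rule limit_unique_ev[OF t[OF assms(3) uv(1)] tendsto_add[OF t[OF assms(3,1)] t[OF assms(3,2)]]])
      (simp add: gamma_r_lin[OF _ assms(1,2)])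
  show "\<gamma> p w (k *\<^sub>R u) = k * \<gamma> p w u"
    by (rule limit_unique_ev[OF t[OF assms(3) uv(2)] tendsto_mult_left[OF t[OF assms(3,1)]]])
      (simp add: gamma_r_lin[OF _ assms(1,2)])
qed

section \<open>Passage to the limit in compositions\<close>

lemma eta_phi_tendsto:
  assumes v: "v \<in> T"
  shows "((\<lambda>r. \<eta>r r (\<phi>r r v)) \<longlongrightarrow> \<eta>0 p (\<phi> p v)) at_top"
proof -
  have ev: "\<forall>\<^sub>F r in at_top. \<phi>r r v \<in> T" by (rule ev_pos) (rule phi_r_in[OF _ v])
  have "((\<lambda>r. \<eta>0 p (\<phi>r r v)) \<longlongrightarrow> \<eta>0 p (\<phi> p v)) at_top"
    by (rule tendsto_on_T[OF _ _ phi_tendsto[OF v] ev phi_in[OF v]]) (simp_all add: eta_lin)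
  from tendsto_add[OF eta_diff_tendsto[OF phi_tendsto[OF v] ev] this] show ?thesis by simp
qed

lemma phi_phi_tendsto:
  assumes v: "v \<in> T"
  shows "((\<lambda>r. \<phi>r r (\<phi>r r v)) \<longlongrightarrow> \<phi> p (\<phi> p v)) at_top"
proof -
  have ev: "\<forall>\<^sub>F r in at_top. \<phi>r r v \<in> T" by (rule ev_pos) (rule phi_r_in[OF _ v])
  have "((\<lambda>r. \<phi> p (\<phi>r r v)) \<longlongrightarrow> \<phi> p (\<phi> p v)) at_top"
    by (rule tendsto_on_T[OF _ _ phi_tendsto[OF v] ev phi_in[OF v]]) (simp_all add: phi_lin)
  from tendsto_add[OF phi_diff_tendsto[OF phi_tendsto[OF v] ev] this] show ?thesis by simp
qed

lemma gamma_phi_tendsto: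
  assumes u: "u \<in> T" and v: "v \<in> T"
  shows "((\<lambda>r. \<gamma>r r (\<phi>r r u) (\<phi>r r v)) \<longlongrightarrow> \<gamma> p (\<phi> p u) (\<phi> p v)) at_top"
proof -
  have ev: "\<forall>\<^sub>F r in at_top. \<phi>r r w \<in> T" if "w \<in> T" for w by (rule ev_pos) (rule phi_r_in[OF _ that])
  have bil: "bilinear (\<lambda>x y. \<gamma> p (proj_T x) (proj_T y))"
    unfolding bilinear_def
    by (auto intro!: linearI simp: linear_add[OF linear_proj_T] linear_cmul[OF linear_proj_T]
        gamma_lin[OF proj_T_in proj_T_in proj_T_in])
  have "((\<lambda>r. \<gamma> p (proj_T (\<phi>r r u)) (proj_T (\<phi>r r v))) \<longlongrightarrow> \<gamma> p (proj_T (\<phi> p u)) (proj_T (\<phi> p v))) at_top"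
    using bounded_bilinear.tendsto[OF bilinear_conv_bounded_bilinear[THEN iffD1, OF bil] phi_tendsto[OF u] phi_tendsto[OF v]] .
  then have lim: "((\<lambda>r. \<gamma> p (proj_T (\<phi>r r u)) (proj_T (\<phi>r r v))) \<longlongrightarrow> \<gamma> p (\<phi> p u) (\<phi> p v)) at_top"
    by (simp only: proj_T_id phi_in u v)
  have "((\<lambda>r. \<gamma> p (\<phi>r r u) (\<phi>r r v)) \<longlongrightarrow> \<gamma> p (\<phi> p u) (\<phi> p v)) at_top"
    by (rule Lim_transform_eventually[OF lim ev_pos]) (simp add: proj_T_id phi_r_in u v)
  from tendsto_add[OF gamma_diff_tendsto[OF phi_tendsto[OF u] ev[OF u] phi_tendsto[OF v] ev[OF v]] this]
  show ?thesis by simp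
qed

text \<open>Solving the definition of \<gamma>_r for g_r gives e^{-2r} g_r(v, v) = e^{-r}
  \<gamma>_r(v, v) + \<eta>_r(v)^2, and the first term tends to 0.\<close>

lemma D_growth:
  assumes v: "v \<in> T"
  shows "((\<lambda>r. exp (- r) * gnorm g (E r p) (D r v)) \<longlongrightarrow> \<bar>\<eta>0 p v\<bar>) at_top"
proof -
  have e0: "((\<lambda>r::real. exp (- r)) \<longlongrightarrow> 0) at_top" using exp_decay_tendsto_0[of 1 1] by simp
  have "((\<lambda>r. sqrt (exp (- r) * \<gamma>r r v v + \<eta>r r v * \<eta>r r v)) \<longlongrightarrow> sqrt (0 * \<gamma> p v v + \<eta>0 p v * \<eta>0 p v)) at_top"
    by (intro tendsto_intros e0 gamma_tendsto eta_tendsto v)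
  moreover have "sqrt (exp (- r) * \<gamma>r r v v + \<eta>r r v * \<eta>r r v) = exp (- r) * gnorm g (E r p) (D r v)" for r
  proof -
    have "exp (- r) * \<gamma>r r v v + \<eta>r r v * \<eta>r r v = (exp (- r))\<^sup>2 * g (E r p) (D r v) (D r v)"
    proof -
      have e: "exp (- r) * exp (- r) * exp (2 * r) = 1" by (simp flip: exp_add)
      have "exp (- r) * \<gamma>r r v v + \<eta>r r v * \<eta>r r v = exp (- r) * exp (- r) * g (E r p) (D r v) (D r v)
          - (exp (- r) * exp (- r) * exp (2 * r)) * (\<eta>r r v * \<eta>r r v) + \<eta>r r v * \<eta>r r v"
        unfolding gamma_r_def g_r_def by algebra
      then show ?thesis unfolding e by (simp add: power2_eq_square)
    qed
    then show ?thesis by (simp add: real_sqrt_mult gnorm_def)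
  qed
  ultimately show ?thesis by simp
qed

text \<open>Replacing J\<partial>_r by \<open>E0\<close> costs at most |D v| times C e^{-ar}. The
  vectors \<open>w\<close> are general because both \<open>D r v\<close> and
  \<open>D r (\<phi>r r v)\<close> will be inserted; the factors \<open>exp r\<close> and
  \<open>exp (- r)\<close> let the second term match \<open>eta_r\<close>.\<close>

lemma E0_error_tendsto:
  assumes bound: "\<And>r. r > 0 \<Longrightarrow> gnorm g (E r p) (w r) \<le> gnorm g (E r p) (D r v)" and v: "v \<in> T"
  shows "((\<lambda>r. g (E r p) (w r) (X r) - exp r * (exp (- r) * g (E r p) (w r) (E0 A g J K \<nu> r p))) \<longlongrightarrow> 0) at_top"
proof -
  obtain C R where CR: "C \<ge> 0" "R > 0"
    "\<And>r. r \<ge> R \<Longrightarrow> gnorm g (E r p) (X r - E0 A g J K \<nu> r p) \<le> C * exp (- a * r)"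
    using E0_close p by metis
  have a1: "a - 1 > 0" using a_gt_1 by simp
  have lim: "((\<lambda>r. (exp (- r) * gnorm g (E r p) (D r v)) * (C * exp (- (a - 1) * r))) \<longlongrightarrow> \<bar>\<eta>0 p v\<bar> * 0) at_top"
    by (intro tendsto_mult D_growth v exp_decay_tendsto_0[OF a1])
  show ?thesis
  proof (rule Lim_null_comparison)
    show "\<forall>\<^sub>F r in at_top. norm (g (E r p) (w r) (X r) - exp r * (exp (- r) * g (E r p) (w r) (E0 A g J K \<nu> r p)))
        \<le> (exp (- r) * gnorm g (E r p) (D r v)) * (C * exp (- (a - 1) * r))"
      using eventually_ge_at_top[of R]
    proof eventually_elim
      case (elim r)
      have eq: "g (E r p) (w r) (X r) - exp r * (exp (- r) * g (E r p) (w r) (E0 A g J K \<nu> r p)) =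
          g (E r p) (w r) (X r - E0 A g J K \<nu> r p)"
        by (simp add: exp_cancel)
      have "norm (g (E r p) (w r) (X r) - exp r * (exp (- r) * g (E r p) (w r) (E0 A g J K \<nu> r p))) \<le>
          gnorm g (E r p) (w r) * gnorm g (E r p) (X r - E0 A g J K \<nu> r p)"
        unfolding eq real_norm_def by (rule g_cauchy_schwarz)
      also have "\<dots> \<le> gnorm g (E r p) (D r v) * (C * exp (- a * r))"
        using bound[of r] CR(2) CR(3)[OF elim] elim by (intro mult_mono) auto
      also have "\<dots> = (exp (- r) * gnorm g (E r p) (D r v)) * (C * exp (- (a - 1) * r))"
        by (simp add: algebra_simps flip: exp_add)
      finally show ?case .
    qed
    show "((\<lambda>r. (exp (- r) * gnorm g (E r p) (D r v)) * (C * exp (- (a - 1) * r))) \<longlongrightarrow> 0) at_top"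
      using lim by simp
  qed
qed

lemma X_component_close:
  "v \<in> T \<Longrightarrow> ((\<lambda>r. g (E r p) (D r v) (X r) - exp r * \<eta>r r v) \<longlongrightarrow> 0) at_top"
  using E0_error_tendsto[of "\<lambda>r. D r v" v] by (simp add: eta_r_def)

text \<open>The image of \<open>\<phi>r r v\<close> under \<open>D r\<close> is exactly orthogonal
  to J\<partial>_r, so only the replacement error remains. The factor \<open>exp r\<close> is
  retained because \<gamma>_r contains the square of \<eta>_r with weight e^r.\<close>

lemma eta_phi_decay:
  assumes v: "v \<in> T"
  shows "((\<lambda>r. exp r * \<eta>r r (\<phi>r r v)) \<longlongrightarrow> 0) at_top"
proof -
  have "((\<lambda>r. g (E r p) (D r (\<phi>r r v)) (X r) - exp r * \<eta>r r (\<phi>r r v)) \<longlongrightarrow> 0) at_top"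
    using E0_error_tendsto[of "\<lambda>r. D r (\<phi>r r v)" v] phi_r_norm v by (simp add: eta_r_def)
  then have "((\<lambda>r. - (exp r * \<eta>r r (\<phi>r r v))) \<longlongrightarrow> 0) at_top"
    by (rule Lim_transform_eventually) (rule ev_pos, simp add: phi_r_orth v)
  from tendsto_minus[OF this] show ?thesis by simp
qed

lemma exp_neg_tendsto: "((\<lambda>r::real. exp (- r)) \<longlongrightarrow> 0) at_top"
  using exp_decay_tendsto_0[of 1 1] by simp

lemma eta_phi:
  assumes v: "v \<in> T"
  shows "\<eta>0 p (\<phi> p v) = 0"
proof -
  have "((\<lambda>r. exp (- r) * (exp r * \<eta>r r (\<phi>r r v))) \<longlongrightarrow> 0 * 0) at_top"
    by (intro tendsto_mult exp_neg_tendsto eta_phi_decay v)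
  then have "((\<lambda>r. \<eta>r r (\<phi>r r v)) \<longlongrightarrow> 0) at_top" by (simp add: exp_cancel)
  then show ?thesis using eta_phi_tendsto[OF v] tendsto_unique[OF trivial_limit_at_top_linorder] by blast
qed

lemma X_component_tendsto:
  assumes v: "v \<in> T"
  shows "((\<lambda>r. exp (- r) * g (E r p) (D r v) (X r)) \<longlongrightarrow> \<eta>0 p v) at_top"
proof -
  have "((\<lambda>r. exp (- r) * (g (E r p) (D r v) (X r) - exp r * \<eta>r r v) + \<eta>r r v) \<longlongrightarrow> 0 * 0 + \<eta>0 p v) at_top"
    by (intro tendsto_add tendsto_mult exp_neg_tendsto X_component_close eta_tendsto v)
  then show ?thesis by (simp add: right_diff_distrib exp_cancel)
qed

text \<open>All vectors see the same scaled direction \<open>exp r *\<^sub>R \<xi> r\<close>, with a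
  coefficient that tends to the value of \<open>\<eta>0 p\<close>. Division by the coefficient of
  \<open>w\<close> shows that this direction converges; for \<open>v\<close> in the kernel the
  coefficient tends to 0, and with it the product.\<close>

lemma phi_phi:
  assumes w: "w \<in> T" "\<eta>0 p w \<noteq> 0" and v: "v \<in> T" "\<eta>0 p v = 0"
  shows "\<phi> p (\<phi> p v) = - v"
proof -
  obtain \<xi> where \<xi>: "\<And>r v. r > 0 \<Longrightarrow> v \<in> T \<Longrightarrow> \<phi>r r (\<phi>r r v) + v = g (E r p) (D r v) (X r) *\<^sub>R \<xi> r"
    using phi_r_phi_r by metis
  define y where "y v r = exp (- r) * g (E r p) (D r v) (X r)" for v r
  have y: "(y v \<longlongrightarrow> \<eta>0 p v) at_top" if "v \<in> T" for v
    unfolding y_def by (rule X_component_tendsto[OF that])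
  have eq: "\<phi>r r (\<phi>r r v) + v = y v r *\<^sub>R (exp r *\<^sub>R \<xi> r)" if "r > 0" "v \<in> T" for r v
    using \<xi>[OF that] by (simp add: y_def exp_cancel mult.assoc mult.commute[of _ "exp r"])
  have L: "((\<lambda>r. \<phi>r r (\<phi>r r v) + v) \<longlongrightarrow> \<phi> p (\<phi> p v) + v) at_top" if "v \<in> T" for v
    by (intro tendsto_add phi_phi_tendsto that tendsto_const)
  have ne: "\<forall>\<^sub>F r in at_top. y w r \<noteq> 0"
    using tendsto_imp_eventually_ne[OF y[OF w(1)] w(2)] .
  have "((\<lambda>r. inverse (y w r) *\<^sub>R (\<phi>r r (\<phi>r r w) + w)) \<longlongrightarrow> inverse (\<eta>0 p w) *\<^sub>R (\<phi> p (\<phi> p w) + w)) at_top"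
    by (intro tendsto_scaleR tendsto_inverse y L w)
  then have "((\<lambda>r. exp r *\<^sub>R \<xi> r) \<longlongrightarrow> inverse (\<eta>0 p w) *\<^sub>R (\<phi> p (\<phi> p w) + w)) at_top"
  proof (rule Lim_transform_eventually)
    show "\<forall>\<^sub>F r in at_top. inverse (y w r) *\<^sub>R (\<phi>r r (\<phi>r r w) + w) = exp r *\<^sub>R \<xi> r"
      using ne eventually_gt_at_top[of 0] by eventually_elim (simp add: eq w(1))
  qed
  from tendsto_scaleR[OF y[OF v(1)] this]
  have "((\<lambda>r. y v r *\<^sub>R (exp r *\<^sub>R \<xi> r)) \<longlongrightarrow> 0) at_top" using v(2) by simp
  from limit_unique_ev[OF L[OF v(1)] this] eq v(1) have "\<phi> p (\<phi> p v) + v = 0" by blast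
  then show ?thesis by (simp add: eq_neg_iff_add_eq_0)
qed

text \<open>Under \<phi>_r the form g_r loses x(u) x(v), where x is the component along
  J\<partial>_r. This differs from the term e^{2r} \<eta>_r(u) \<eta>_r(v) that \<gamma>_r subtracts
  by an error that vanishes after scaling, so the invariance holds on the whole tangent
  space.\<close>

lemma gamma_phi:
  assumes u: "u \<in> T" and v: "v \<in> T"
  shows "\<gamma> p (\<phi> p u) (\<phi> p v) = \<gamma> p u v"
proof -
  let ?x = "\<lambda>v r. g (E r p) (D r v) (X r)"
  \<comment> \<open>The difference of the two values of \<gamma>_r, arranged so that every summand
    has a factor tending to 0 while its other factors converge. The difference of the products x(u)
    x(v) and e^{2r} \<eta>_r(u) \<eta>_r(v) is split by changing one factor at a time.\<close>
  let ?h = "\<lambda>r. - ((exp (- r) * ?x u r) * (?x v r - exp r * \<eta>r r v) + (?x u r - exp r * \<eta>r r u) * \<eta>r r v)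
      - exp (- r) * ((exp r * \<eta>r r (\<phi>r r u)) * (exp r * \<eta>r r (\<phi>r r v)))"
  have limh: "(?h \<longlongrightarrow> - (\<eta>0 p u * 0 + 0 * \<eta>0 p v) - 0 * (0 * 0)) at_top"
    by (intro tendsto_diff tendsto_minus tendsto_add tendsto_mult X_component_tendsto X_component_close
        eta_tendsto exp_neg_tendsto eta_phi_decay u v)
  have limg: "((\<lambda>r. \<gamma>r r (\<phi>r r u) (\<phi>r r v) - \<gamma>r r u v) \<longlongrightarrow> \<gamma> p (\<phi> p u) (\<phi> p v) - \<gamma> p u v) at_top"
    by (intro tendsto_diff gamma_phi_tendsto gamma_tendsto u v)
  have eq: "\<gamma>r r (\<phi>r r u) (\<phi>r r v) - \<gamma>r r u v = ?h r" if r: "r > 0" for r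
  proof -
    have e: "exp (2 * r) = exp r * exp r" by (simp flip: exp_add)
    have *: "exp (- r) * exp r = 1" by (simp flip: exp_add)
    show ?thesis
      unfolding gamma_r_def g_r_def phi_r_inner[OF r u v] e using * by algebra
  qed
  have "\<gamma> p (\<phi> p u) (\<phi> p v) - \<gamma> p u v = - (\<eta>0 p u * 0 + 0 * \<eta>0 p v) - 0 * (0 * 0)"
    by (rule limit_unique_ev[OF limg limh eq])
  then show ?thesis by simp
qed

lemma complex_structure_kernel:
  assumes w: "w \<in> T" "\<eta>0 p w \<noteq> 0"
  shows "complex_structure_on (form_kernel A K \<eta>0 p) (\<phi> p)"
proof -
  have "\<eta>0 p 0 = 0" using eta_lin(2)[OF w(1,1), of 0] by simp
  then have "subspace (form_kernel A K \<eta>0 p)"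
    unfolding subspace_def form_kernel_def
    using subspace_0[OF T] subspace_add[OF T] subspace_scale[OF T] by (auto simp: eta_lin)
  then show ?thesis
    unfolding complex_structure_on_def
    using phi_in eta_phi phi_lin phi_phi[OF w] by (auto simp: form_kernel_def)
qed

end

theorem theorem4p5:
  fixes A :: "('m::{t2_space,second_countable_topology}, 'e::euclidean_space) chart set"
    and g :: "'m \<Rightarrow> 'e \<Rightarrow> 'e \<Rightarrow> real" and J :: "'m \<Rightarrow> 'e \<Rightarrow> 'e"
    and K :: "'m set" and \<nu> :: "'m \<Rightarrow> 'e" and a :: real
    and \<eta>0 :: "'m \<Rightarrow> 'e \<Rightarrow> real" and \<gamma> :: "'m \<Rightarrow> 'e \<Rightarrow> 'e \<Rightarrow> real" and \<phi> :: "'m \<Rightarrow> 'e \<Rightarrow> 'e"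
  assumes manifold: "smooth_atlas A"
    and hermitian: "almost_hermitian A g J"
    and complete: "complete_metric A g"
    and noncompact: "\<not> compact (UNIV :: 'm set)"
    and dimension: "DIM('e) \<ge> 4"
    and essential: "essential_subset A g K \<nu>"
    and normal_exp_diffeo:
      "diffeo_between (prod_atlas real_atlas A) A ({0..} \<times> frontier K) (closure (- K))
         (\<lambda>(r, p). normal_exp A g \<nu> r p)"
    and a_gt_1: "a > 1"
    and curvature_decay:
      "(\<lambda>p. tensor_norm3 g p (\<lambda>u v w. curv A g p u v w - R0 g J p u v w))
         \<in> O[filtercomap (distance_to A g K) at_top](\<lambda>p. exp (- a * distance_to A g K p))"
    and nabla_J_decay:
      "(\<lambda>p. tensor_norm2 g p (nabla_J A g J p))
         \<in> O[filtercomap (distance_to A g K) at_top](\<lambda>p. exp (- a * distance_to A g K p))"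
    and eta_lim: "unif_lim_form A g K (eta_r A g J K \<nu>) \<eta>0"
    and gamma_lim: "unif_lim_bilin A g K (gamma_r A g J K \<nu>) \<gamma>"
    and phi_lim: "unif_lim_endo A g K (phi_r A g J K \<nu>) \<phi>"
    and eta_nonvanishing: "\<forall>p\<in>frontier K. \<exists>v\<in>bdry_tangent A K p. \<eta>0 p v \<noteq> 0"
  shows "\<forall>p\<in>frontier K.
           complex_structure_on (form_kernel A K \<eta>0 p) (\<phi> p) \<and>
           (\<forall>u\<in>form_kernel A K \<eta>0 p. \<forall>v\<in>form_kernel A K \<eta>0 p.
              \<gamma> p (\<phi> p u) (\<phi> p v) = \<gamma> p u v)"
proof
  fix p assume p: "p \<in> frontier K"
  interpret limit_tensors A g K \<nu> J a \<eta>0 \<gamma> \<phi> p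
    using assms p by unfold_locales (auto simp: almost_hermitian_def)
  obtain w where "w \<in> bdry_tangent A K p" "\<eta>0 p w \<noteq> 0" using eta_nonvanishing p by blast
  then show "complex_structure_on (form_kernel A K \<eta>0 p) (\<phi> p) \<and>
      (\<forall>u\<in>form_kernel A K \<eta>0 p. \<forall>v\<in>form_kernel A K \<eta>0 p. \<gamma> p (\<phi> p u) (\<phi> p v) = \<gamma> p u v)"
    using complex_structure_kernel gamma_phi by (auto simp: form_kernel_def)
qed

end
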